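(* Let $1\le q<2$ and let $\Omega\subset\mathbb{R}^N$ be an open set with positive spectrum, i.e. $\lambda_1(\Omega)>0$. Let $w_{q,\Omega}$ be the Lane-Emden $q$-density of $\Omega$. Then for every $\varphi\in C^\infty_0(\Omega)$ and every $\delta>0$ we have \[ \frac{1}{\delta}\left(1-\frac{1}{\delta}\right)\int_\Omega \left|\frac{\nabla w_{q,\Omega}}{w_{q,\Omega}}\right|^2\varphi^2\,dx+\frac{1}{\delta}\int_\Omega\frac{\varphi^2}{w^{2-q}_{q,\Omega}}\,dx\le \int_\Omega |\nabla \varphi|^2\,dx. \]
   Context: $\lambda_1(\Omega)=\inf\left\{\int_\Omega|\nabla\varphi|^2\,dx : \varphi\in C^\infty_0(\Omega),\ \|\varphi\|_{L^2(\Omega)}=1\right\}$. Lane-Emden density: for an open set $U\subset\mathbb{R}^N$, $\mathcal{D}^{1,2}_0(U)$ is the completion of $C^\infty_0(U)$ with respect to the norm $\left(\int_U|\nabla\varphi|^2dx\right)^{1/2}$. If $U$ is open and bounded and $1\le q<2$, $w_{q,U}$ denotes the unique minimizer of $\frac12\int_U|\nabla\varphi|^2dx-\frac1q\int_U\varphi^q\,dx$ among $\varphi\in\mathcal{D}^{1,2}_0(U)$ with $\varphi\ge0$ a.e. in $U$ (extended by $0$ outside $U$). For a general open set $\Omega$, put $\Omega_R=\Omega\cap B_R(0)$ and define $w_{q,\Omega}=\lim_{R\to+\infty}w_{q,\Omega_R}$ pointwise (the family is monotone nondecreasing in $R$). When $\lambda_1(\Omega)>0$, $\nabla w_{q,\Omega}$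 denotes the distributional gradient, which belongs to $L^2_{\rm loc}(\Omega)$. *)

theory Defs
  imports "HOL-Analysis.Analysis"
begin

text \<open>
  The space \<open>\<real>\<^sup>N\<close> is an arbitrary \<open>'a::euclidean_space\<close>, with \<open>N = DIM('a)\<close>.
  All integrals are taken with respect to the (complete) Lebesgue measure.
\<close>

section \<open>Test functions\<close>

definition partial_deriv :: "('a::euclidean_space \<Rightarrow> real) \<Rightarrow> 'a \<Rightarrow> 'a \<Rightarrow> real" where
  "partial_deriv f b x = frechet_derivative f (at x) b"

primrec C_k :: "nat \<Rightarrow> ('a::euclidean_space \<Rightarrow> real) \<Rightarrow> bool" where
  "C_k 0 f \<longleftrightarrow> continuous_on UNIV f"
| "C_k (Suc k) f \<longleftrightarrow>
     (\<forall>x. f differentiable (at x)) \<and> (\<forall>b\<in>Basis. C_k k (partial_deriv f b))"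

text \<open>An element of \<open>C\<^sub>0\<^sup>\<infinity>(U)\<close> is a smooth function on the whole space (that is, already
  extended by 0) whose support is a compact subset of \<open>U\<close>.\<close>

definition C0_inf :: "'a::euclidean_space set \<Rightarrow> ('a \<Rightarrow> real) set" where
  "C0_inf U = {f. (\<forall>k. C_k k f) \<and> compact (closure {x. f x \<noteq> 0}) \<and> closure {x. f x \<noteq> 0} \<subseteq> U}"

definition grad :: "('a::euclidean_space \<Rightarrow> real) \<Rightarrow> 'a \<Rightarrow> 'a" where
  "grad f x = (\<Sum>b\<in>Basis. partial_deriv f b x *\<^sub>R b)"

text \<open>The infimum is taken in the extended reals, so that it is \<open>\<infinity>\<close> for \<open>U = {}\<close>.\<close>

definition lambda1 :: "'a::euclidean_space set \<Rightarrow> ereal" where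
  "lambda1 U = (INF f\<in>{f \<in> C0_inf U. sqrt (LINT x:U|lebesgue. (f x)\<^sup>2) = 1}.
     ereal (LINT x:U|lebesgue. (norm (grad f x))\<^sup>2))"

section \<open>The Lane-Emden density\<close>

text \<open>
  \<open>D12_0 U u g\<close>: the function \<open>u\<close> belongs to \<open>\<D>\<^sub>0\<^sup>1\<^sup>,\<^sup>2(U)\<close> and has gradient \<open>g\<close>.
  This is meant for bounded open \<open>U\<close> only. There, by the Poincare inequality, a sequence
  of test functions which is Cauchy in the norm \<open>\<parallel>\<nabla>f\<parallel>\<close> of \<open>L\<^sup>2\<close> also converges
  in \<open>L\<^sup>2\<close>, and so the completion is the space of \<open>L\<^sup>2\<close> limits of such sequences. The integrals
  are over the whole space, so \<open>u\<close> and \<open>g\<close> vanish almost everywhere outside \<open>U\<close>.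
\<close>

definition D12_0 :: "'a::euclidean_space set \<Rightarrow> ('a \<Rightarrow> real) \<Rightarrow> ('a \<Rightarrow> 'a) \<Rightarrow> bool" where
  "D12_0 U u g \<longleftrightarrow>
     u \<in> borel_measurable lebesgue \<and> g \<in> borel_measurable lebesgue \<and>
     (\<exists>f. (\<forall>n::nat. f n \<in> C0_inf U) \<and>
        (\<lambda>n. \<integral>\<^sup>+x. ennreal ((f n x - u x)\<^sup>2) \<partial>lebesgue) \<longlonglongrightarrow> 0 \<and>
        (\<lambda>n. \<integral>\<^sup>+x. ennreal ((norm (grad (f n) x - g x))\<^sup>2) \<partial>lebesgue) \<longlonglongrightarrow> 0)"

definition lane_emden_energy ::
  "real \<Rightarrow> 'a::euclidean_space set \<Rightarrow> ('a \<Rightarrow> real) \<Rightarrow> ('a \<Rightarrow> 'a) \<Rightarrow> real" where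
  "lane_emden_energy q U u g =
     1 / 2 * (LINT x:U|lebesgue. (norm (g x))\<^sup>2) - 1 / q * (LINT x:U|lebesgue. u x powr q)"

definition lane_emden_minimizer :: "real \<Rightarrow> 'a::euclidean_space set \<Rightarrow> ('a \<Rightarrow> real) \<Rightarrow> bool" where
  "lane_emden_minimizer q U u \<longleftrightarrow>
     (\<exists>g. D12_0 U u g \<and> (AE x\<in>U in lebesgue. 0 \<le> u x) \<and>
        (\<forall>v h. D12_0 U v h \<and> (AE x\<in>U in lebesgue. 0 \<le> v x) \<longrightarrow>
           lane_emden_energy q U u g \<le> lane_emden_energy q U v h))"

text \<open>
  \<open>w\<close> is (a representative of) the density of the open set \<open>\<Omega>\<close>. The minimizers are only determined
  almost everywhere, so a representative \<open>W R\<close> is chosen for each radius \<open>R\<close>; the class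
  of \<open>w\<close> does not depend on this choice. As an increasing limit, \<open>w\<close> could a priori be infinite.
\<close>

definition lane_emden_density ::
  "real \<Rightarrow> 'a::euclidean_space set \<Rightarrow> ('a \<Rightarrow> ennreal) \<Rightarrow> bool" where
  "lane_emden_density q \<Omega> w \<longleftrightarrow>
     (\<exists>W. (\<forall>R>0. lane_emden_minimizer q (\<Omega> \<inter> ball 0 R) (W R)) \<and>
        (AE x\<in>\<Omega> in lebesgue. ((\<lambda>R::real. ennreal (W R x)) \<longlongrightarrow> w x) at_top))"

definition has_distributional_gradient ::
  "'a::euclidean_space set \<Rightarrow> ('a \<Rightarrow> real) \<Rightarrow> ('a \<Rightarrow> 'a) \<Rightarrow> bool" where
  "has_distributional_gradient \<Omega> u g \<longleftrightarrow>
     (\<forall>K. compact K \<and> K \<subseteq> \<Omega> \<longrightarrow> set_integrable lebesgue K u \<and> set_integrable lebesgue K g) \<and>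
     (\<forall>f\<in>C0_inf \<Omega>. (LINT x:\<Omega>|lebesgue. u x *\<^sub>R grad f x) = - (LINT x:\<Omega>|lebesgue. f x *\<^sub>R g x))"

definition ennreal_powr :: "ennreal \<Rightarrow> real \<Rightarrow> ennreal" where  (* for positive exponents only *)
  "ennreal_powr a p = (if a = \<infinity> then \<infinity> else ennreal (enn2real a powr p))"

end

theory Submission
  imports Defs
begin

text \<open>
  The inequality is what one gets by testing the Lane-Emden equation \<open>-\<Delta>w = w\<^sup>q\<^sup>-\<^sup>1\<close> with \<open>\<phi>\<^sup>2/w\<close>:
  since the gradient of \<open>\<phi>\<^sup>2/w\<close> is \<open>2\<phi>\<nabla>\<phi>/w - \<phi>\<^sup>2\<nabla>w/w\<^sup>2\<close>,
  \<open>\<integral> \<phi>\<^sup>2/w\<^sup>2\<^sup>-\<^sup>q + \<integral> \<phi>\<^sup>2|\<nabla>w/w|\<^sup>2 = 2 \<integral> \<nabla>\<phi> \<bullet> (\<phi>\<nabla>w/w)\<close>, and Young's inequality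
  \<open>2 a \<bullet> b \<le> \<delta>|a|\<^sup>2 + |b|\<^sup>2/\<delta>\<close> bounds the right-hand side by \<open>\<delta> \<integral> |\<nabla>\<phi>|\<^sup>2 + (1/\<delta>) \<integral> \<phi>\<^sup>2|\<nabla>w/w|\<^sup>2\<close>.
  It remains to justify the computation, and it is done for the minimizers \<open>u\<^sub>n\<close> on the bounded sets
  \<open>\<Omega> \<inter> B\<^sub>n\<close> first, with \<open>u\<^sub>n + \<epsilon>\<close> in the denominator.

  On a bounded set, comparing a minimizer \<open>u\<close> with the positive part of \<open>u + t \<eta>\<close> gives
  the weak equation for every \<open>\<eta>\<close> in \<open>\<D>\<^sub>0\<^sup>1\<^sup>,\<^sup>2\<close> (\<open>Euler_Lagrange\<close>), and comparing it with \<open>u + t f\<close>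
  gives \<open>u > 0\<close> almost everywhere on \<open>{f > 0}\<close> for a test function \<open>f \<ge> 0\<close>, because \<open>t\<^sup>q\<close> beats \<open>t\<^sup>2\<close>
  (\<open>lane_emden_pair_pos\<close>). The function \<open>\<phi>\<^sup>2/(u + \<epsilon>)\<close> is admissible, which is the identity
  \<open>lane_emden_test_identity\<close>.

  The assumption \<open>\<lambda>\<^sub>1(\<Omega>) > 0\<close> enters through a weight \<open>\<rho> > 0\<close> that is square integrable on the whole space
  and satisfies \<open>|\<nabla>\<rho>| \<le> c \<rho>\<close> with \<open>c\<close> small compared to \<open>\<lambda>\<^sub>1\<close>. Testing the equation with \<open>\<rho>\<^sup>2u\<close> bounds
  \<open>\<rho>u\<^sub>n\<close> and \<open>\<rho>\<nabla>u\<^sub>n\<close> in \<open>L\<^sup>2\<close> independently of \<open>n\<close> (\<open>lane_emden_weighted_bound\<close>). Suitable convex combinations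
  of the pairs \<open>(\<rho>u\<^sub>n, \<rho>\<nabla>u\<^sub>n)\<close> then converge strongly in \<open>L\<^sup>2\<close> (\<open>bounded_L2_convex_combinations\<close>), so that
  \<open>w\<close> is finite almost everywhere and has a gradient \<open>G\<close> with \<open>\<rho>G\<close> in \<open>L\<^sup>2\<close> (\<open>exists_limit\<close>). By the
  fundamental lemma of the calculus of variations, \<open>G\<close> is the given distributional gradient
  (\<open>limit_gradient_unique\<close>).

  The quadratic term is not linear in \<open>\<nabla>u\<^sub>n\<close>, and passing to the limit needs lower semicontinuity for it. With
  \<open>V = \<phi>G/(w + \<epsilon>)\<close>, the estimate \<open>|X|\<^sup>2 \<ge> 2 X \<bullet> V - |V|\<^sup>2\<close> turns the identity for \<open>u\<^sub>n\<close> into an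
  inequality that is linear in \<open>\<nabla>u\<^sub>n\<close> and therefore survives convex combinations
  (\<open>limit_inequality\<close>). Finally \<open>\<epsilon>\<close> tends to 0: \<open>w > 0\<close> almost everywhere on \<open>{\<phi> \<noteq> 0}\<close> follows from the uniform bound
  on \<open>\<integral> \<phi>\<^sup>2/u\<^sub>n\<^sup>2\<^sup>-\<^sup>q\<close> (\<open>limit_pos\<close>), and the choices \<open>\<delta> = 1\<close> and \<open>\<delta> = 2\<close> show that both integrals of the
  theorem are finite, so that the inequality is one between real numbers for every \<open>\<delta>\<close>.
\<close>

section \<open>Square integrable functions\<close>

abbreviation sqnorm :: "'a measure \<Rightarrow> ('a \<Rightarrow> 'b::euclidean_space) \<Rightarrow> real" where
  "sqnorm M f \<equiv> \<integral>x. (norm (f x))\<^sup>2 \<partial>M"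

definition sq_integrable :: "'a measure \<Rightarrow> ('a \<Rightarrow> 'b::euclidean_space) \<Rightarrow> bool" where
  "sq_integrable M f \<longleftrightarrow> f \<in> borel_measurable M \<and> integrable M (\<lambda>x. (norm (f x))\<^sup>2)"

definition L2_tendsto ::
  "'a measure \<Rightarrow> (nat \<Rightarrow> 'a \<Rightarrow> 'b::euclidean_space) \<Rightarrow> ('a \<Rightarrow> 'b) \<Rightarrow> bool" where
  "L2_tendsto M F f \<longleftrightarrow> (\<forall>n. sq_integrable M (F n)) \<and> sq_integrable M f \<and>
     (\<lambda>n. sqnorm M (\<lambda>x. F n x - f x)) \<longlonglongrightarrow> 0"

lemma norm_add_sq_le: "(norm (a + b))\<^sup>2 \<le> 2 * (norm a)\<^sup>2 + 2 * (norm (b::'b::real_inner))\<^sup>2"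
proof -
  have "0 \<le> (norm (a - b))\<^sup>2" by simp
  then show ?thesis
    by (simp add: power2_norm_eq_inner inner_add inner_diff inner_commute)
qed

lemma norm_diff_sq_le: "(norm (a - b))\<^sup>2 \<le> 2 * (norm a)\<^sup>2 + 2 * (norm (b::'b::real_inner))\<^sup>2"
  using norm_add_sq_le[of a "-b"] by simp

lemma inner_le_sq: "\<bar>a \<bullet> b\<bar> \<le> (norm a)\<^sup>2 + (norm (b::'b::real_inner))\<^sup>2"
proof -
  have "\<bar>a \<bullet> b\<bar> \<le> norm a * norm b" by (rule Cauchy_Schwarz_ineq2)
  moreover have "2 * (norm a * norm b) \<le> (norm a)\<^sup>2 + (norm b)\<^sup>2"
    using sum_squares_bound[of "norm a" "norm b"] by simp
  moreover have "0 \<le> norm a * norm b" by simp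
  ultimately show ?thesis by linarith
qed

lemma sq_integrableD:
  assumes "sq_integrable M f"
  shows "f \<in> borel_measurable M" "integrable M (\<lambda>x. (norm (f x))\<^sup>2)"
  using assms by (auto simp: sq_integrable_def)

lemma sq_integrable_bound:
  assumes "f \<in> borel_measurable M" "integrable M h" "AE x in M. (norm (f x))\<^sup>2 \<le> h x"
  shows "sq_integrable M f"
  unfolding sq_integrable_def
proof
  show "integrable M (\<lambda>x. (norm (f x))\<^sup>2)"
    by (rule Bochner_Integration.integrable_bound[OF assms(2)]) (use assms in auto)
qed fact

lemma sq_integrable_zero [simp]: "sq_integrable M (\<lambda>x. 0)"
  by (simp add: sq_integrable_def)

lemma sq_integrable_add:
  assumes "sq_integrable M f" "sq_integrable M g"
  shows "sq_integrable M (\<lambda>x. f x + g x)"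
  using assms norm_add_sq_le
  by (intro sq_integrable_bound[where h="\<lambda>x. 2 * (norm (f x))\<^sup>2 + 2 * (norm (g x))\<^sup>2"])
     (auto simp: sq_integrable_def)

lemma sq_integrable_bounded_scaleR:
  fixes r :: "'a \<Rightarrow> real"
  assumes "sq_integrable M f" "r \<in> borel_measurable M" "\<And>x. \<bar>r x\<bar> \<le> C"
  shows "sq_integrable M (\<lambda>x. r x *\<^sub>R f x)"
proof (rule sq_integrable_bound[where h="\<lambda>x. C\<^sup>2 * (norm (f x))\<^sup>2"])
  have "(r x)\<^sup>2 \<le> C\<^sup>2" for x
    using assms(3)[of x] by (metis abs_ge_zero power2_abs power_mono)
  then show "AE x in M. (norm (r x *\<^sub>R f x))\<^sup>2 \<le> C\<^sup>2 * (norm (f x))\<^sup>2"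
    by (auto simp: power_mult_distrib intro!: mult_right_mono)
qed (use assms in \<open>auto simp: sq_integrable_def\<close>)

lemma sq_integrable_scaleR:
  "sq_integrable M f \<Longrightarrow> sq_integrable M (\<lambda>x. c *\<^sub>R f x)"
  using sq_integrable_bounded_scaleR[of M f "\<lambda>_. c" "\<bar>c\<bar>"] by simp

lemma sq_integrable_diff:
  assumes "sq_integrable M f" "sq_integrable M g"
  shows "sq_integrable M (\<lambda>x. f x - g x)"
  using sq_integrable_add[OF assms(1) sq_integrable_scaleR[OF assms(2), of "-1"]] by simp

lemma sq_integrable_sum:
  assumes "\<And>i. i \<in> I \<Longrightarrow> sq_integrable M (f i)"
  shows "sq_integrable M (\<lambda>x. \<Sum>i\<in>I. f i x)"
  using assms by (induction I rule: infinite_finite_induct) (auto intro: sq_integrable_add)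

lemma integrable_inner:
  assumes "sq_integrable M f" "sq_integrable M g"
  shows "integrable M (\<lambda>x. f x \<bullet> g x)"
  by (rule Bochner_Integration.integrable_bound[where f="\<lambda>x. (norm (f x))\<^sup>2 + (norm (g x))\<^sup>2"])
     (use assms inner_le_sq in \<open>auto simp: sq_integrable_def\<close>)

lemma Cauchy_Schwarz_integral:
  assumes "sq_integrable M f" "sq_integrable M g"
  shows "(\<integral>x. f x \<bullet> g x \<partial>M)\<^sup>2 \<le> sqnorm M f * sqnorm M g"
proof -
  let ?a = "sqnorm M f" and ?b = "\<integral>x. f x \<bullet> g x \<partial>M" and ?c = "sqnorm M g"
  have *: "0 \<le> t\<^sup>2 * ?a - 2 * s * t * ?b + s\<^sup>2 * ?c" for t s
  proof -
    have "0 \<le> sqnorm M (\<lambda>x. t *\<^sub>R f x - s *\<^sub>R g x)" by simp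
    also have "\<dots> = (\<integral>x. t\<^sup>2 * (norm (f x))\<^sup>2 - 2 * s * t * (f x \<bullet> g x) + s\<^sup>2 * (norm (g x))\<^sup>2 \<partial>M)"
      by (intro Bochner_Integration.integral_cong refl)
        (simp add: power2_norm_eq_inner inner_diff inner_commute, simp add: power2_eq_square algebra_simps)
    also have "\<dots> = t\<^sup>2 * ?a - 2 * s * t * ?b + s\<^sup>2 * ?c"
      using assms integrable_inner[OF assms] by (simp add: sq_integrable_def)
    finally show ?thesis .
  qed
  have real: "b\<^sup>2 \<le> a * c" if *: "\<And>t s. 0 \<le> t\<^sup>2 * a - 2 * s * t * b + s\<^sup>2 * c" and a: "0 \<le> a" for a b c :: real
  proof (cases "a = 0")
    case True
    have "b = 0"
    proof (rule ccontr)
      assume b: "b \<noteq> 0"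
      have "0 \<le> c - 2 * ((c + 1) / (2 * b)) * b"
        using *[of "(c + 1) / (2 * b)" 1] True by simp
      with b show False by simp
    qed
    with True show ?thesis by simp
  next
    case False
    then have "0 < a" using a by simp
    have "b\<^sup>2 * a - 2 * a * b * b + a\<^sup>2 * c = a * (a * c - b\<^sup>2)"
      unfolding power2_eq_square right_diff_distrib by (simp only: ac_simps)
    then have "0 \<le> a * (a * c - b\<^sup>2)" using *[of b a] by linarith
    then have "0 \<le> a * c - b\<^sup>2" using \<open>0 < a\<close> by (metis mult_pos_neg not_le)
    then show ?thesis by linarith
  qed
  show ?thesis by (rule real[OF *]) simp
qed

lemma L2_tendstoD:
  assumes "L2_tendsto M F f"
  shows "sq_integrable M (F n)" "sq_integrable M f" "F n \<in> borel_measurable M" "f \<in> borel_measurable M"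
    "(\<lambda>n. sqnorm M (\<lambda>x. F n x - f x)) \<longlonglongrightarrow> 0"
  using assms by (auto simp: L2_tendsto_def sq_integrable_def)

lemma L2_tendsto_const: "sq_integrable M f \<Longrightarrow> L2_tendsto M (\<lambda>n. f) f"
  by (simp add: L2_tendsto_def)

lemma L2_tendstoI_bound:
  assumes "\<And>n. sq_integrable M (F n)" "sq_integrable M f"
    and "\<And>n. sqnorm M (\<lambda>x. F n x - f x) \<le> e n" "e \<longlonglongrightarrow> 0"
  shows "L2_tendsto M F f"
proof -
  have "(\<lambda>n. sqnorm M (\<lambda>x. F n x - f x)) \<longlonglongrightarrow> 0"
    by (rule tendsto_sandwich[OF _ _ tendsto_const assms(4)]) (use assms(3) in simp_all)
  with assms(1,2) show ?thesis by (simp add: L2_tendsto_def)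
qed

lemma L2_tendsto_add:
  assumes "L2_tendsto M F f" "L2_tendsto M G g"
  shows "L2_tendsto M (\<lambda>n x. F n x + G n x) (\<lambda>x. f x + g x)"
proof (rule L2_tendstoI_bound)
  note D = L2_tendstoD[OF assms(1)] L2_tendstoD[OF assms(2)]
  fix n
  show "sq_integrable M (\<lambda>x. F n x + G n x)" by (intro sq_integrable_add D)
  have i: "integrable M (\<lambda>x. (norm (F n x - f x))\<^sup>2)" "integrable M (\<lambda>x. (norm (G n x - g x))\<^sup>2)"
    by (intro sq_integrableD(2) sq_integrable_diff D)+
  have "sqnorm M (\<lambda>x. F n x + G n x - (f x + g x))
     \<le> (\<integral>x. 2 * (norm (F n x - f x))\<^sup>2 + 2 * (norm (G n x - g x))\<^sup>2 \<partial>M)"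
  proof (rule integral_mono)
    show "integrable M (\<lambda>x. (norm (F n x + G n x - (f x + g x)))\<^sup>2)"
      by (intro sq_integrableD(2) sq_integrable_diff sq_integrable_add D)
    show "(norm (F n x + G n x - (f x + g x)))\<^sup>2 \<le> 2 * (norm (F n x - f x))\<^sup>2 + 2 * (norm (G n x - g x))\<^sup>2" for x
      using norm_add_sq_le[of "F n x - f x" "G n x - g x"] by (simp add: algebra_simps)
  qed (use i in auto)
  also have "\<dots> = 2 * sqnorm M (\<lambda>x. F n x - f x) + 2 * sqnorm M (\<lambda>x. G n x - g x)"
    using i by simp
  finally show "sqnorm M (\<lambda>x. F n x + G n x - (f x + g x)) \<le>
     2 * sqnorm M (\<lambda>x. F n x - f x) + 2 * sqnorm M (\<lambda>x. G n x - g x)" .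
next
  show "sq_integrable M (\<lambda>x. f x + g x)" using assms by (intro sq_integrable_add) (auto simp: L2_tendsto_def)
  show "(\<lambda>n. 2 * sqnorm M (\<lambda>x. F n x - f x) + 2 * sqnorm M (\<lambda>x. G n x - g x)) \<longlonglongrightarrow> 0"
    using tendsto_add[OF tendsto_mult[OF tendsto_const[of 2] L2_tendstoD(5)[OF assms(1)]]
        tendsto_mult[OF tendsto_const[of 2] L2_tendstoD(5)[OF assms(2)]]] by simp
qed

lemma L2_tendsto_inner_left:
  assumes "L2_tendsto M F f" "sq_integrable M g"
  shows "(\<lambda>n. \<integral>x. F n x \<bullet> g x \<partial>M) \<longlonglongrightarrow> (\<integral>x. f x \<bullet> g x \<partial>M)"
proof -
  note D = L2_tendstoD[OF assms(1)]
  let ?d = "\<lambda>n. (\<integral>x. (F n x - f x) \<bullet> g x \<partial>M)"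
  have "(\<lambda>n. (?d n)\<^sup>2) \<longlonglongrightarrow> 0"
  proof (rule tendsto_sandwich[of "\<lambda>_. 0"])
    show "\<forall>\<^sub>F n in sequentially. (?d n)\<^sup>2 \<le> sqnorm M (\<lambda>x. F n x - f x) * sqnorm M g"
      by (intro always_eventually allI Cauchy_Schwarz_integral sq_integrable_diff D assms)
    show "(\<lambda>n. sqnorm M (\<lambda>x. F n x - f x) * sqnorm M g) \<longlonglongrightarrow> 0"
      using tendsto_mult[OF D(5) tendsto_const] by simp
  qed auto
  then have "?d \<longlonglongrightarrow> 0" by (simp add: power_tendsto_0_iff)
  moreover have "?d n = (\<integral>x. F n x \<bullet> g x \<partial>M) - (\<integral>x. f x \<bullet> g x \<partial>M)" for n
    by (simp add: inner_diff_left integrable_inner D assms)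
  ultimately show ?thesis by (simp add: LIM_zero_iff)
qed

lemma L2_tendsto_norm:
  assumes "L2_tendsto M F f"
  shows "(\<lambda>n. sqnorm M (F n)) \<longlonglongrightarrow> (sqnorm M f)"
proof -
  note D = L2_tendstoD[OF assms(1)]
  have eq: "sqnorm M (F n) = sqnorm M (\<lambda>x. F n x - f x) + 2 * (\<integral>x. F n x \<bullet> f x \<partial>M)
     - sqnorm M f" for n
  proof -
    have "sqnorm M (F n) = (\<integral>x. (norm (F n x - f x))\<^sup>2 + 2 * (F n x \<bullet> f x) - (norm (f x))\<^sup>2 \<partial>M)"
      by (intro Bochner_Integration.integral_cong refl)
        (simp add: power2_norm_eq_inner inner_diff inner_commute)
    also have "\<dots> = sqnorm M (\<lambda>x. F n x - f x) + 2 * (\<integral>x. F n x \<bullet> f x \<partial>M)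
     - sqnorm M f"
      by (simp add: integrable_inner D sq_integrableD(2) sq_integrable_diff)
    finally show ?thesis .
  qed
  have "(\<lambda>n. sqnorm M (\<lambda>x. F n x - f x) + 2 * (\<integral>x. F n x \<bullet> f x \<partial>M)
     - sqnorm M f) \<longlonglongrightarrow> 0 + 2 * (\<integral>x. f x \<bullet> f x \<partial>M) - sqnorm M f"
    by (intro tendsto_intros D L2_tendsto_inner_left assms)
  then show ?thesis unfolding eq by (simp add: power2_norm_eq_inner)
qed

lemma L2_tendsto_subseq:
  assumes "L2_tendsto M F f" "strict_mono r"
  shows "L2_tendsto M (\<lambda>n. F (r n)) f"
  using assms LIMSEQ_subseq_LIMSEQ[OF L2_tendstoD(5)[OF assms(1)] assms(2)]
  by (auto simp: L2_tendsto_def o_def)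

lemma L2_tendsto_AE_subseq:
  assumes "L2_tendsto M F f"
  obtains r :: "nat \<Rightarrow> nat" where "strict_mono r" "AE x in M. (\<lambda>n. F (r n) x) \<longlonglongrightarrow> f x"
proof -
  note D = L2_tendstoD[OF assms(1)]
  have "\<exists>r::nat\<Rightarrow>nat. strict_mono r \<and> (AE x in M. (\<lambda>n. (norm (F (r n) x - f x))\<^sup>2) \<longlonglongrightarrow> 0)"
    by (rule tendsto_L1_AE_subseq) (auto intro!: sq_integrableD(2) sq_integrable_diff D(1,2) simp: D(5))
  then obtain r :: "nat \<Rightarrow> nat" where r: "strict_mono r" "AE x in M. (\<lambda>n. (norm (F (r n) x - f x))\<^sup>2) \<longlonglongrightarrow> 0"
    by blast
  have "(\<lambda>n. F (r n) x) \<longlonglongrightarrow> f x" if "(\<lambda>n. (norm (F (r n) x - f x))\<^sup>2) \<longlonglongrightarrow> 0" for x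
  proof -
    have "(\<lambda>n. norm (F (r n) x - f x)) \<longlonglongrightarrow> 0" using that by (simp add: power_tendsto_0_iff)
    then show ?thesis by (simp add: tendsto_norm_zero_iff LIM_zero_iff)
  qed
  with r show ?thesis by (intro that[of r]) auto
qed

lemma L2_tendsto_dominated:
  assumes "\<And>n. F n \<in> borel_measurable M" "f \<in> borel_measurable M"
    and "AE x in M. (\<lambda>n. F n x) \<longlonglongrightarrow> f x"
    and "\<And>n. AE x in M. norm (F n x) \<le> norm (h x)" "sq_integrable M (h::'a \<Rightarrow> 'c::euclidean_space)"
  shows "L2_tendsto M F (f :: 'a \<Rightarrow> 'b::euclidean_space)"
proof -
  have hi: "integrable M (\<lambda>x. (norm (h x))\<^sup>2)" using assms by (auto simp: sq_integrable_def)
  have F: "sq_integrable M (F n)" for n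
    by (rule sq_integrable_bound[OF assms(1) hi]) (use assms(4)[of n] in \<open>auto intro: power_mono\<close>)
  have all: "AE x in M. \<forall>n. norm (F n x) \<le> norm (h x)" using assms(4) by (simp add: AE_all_countable)
  have bd: "AE x in M. norm (f x) \<le> norm (h x)"
    using all assms(3)
  proof eventually_elim
    case (elim x)
    show ?case by (rule tendsto_upperbound[OF tendsto_norm[OF elim(2)]]) (use elim in auto)
  qed
  have f: "sq_integrable M f"
    by (rule sq_integrable_bound[OF assms(2) hi]) (use bd in \<open>auto intro: power_mono\<close>)
  have "(\<lambda>n. sqnorm M (\<lambda>x. F n x - f x)) \<longlonglongrightarrow> (\<integral>x. 0 \<partial>M)"
  proof (rule integral_dominated_convergence[where w="\<lambda>x. 4 * (norm (h x))\<^sup>2"])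
    show "AE x in M. (\<lambda>n. (norm (F n x - f x))\<^sup>2) \<longlonglongrightarrow> 0"
      using assms(3)
    proof eventually_elim
      case (elim x)
      have "(\<lambda>n. (norm (F n x - f x))\<^sup>2) \<longlonglongrightarrow> (norm (f x - f x))\<^sup>2"
        by (intro tendsto_intros elim)
      then show ?case by simp
    qed
    show "AE x in M. norm ((norm (F n x - f x))\<^sup>2) \<le> 4 * (norm (h x))\<^sup>2" for n
      using all bd
    proof eventually_elim
      case (elim x)
      have "(norm (F n x))\<^sup>2 \<le> (norm (h x))\<^sup>2" "(norm (f x))\<^sup>2 \<le> (norm (h x))\<^sup>2"
        using elim by (auto intro: power_mono)
      then have "(norm (F n x - f x))\<^sup>2 \<le> 4 * (norm (h x))\<^sup>2"
        using norm_diff_sq_le[of "F n x" "f x"] by linarith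
      then show ?case by simp
    qed
  qed (use assms hi in auto)
  with F f show ?thesis by (simp add: L2_tendsto_def)
qed

text \<open>
  The product rule for convergence that is behind the chain rule: one factor converges in \<open>L\<^sup>2\<close>, the other one is
  bounded and converges only pointwise.
\<close>

lemma L2_tendsto_scaleR_AE:
  fixes r :: "nat \<Rightarrow> 'a \<Rightarrow> real"
  assumes F: "L2_tendsto M F f"
    and m: "\<And>n. r n \<in> borel_measurable M" "s \<in> borel_measurable M"
    and b: "\<And>n x. \<bar>r n x\<bar> \<le> C" and lim: "AE x in M. (\<lambda>n. r n x) \<longlonglongrightarrow> s x"
  shows "L2_tendsto M (\<lambda>n x. r n x *\<^sub>R F n x) (\<lambda>x. s x *\<^sub>R f x)"
proof -
  note D = L2_tendstoD[OF F]
  have 1: "L2_tendsto M (\<lambda>n x. r n x *\<^sub>R (F n x - f x)) (\<lambda>x. 0)"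
  proof (rule L2_tendstoI_bound)
    fix n
    have d: "sq_integrable M (\<lambda>x. F n x - f x)" by (intro sq_integrable_diff D)
    show s: "sq_integrable M (\<lambda>x. r n x *\<^sub>R (F n x - f x))"
      by (rule sq_integrable_bounded_scaleR[OF d m(1) b])
    have "sqnorm M (\<lambda>x. r n x *\<^sub>R (F n x - f x) - 0) \<le> (\<integral>x. C\<^sup>2 * (norm (F n x - f x))\<^sup>2 \<partial>M)"
    proof (rule integral_mono)
      have "(r n x)\<^sup>2 \<le> C\<^sup>2" for x
        using b[of n x] by (metis abs_ge_zero power2_abs power_mono)
      then show "(norm (r n x *\<^sub>R (F n x - f x) - 0))\<^sup>2 \<le> C\<^sup>2 * (norm (F n x - f x))\<^sup>2" for x
        by (auto simp: power_mult_distrib intro!: mult_right_mono)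
    qed (use sq_integrableD(2)[OF d] sq_integrableD(2)[OF s] in auto)
    then show "sqnorm M (\<lambda>x. r n x *\<^sub>R (F n x - f x) - 0) \<le> C\<^sup>2 * sqnorm M (\<lambda>x. F n x - f x)"
      by simp
  next
    show "(\<lambda>n. C\<^sup>2 * sqnorm M (\<lambda>x. F n x - f x)) \<longlonglongrightarrow> 0"
      using tendsto_mult[OF tendsto_const[of "C\<^sup>2"] D(5)] by simp
  qed simp
  have 2: "L2_tendsto M (\<lambda>n x. r n x *\<^sub>R f x) (\<lambda>x. s x *\<^sub>R f x)"
  proof (rule L2_tendsto_dominated[where h="\<lambda>x. C *\<^sub>R f x"])
    show "(\<lambda>x. r n x *\<^sub>R f x) \<in> borel_measurable M" "(\<lambda>x. s x *\<^sub>R f x) \<in> borel_measurable M" for n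
      using m D(4) by auto
    show "AE x in M. (\<lambda>n. r n x *\<^sub>R f x) \<longlonglongrightarrow> s x *\<^sub>R f x"
      using lim by eventually_elim (intro tendsto_intros)
    have "\<bar>r n x\<bar> \<le> \<bar>C\<bar>" for n x using b[of n x] by linarith
    then show "AE x in M. norm (r n x *\<^sub>R f x) \<le> norm (C *\<^sub>R f x)" for n
      by (auto intro!: mult_right_mono)
  qed (intro sq_integrable_scaleR D)
  show ?thesis using L2_tendsto_add[OF 1 2] by (simp add: algebra_simps)
qed

lemma L2_tendsto_bounded_scaleR:
  fixes r :: "'a \<Rightarrow> real"
  assumes "L2_tendsto M F f" "r \<in> borel_measurable M" "\<And>x. \<bar>r x\<bar> \<le> C"
  shows "L2_tendsto M (\<lambda>n x. r x *\<^sub>R F n x) (\<lambda>x. r x *\<^sub>R f x)"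
  by (rule L2_tendsto_scaleR_AE[OF assms(1)]) (use assms in auto)

lemma nn_integral_sq:
  assumes "sq_integrable M f"
  shows "(\<integral>\<^sup>+x. ennreal ((norm (f x))\<^sup>2) \<partial>M) = ennreal (sqnorm M f)"
  by (rule nn_integral_eq_integral) (use assms in \<open>auto simp: sq_integrable_def\<close>)

lemma sq_integrable_nn:
  assumes "f \<in> borel_measurable M" "(\<integral>\<^sup>+x. ennreal ((norm (f x))\<^sup>2) \<partial>M) < \<infinity>"
  shows "sq_integrable M f"
  unfolding sq_integrable_def
  using assms by (auto intro!: integrableI_bounded)

text \<open>
  The bound is only required eventually, so that it can be applied to the tail of a Cauchy sequence.
\<close>

lemma sq_integrable_Fatou:
  fixes f :: "'a \<Rightarrow> 'b::euclidean_space"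
  assumes "\<And>k. sq_integrable M (G k)" "f \<in> borel_measurable M"
    and "AE x in M. (\<lambda>k. G k x) \<longlonglongrightarrow> f x"
    and "eventually (\<lambda>k. sqnorm M (G k) \<le> e) sequentially"
  shows "sq_integrable M f" "sqnorm M f \<le> e"
proof -
  have e: "0 \<le> e"
  proof -
    obtain k where "sqnorm M (G k) \<le> e" using eventually_happens[OF assms(4)] by auto
    moreover have "0 \<le> sqnorm M (G k)" by simp
    ultimately show ?thesis by linarith
  qed
  have "(\<integral>\<^sup>+x. ennreal ((norm (f x))\<^sup>2) \<partial>M) = (\<integral>\<^sup>+x. liminf (\<lambda>k. ennreal ((norm (G k x))\<^sup>2)) \<partial>M)"
  proof (rule nn_integral_cong_AE)
    show "AE x in M. ennreal ((norm (f x))\<^sup>2) = liminf (\<lambda>k. ennreal ((norm (G k x))\<^sup>2))"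
      using assms(3)
    proof eventually_elim
      case (elim x)
      have "(\<lambda>k. ennreal ((norm (G k x))\<^sup>2)) \<longlonglongrightarrow> ennreal ((norm (f x))\<^sup>2)"
        by (intro tendsto_intros tendsto_ennrealI elim)
      then show ?case by (rule lim_imp_Liminf[OF trivial_limit_sequentially, symmetric])
    qed
  qed
  also have "\<dots> \<le> liminf (\<lambda>k. \<integral>\<^sup>+x. ennreal ((norm (G k x))\<^sup>2) \<partial>M)"
    by (rule nn_integral_liminf) (use sq_integrableD(1)[OF assms(1)] in measurable)
  also have "\<dots> \<le> ennreal e"
  proof (rule Liminf_le)
    show "\<forall>\<^sub>F k in sequentially. (\<integral>\<^sup>+x. ennreal ((norm (G k x))\<^sup>2) \<partial>M) \<le> ennreal e"
      using assms(4) by eventually_elim (simp add: nn_integral_sq assms(1) ennreal_leI)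
  qed simp
  finally have *: "(\<integral>\<^sup>+x. ennreal ((norm (f x))\<^sup>2) \<partial>M) \<le> ennreal e" .
  then show f: "sq_integrable M f"
    by (intro sq_integrable_nn assms) (auto intro: le_less_trans)
  show "sqnorm M f \<le> e"
    using * e unfolding nn_integral_sq[OF f] by simp
qed

lemma convergent_of_geometric_steps:
  fixes a :: "nat \<Rightarrow> 'b::banach"
  assumes "\<And>k. norm (a (Suc k) - a k) \<le> C * (1/2)^k"
  shows "convergent a"
proof -
  have "summable (\<lambda>k. a (Suc k) - a k)"
    by (rule summable_comparison_test[of _ "\<lambda>k. C * (1/2)^k"]) (use assms in \<open>auto intro!: summable_mult summable_geometric\<close>)
  then have "(\<lambda>n. \<Sum>k<n. a (Suc k) - a k) \<longlonglongrightarrow> (\<Sum>k. a (Suc k) - a k)"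
    by (rule summable_LIMSEQ)
  then have "(\<lambda>n. (a n - a 0) + a 0) \<longlonglongrightarrow> (\<Sum>k. a (Suc k) - a k) + a 0"
    unfolding sum_lessThan_telescope by (intro tendsto_intros)
  then show ?thesis by (auto simp: convergent_def)
qed

text \<open>
  Along a subsequence the squared distances of consecutive terms are at most \<open>8\<^sup>-\<^sup>k\<close>. Their sum weighted with
  \<open>4\<^sup>k\<close> has a finite integral and is therefore finite almost everywhere, which makes the steps
  geometrically small at almost every point. Fatou's lemma turns the pointwise limit into an \<open>L\<^sup>2\<close> limit.
\<close>

lemma L2_complete:
  fixes F :: "nat \<Rightarrow> 'a \<Rightarrow> 'b::euclidean_space"
  assumes F: "\<And>n. sq_integrable M (F n)"
    and Cauchy: "\<And>e. 0 < e \<Longrightarrow> \<exists>N. \<forall>m\<ge>N. \<forall>n\<ge>N. sqnorm M (\<lambda>x. F m x - F n x) < e"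
  obtains f where "L2_tendsto M F f"
proof -
  have "\<exists>r. \<forall>k. (\<forall>m\<ge>r k. \<forall>n\<ge>r k. sqnorm M (\<lambda>x. F m x - F n x) < (1/8)^k) \<and> r k < (r (Suc k) :: nat)"
  proof (rule dependent_nat_choice)
    show "\<exists>x. \<forall>m\<ge>x. \<forall>n\<ge>x. sqnorm M (\<lambda>y. F m y - F n y) < (1/8)^0"
      by (rule Cauchy) simp
    fix x k :: nat
    obtain N where N: "\<forall>m\<ge>N. \<forall>n\<ge>N. sqnorm M (\<lambda>y. F m y - F n y) < (1/8)^Suc k"
      using Cauchy[of "(1/8)^Suc k"] by auto
    show "\<exists>y. (\<forall>m\<ge>y. \<forall>n\<ge>y. sqnorm M (\<lambda>x. F m x - F n x) < (1/8)^Suc k) \<and> x < y"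
      by (rule exI[of _ "max N (Suc x)"]) (use N in auto)
  qed
  then obtain r :: "nat \<Rightarrow> nat" where r: "\<And>k m n. m \<ge> r k \<Longrightarrow> n \<ge> r k \<Longrightarrow> (sqnorm M (\<lambda>x. F m x - F n x)) < (1/8)^k"
    and mono: "\<And>k. r k < r (Suc k)" by blast
  have sm: "strict_mono r" using mono by (simp add: strict_mono_Suc_iff)
  define D where "D k x = 4^k * (norm (F (r (Suc k)) x - F (r k) x))\<^sup>2" for k x
  have [measurable]: "F n \<in> borel_measurable M" for n using F by (auto simp: sq_integrable_def)
  have "(\<integral>\<^sup>+x. (\<Sum>k. ennreal (D k x)) \<partial>M) = (\<Sum>k. \<integral>\<^sup>+x. ennreal (D k x) \<partial>M)"
    by (rule nn_integral_suminf) (simp add: D_def)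
  also have "\<dots> \<le> (\<Sum>k. ennreal ((1/2)^k))"
  proof (rule suminf_le)
    fix k
    have i: "integrable M (D k)" unfolding D_def
      by (intro integrable_mult_right sq_integrableD(2) sq_integrable_diff F)
    have "(\<integral>\<^sup>+x. ennreal (D k x) \<partial>M) = ennreal (\<integral>x. D k x \<partial>M)"
      by (rule nn_integral_eq_integral[OF i]) (simp add: D_def)
    also have "(\<integral>x. D k x \<partial>M) = 4^k * sqnorm M (\<lambda>x. F (r (Suc k)) x - F (r k) x)"
      by (simp add: D_def)
    also have "\<dots> \<le> 4^k * (1/8)^k"
      using r[of k "r (Suc k)" "r k"] mono[of k] by (intro mult_left_mono) auto
    also have "\<dots> = (1/2)^k" by (simp add: power_mult_distrib[symmetric])
    finally show "(\<integral>\<^sup>+x. ennreal (D k x) \<partial>M) \<le> ennreal ((1/2)^k)" by (simp add: ennreal_leI)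
  qed auto
  also have "\<dots> < \<infinity>"
    by (subst suminf_ennreal2) (auto intro: summable_geometric)
  finally have "AE x in M. (\<Sum>k. ennreal (D k x)) \<noteq> \<infinity>"
    by (intro nn_integral_noteq_infinite) (auto simp: D_def)
  then have conv: "AE x in M. convergent (\<lambda>k. F (r k) x)"
  proof eventually_elim
    case (elim x)
    obtain B where B: "(\<Sum>k. ennreal (D k x)) = ennreal B" "0 \<le> B"
      using elim by (cases "\<Sum>k. ennreal (D k x)") auto
    show ?case
    proof (rule convergent_of_geometric_steps[where C="sqrt B"])
      fix k
      have "ennreal (D k x) \<le> (\<Sum>k. ennreal (D k x))"
        using sum_le_suminf[OF summableI, of "{k}" "\<lambda>k. ennreal (D k x)"] by simp
      then have "D k x \<le> B" using B by simp
      then have "(2^k * norm (F (r (Suc k)) x - F (r k) x))\<^sup>2 \<le> B"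
        by (simp add: D_def power_mult_distrib power2_eq_square[of "2^k"] flip: power_mult_distrib[of 2 2])
      then have "2^k * norm (F (r (Suc k)) x - F (r k) x) \<le> sqrt B"
        by (rule real_le_rsqrt)
      then show "norm (F (r (Suc k)) x - F (r k) x) \<le> sqrt B * (1/2)^k"
        by (simp add: field_simps)
    qed
  qed
  define f where "f x = lim (\<lambda>k. F (r k) x)" for x
  have fm[measurable]: "f \<in> borel_measurable M"
    unfolding f_def by (rule borel_measurable_lim_metric) simp
  have lim: "AE x in M. (\<lambda>k. F (r k) x) \<longlonglongrightarrow> f x"
    using conv by (auto simp: f_def convergent_LIMSEQ_iff)
  have close: "sq_integrable M (\<lambda>x. F n x - f x) \<and> sqnorm M (\<lambda>x. F n x - f x) \<le> (1/8)^k"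
    if "n \<ge> r k" for n k
  proof -
    have 1: "AE x in M. (\<lambda>j. F n x - F (r j) x) \<longlonglongrightarrow> F n x - f x"
      using lim by eventually_elim (intro tendsto_intros)
    have 2: "\<forall>\<^sub>F j in sequentially. sqnorm M (\<lambda>x. F n x - F (r j) x) \<le> (1/8)^k"
      using eventually_ge_at_top[of k]
    proof eventually_elim
      case (elim j)
      then have "r j \<ge> r k" using sm by (simp add: strict_mono_less_eq)
      then show ?case using r[of k n "r j"] that by simp
    qed
    show ?thesis
      using sq_integrable_Fatou[OF sq_integrable_diff[OF F F] _ 1 2] by simp
  qed
  have f: "sq_integrable M f"
    using sq_integrable_diff[OF F[of "r 0"] conjunct1[OF close[OF order_refl, of 0]]] by simp
  have "(\<lambda>n. sqnorm M (\<lambda>x. F n x - f x)) \<longlonglongrightarrow> 0"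
  proof (rule LIMSEQ_I)
    fix e :: real assume "0 < e"
    obtain k where k: "(1/8)^k < e" using real_arch_pow_inv[of e "1/8"] \<open>0 < e\<close> by auto
    show "\<exists>no. \<forall>n\<ge>no. norm (sqnorm M (\<lambda>x. F n x - f x) - 0) < e"
      using close[of k] k by (intro exI[of _ "r k"]) force
  qed
  with F f show ?thesis by (intro that[of f]) (simp add: L2_tendsto_def)
qed

lemma norm_Pair_sq: "(norm (a, b))\<^sup>2 = (norm a)\<^sup>2 + (norm b)\<^sup>2"
  by (simp add: norm_Pair)

lemma sq_integrable_Pair:
  assumes "sq_integrable M f" "sq_integrable M g"
  shows "sq_integrable M (\<lambda>x. (f x, g x))"
    and "sqnorm M (\<lambda>x. (f x, g x)) = sqnorm M f + sqnorm M g"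
  using assms by (auto simp: sq_integrable_def norm_Pair_sq)

lemma sq_integrable_fst_snd:
  assumes "sq_integrable M f"
  shows "sq_integrable M (\<lambda>x. fst (f x))" "sq_integrable M (\<lambda>x. snd (f x))"
proof -
  note m = sq_integrableD(1)[OF assms] and i = sq_integrableD(2)[OF assms]
  have "(norm (f x))\<^sup>2 = (norm (fst (f x)))\<^sup>2 + (norm (snd (f x)))\<^sup>2" for x
    using norm_Pair_sq[of "fst (f x)" "snd (f x)"] by simp
  then have b: "(norm (fst (f x)))\<^sup>2 \<le> (norm (f x))\<^sup>2" "(norm (snd (f x)))\<^sup>2 \<le> (norm (f x))\<^sup>2" for x
    by simp_all
  have "fst \<in> borel_measurable (borel :: ('b \<times> 'c) measure)" "snd \<in> borel_measurable (borel :: ('b \<times> 'c) measure)"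
    by (auto intro!: borel_measurable_continuous_onI continuous_intros)
  then have "(\<lambda>x. fst (f x)) \<in> borel_measurable M" "(\<lambda>x. snd (f x)) \<in> borel_measurable M"
    using m by (auto intro: measurable_compose)
  with b i show "sq_integrable M (\<lambda>x. fst (f x))" "sq_integrable M (\<lambda>x. snd (f x))"
    by (auto intro: sq_integrable_bound)
qed

section \<open>Convex combinations of bounded sequences\<close>

text \<open>
  The weights are indexed from 0 and vanish off \<open>{n..N}\<close>; in this way any two elements can be
  written with the same range of summation.
\<close>

definition tail_hull :: "(nat \<Rightarrow> 'a \<Rightarrow> 'b::real_vector) \<Rightarrow> nat \<Rightarrow> ('a \<Rightarrow> 'b) set" where
  "tail_hull f n = {(\<lambda>x. \<Sum>i\<le>N. c i *\<^sub>R f i x) | c N.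
     (\<forall>i. 0 \<le> c i) \<and> (\<forall>i. i < n \<or> N < i \<longrightarrow> c i = 0) \<and> (\<Sum>i\<le>N. c i) = 1}"

lemma tail_hull_antimono: "m \<le> n \<Longrightarrow> tail_hull f n \<subseteq> tail_hull f m"
  unfolding tail_hull_def by (blast intro: less_le_trans)

lemma tail_hull_base: "f n \<in> tail_hull f n"
  unfolding tail_hull_def
proof (intro CollectI exI conjI)
  show "f n = (\<lambda>x. \<Sum>i\<le>n. (if i = n then 1 else 0) *\<^sub>R f i x)"
    by (simp add: if_distrib[of "\<lambda>c. c *\<^sub>R _"] cong: if_cong)
qed auto

lemma tail_hull_midpoint:
  assumes "F \<in> tail_hull f n" "G \<in> tail_hull f n"
  shows "(\<lambda>x. (1/2) *\<^sub>R (F x + G x)) \<in> tail_hull f n"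
proof -
  obtain c N where c: "F = (\<lambda>x. \<Sum>i\<le>N. c i *\<^sub>R f i x)" "\<forall>i. 0 \<le> c i" "\<forall>i. i < n \<or> N < i \<longrightarrow> c i = 0"
     "(\<Sum>i\<le>N. c i) = 1" using assms(1) unfolding tail_hull_def by blast
  obtain d L where d: "G = (\<lambda>x. \<Sum>i\<le>L. d i *\<^sub>R f i x)" "\<forall>i. 0 \<le> d i" "\<forall>i. i < n \<or> L < i \<longrightarrow> d i = 0"
     "(\<Sum>i\<le>L. d i) = 1" using assms(2) unfolding tail_hull_def by blast
  define P where "P = max N L"
  have F: "F x = (\<Sum>i\<le>P. c i *\<^sub>R f i x)" for x
    unfolding c(1) by (rule sum.mono_neutral_left) (use c(3) in \<open>auto simp: P_def\<close>)
  have G: "G x = (\<Sum>i\<le>P. d i *\<^sub>R f i x)" for x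
    unfolding d(1) by (rule sum.mono_neutral_left) (use d(3) in \<open>auto simp: P_def\<close>)
  have c1: "(\<Sum>i\<le>P. c i) = 1"
    unfolding c(4)[symmetric] by (rule sum.mono_neutral_right) (use c(3) in \<open>auto simp: P_def\<close>)
  have d1: "(\<Sum>i\<le>P. d i) = 1"
    unfolding d(4)[symmetric] by (rule sum.mono_neutral_right) (use d(3) in \<open>auto simp: P_def\<close>)
  show ?thesis unfolding tail_hull_def
  proof (intro CollectI exI conjI)
    show "(\<lambda>x. (1/2) *\<^sub>R (F x + G x)) = (\<lambda>x. \<Sum>i\<le>P. ((c i + d i) / 2) *\<^sub>R f i x)"
      unfolding F G by (simp add: sum.distrib[symmetric] scaleR_sum_right scaleR_add_left add_divide_distrib scaleR_add_right)
    show "(\<Sum>i\<le>P. (c i + d i) / 2) = 1"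
      using c1 d1 by (simp add: sum_divide_distrib[symmetric] sum.distrib)
  qed (use c d in \<open>auto simp: P_def\<close>)
qed

lemma parallelogram_law:
  "(norm (a - b))\<^sup>2 = 2 * (norm a)\<^sup>2 + 2 * (norm b)\<^sup>2 - 4 * (norm ((1/2) *\<^sub>R (a + b :: 'b::real_inner)))\<^sup>2"
  unfolding power2_norm_eq_inner by (simp add: inner_add inner_diff inner_commute field_simps)

text \<open>
  A form of Mazur's lemma that needs no weak topology. Near-minimizers of the norm over the convex hulls of
  the tails form a Cauchy sequence: the midpoint of two of them lies in the hull again, so its norm is not
  much smaller, and by the parallelogram law the two are close.
\<close>

lemma bounded_L2_convex_combinations:
  fixes f :: "nat \<Rightarrow> 'a \<Rightarrow> 'b::euclidean_space"
  assumes f: "\<And>n. sq_integrable M (f n)" and C: "\<And>n. sqnorm M (f n) \<le> C"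
  obtains F g where "\<And>n. F n \<in> tail_hull f n" "L2_tendsto M F g"
proof -
  define E where "E F = sqnorm M F" for F :: "'a \<Rightarrow> 'b"
  have E0: "0 \<le> E F" for F by (simp add: E_def)
  define d where "d n = (INF F\<in>tail_hull f n. E F)" for n
  have bb: "bdd_below (E ` tail_hull f n)" for n using E0 by (auto simp: bdd_below_def)
  have ne: "tail_hull f n \<noteq> {}" for n using tail_hull_base[of f n] by auto
  have dle: "d n \<le> E F" if "F \<in> tail_hull f n" for n F
    unfolding d_def by (rule cINF_lower[OF bb that])
  have dmono: "d m \<le> d n" if "m \<le> n" for m n
    unfolding d_def by (rule cINF_superset_mono) (use ne bb tail_hull_antimono[OF that] in auto)
  have "d n \<le> C" for n using dle[OF tail_hull_base] C[of n] by (auto simp: E_def intro: order_trans)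
  moreover have "incseq d" by (simp add: incseq_def dmono)
  ultimately obtain l where l: "d \<longlonglongrightarrow> l" by (metis incseq_convergent)
  have dl: "d n \<le> l" for n by (rule incseq_le[OF _ l]) (simp add: incseq_def dmono)
  have "\<exists>F\<in>tail_hull f n. E F < d n + 1 / Suc n" for n
    using cINF_less_iff[OF ne bb, of n "d n + 1 / Suc n"] by (simp add: d_def)
  then obtain F where F: "\<And>n. F n \<in> tail_hull f n" and FE: "\<And>n. E (F n) < d n + 1 / Suc n" by metis
  have Fsq: "sq_integrable M (F n)" for n
    using F[of n] unfolding tail_hull_def by (auto intro!: sq_integrable_sum sq_integrable_scaleR f)
  have est: "E (\<lambda>x. F m x - F n x) \<le> 4 * (l - d k) + 4 / Suc k" if "m \<ge> k" "n \<ge> k" for m n k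
  proof -
    have "(\<lambda>x. (1/2) *\<^sub>R (F m x + F n x)) \<in> tail_hull f k"
      using F tail_hull_antimono that by (blast intro: tail_hull_midpoint)
    from dle[OF this] have 1: "d k \<le> E (\<lambda>x. (1/2) *\<^sub>R (F m x + F n x))" .
    have "E (\<lambda>x. F m x - F n x) = 2 * E (F m) + 2 * E (F n) - 4 * E (\<lambda>x. (1/2) *\<^sub>R (F m x + F n x))"
      unfolding E_def parallelogram_law
      by (subst Bochner_Integration.integral_diff Bochner_Integration.integral_add;
          (intro Bochner_Integration.integrable_add integrable_mult_right sq_integrableD(2) sq_integrable_scaleR sq_integrable_add Fsq)?)+ simp
    moreover have "1 / Suc m \<le> (1 / Suc k :: real)" "1 / Suc n \<le> (1 / Suc k :: real)"
      using that by (auto intro!: divide_left_mono)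
    moreover have "4 / Suc k = 4 * (1 / Suc k :: real)" by simp
    ultimately show ?thesis using 1 FE[of m] FE[of n] dl[of m] dl[of n] by argo
  qed
  have lim0: "(\<lambda>k. 4 * (l - d k) + 4 / Suc k) \<longlonglongrightarrow> 4 * (l - l) + 0"
    by (intro tendsto_intros l LIMSEQ_Suc[OF lim_const_over_n])
  have "\<exists>g. L2_tendsto M F g"
  proof (rule L2_complete[OF Fsq])
    fix e :: real assume "0 < e"
    then have "\<forall>\<^sub>F k in sequentially. 4 * (l - d k) + 4 / Suc k < e"
      using order_tendstoD(2)[OF lim0, of e] by simp
    then obtain k where "4 * (l - d k) + 4 / Suc k < e" by (auto dest: eventually_happens)
    then show "\<exists>N. \<forall>m\<ge>N. \<forall>n\<ge>N. sqnorm M (\<lambda>x. F m x - F n x) < e"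
      using est[of k] unfolding E_def by (intro exI[of _ k]) force
  qed auto
  with F show ?thesis using that by blast
qed

text \<open>
  Linearity of \<open>\<Phi>\<close> is required on combinations of the \<open>f i\<close> alone, since the integral is not
  additive on functions that are not integrable.
\<close>

lemma tail_hull_functional_ge:
  fixes \<Phi> :: "('a \<Rightarrow> 'b::real_vector) \<Rightarrow> real"
  assumes F: "F \<in> tail_hull f n"
    and lin: "\<And>c N. \<Phi> (\<lambda>x. \<Sum>i\<le>N. c i *\<^sub>R f i x) = (\<Sum>i\<le>N. c i * \<Phi> (f i))"
    and ge: "\<And>i. n \<le> i \<Longrightarrow> a \<le> \<Phi> (f i)"
  shows "a \<le> \<Phi> F"
proof -
  obtain c :: "nat \<Rightarrow> real" and N where c: "F = (\<lambda>x. \<Sum>i\<le>N. c i *\<^sub>R f i x)" "\<forall>i. 0 \<le> c i" "\<forall>i. i < n \<or> N < i \<longrightarrow> c i = 0"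
     "(\<Sum>i\<le>N. c i) = 1" using F unfolding tail_hull_def by blast
  have "a = (\<Sum>i\<le>N. c i * a)" by (simp add: sum_distrib_right[symmetric] c(4))
  also have "\<dots> \<le> (\<Sum>i\<le>N. c i * \<Phi> (f i))"
  proof (rule sum_mono)
    fix i
    show "c i * a \<le> c i * \<Phi> (f i)"
      using c(2,3) ge[of i] by (cases "n \<le> i") (auto intro: mult_left_mono)
  qed
  also have "\<dots> = \<Phi> F" unfolding c(1) lin ..
  finally show ?thesis .
qed

lemma tail_hull_functional_eventually_ge:
  fixes \<Phi> :: "('a \<Rightarrow> 'b::real_vector) \<Rightarrow> real"
  assumes F: "\<And>n. F n \<in> tail_hull f n"
    and lin: "\<And>c N. \<Phi> (\<lambda>x. \<Sum>i\<le>N. c i *\<^sub>R f i x) = (\<Sum>i\<le>N. c i * \<Phi> (f i))"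
    and ev: "\<forall>\<^sub>F i in sequentially. a \<le> \<Phi> (f i)"
  shows "\<forall>\<^sub>F n in sequentially. a \<le> \<Phi> (F n)"
proof -
  obtain N where N: "\<And>i. N \<le> i \<Longrightarrow> a \<le> \<Phi> (f i)" using ev unfolding eventually_sequentially by blast
  show ?thesis unfolding eventually_sequentially
    by (intro exI[of _ N] allI impI tail_hull_functional_ge[OF F lin N]) (erule order_trans, assumption)
qed

lemma inner_functional_linear:
  assumes "\<And>i. sq_integrable M (f i)" "sq_integrable M Y"
  shows "(\<integral>x. (\<Sum>i\<le>N. c i *\<^sub>R f i x) \<bullet> Y x \<partial>M) = (\<Sum>i\<le>(N::nat). c i * (\<integral>x. f i x \<bullet> Y x \<partial>M))"
proof -
  have "(\<integral>x. (\<Sum>i\<le>N. c i *\<^sub>R f i x) \<bullet> Y x \<partial>M) = (\<integral>x. (\<Sum>i\<le>N. c i * (f i x \<bullet> Y x)) \<partial>M)"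
    by (simp add: inner_sum_left)
  also have "\<dots> = (\<Sum>i\<le>N. (\<integral>x. c i * (f i x \<bullet> Y x) \<partial>M))"
    by (rule Bochner_Integration.integral_sum) (intro integrable_mult_right integrable_inner assms)
  finally show ?thesis by simp
qed

section \<open>Calculus of smooth functions\<close>

lemma differentiable_has_derivative:
  "f differentiable (at x) \<Longrightarrow> (f has_derivative frechet_derivative f (at x)) (at x)"
  by (simp add: frechet_derivative_works)

lemma partial_deriv_eqI:
  "(f has_derivative D) (at x) \<Longrightarrow> partial_deriv f b x = D b"
  unfolding partial_deriv_def by (metis frechet_derivative_at)

lemma C_k_imp_continuous: "C_k k f \<Longrightarrow> continuous_on UNIV f"
  by (cases k) (auto intro!: differentiable_imp_continuous_on simp: differentiable_on_def differentiable_at_withinI)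

lemma C_k_Suc_imp: "C_k (Suc k) f \<Longrightarrow> C_k k f"
proof (induction k arbitrary: f)
  case 0
  then show ?case using C_k_imp_continuous[OF 0] by simp
next
  case (Suc k)
  then show ?case by (metis C_k.simps(2))
qed

lemma C_k_const: "C_k k (\<lambda>x. c)"
proof (induction k arbitrary: c)
  case (Suc k)
  have "partial_deriv (\<lambda>x::'a. c) b = (\<lambda>x. 0)" for b :: 'a
    by (rule ext) (rule partial_deriv_eqI, rule has_derivative_const)
  then show ?case using Suc by simp
qed simp

lemma C_k_add: "C_k k f \<Longrightarrow> C_k k g \<Longrightarrow> C_k k (\<lambda>x. f x + g x)"
proof (induction k arbitrary: f g)
  case 0 then show ?case by (auto intro: continuous_on_add)
next
  case (Suc k)
  have "partial_deriv (\<lambda>x. f x + g x) b = (\<lambda>x. partial_deriv f b x + partial_deriv g b x)" for b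
    unfolding partial_deriv_def fun_eq_iff using Suc.prems
    by (auto intro!: partial_deriv_eqI[unfolded partial_deriv_def] has_derivative_add differentiable_has_derivative)
  then show ?case using Suc by auto
qed

lemma C_k_mult: "C_k k f \<Longrightarrow> C_k k g \<Longrightarrow> C_k k (\<lambda>x. f x * g x)"
proof (induction k arbitrary: f g)
  case 0 then show ?case by (auto intro: continuous_on_mult)
next
  case (Suc k)
  have "partial_deriv (\<lambda>x. f x * g x) b = (\<lambda>x. f x * partial_deriv g b x + partial_deriv f b x * g x)" for b
    unfolding partial_deriv_def fun_eq_iff using Suc.prems
    by (auto intro!: partial_deriv_eqI[unfolded partial_deriv_def] has_derivative_mult differentiable_has_derivative)
  then show ?case using Suc C_k_Suc_imp[OF Suc.prems(1)] C_k_Suc_imp[OF Suc.prems(2)]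
    by (auto intro!: C_k_add Suc.IH)
qed

lemma C_k_compose:
  fixes h :: "real \<Rightarrow> real"
  shows "C_k k h \<Longrightarrow> C_k k f \<Longrightarrow> C_k k (\<lambda>x. h (f x))"
proof (induction k arbitrary: f h)
  case 0 then show ?case by (auto intro: continuous_on_compose2)
next
  case (Suc k)
  have "partial_deriv (\<lambda>x. h (f x)) b = (\<lambda>x. partial_deriv h 1 (f x) * partial_deriv f b x)" for b
  proof
    fix x
    have h: "(h has_derivative frechet_derivative h (at (f x))) (at (f x))"
      and f: "(f has_derivative frechet_derivative f (at x)) (at x)"
      using Suc.prems by (auto intro: differentiable_has_derivative)
    have "((\<lambda>x. h (f x)) has_derivative (\<lambda>v. frechet_derivative h (at (f x)) (frechet_derivative f (at x) v))) (at x)"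
      using has_derivative_compose[OF f h] .
    then have "partial_deriv (\<lambda>x. h (f x)) b x = frechet_derivative h (at (f x)) (frechet_derivative f (at x) b *\<^sub>R 1)"
      by (simp add: partial_deriv_eqI)
    also have "\<dots> = frechet_derivative f (at x) b *\<^sub>R frechet_derivative h (at (f x)) 1"
      by (rule linear_cmul[OF has_derivative_linear[OF h]])
    finally show "partial_deriv (\<lambda>x. h (f x)) b x = partial_deriv h 1 (f x) * partial_deriv f b x"
      by (simp add: partial_deriv_def)
  qed
  moreover have "(\<lambda>x. h (f x)) differentiable at x" for x
    by (rule differentiable_compose[where g=f and f=h]) (use Suc.prems in simp_all)
  moreover have "C_k k (\<lambda>x. partial_deriv h 1 (f x) * partial_deriv f b x)" if "b \<in> Basis" for b
    using Suc.prems that by (intro C_k_mult Suc.IH[of "partial_deriv h 1"] C_k_Suc_imp[OF Suc.prems(2)]) simp_all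
  ultimately show ?case by simp
qed

text \<open>
  Smoothness by coinduction: all functions of a class that is stable under taking partial derivatives are smooth.
\<close>

lemma C_k_coinduct:
  assumes "P f" "\<And>f x. P f \<Longrightarrow> f differentiable (at x)"
    and "\<And>f b. P f \<Longrightarrow> b \<in> Basis \<Longrightarrow> P (partial_deriv f b)"
  shows "C_k k f"
  using assms(1)
proof (induction k arbitrary: f)
  case 0
  then show ?case using assms(2)
    by (auto intro!: differentiable_imp_continuous_on simp: differentiable_on_def differentiable_at_withinI)
qed (use assms in auto)

definition smooth :: "('a::euclidean_space \<Rightarrow> real) \<Rightarrow> bool" where
  "smooth f \<longleftrightarrow> (\<forall>k. C_k k f)"

lemma smooth_const [simp]: "smooth (\<lambda>x. c)"
  and smooth_add: "smooth f \<Longrightarrow> smooth g \<Longrightarrow> smooth (\<lambda>x. f x + g x)"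
  and smooth_mult: "smooth f \<Longrightarrow> smooth g \<Longrightarrow> smooth (\<lambda>x. f x * g x)"
  by (simp_all add: smooth_def C_k_const C_k_add C_k_mult)

lemma smooth_compose: "smooth (h::real \<Rightarrow> real) \<Longrightarrow> smooth f \<Longrightarrow> smooth (\<lambda>x. h (f x))"
  by (simp add: smooth_def C_k_compose)

lemma smooth_diff: "smooth f \<Longrightarrow> smooth g \<Longrightarrow> smooth (\<lambda>x. f x - g x)"
  using smooth_add[of f "\<lambda>x. -1 * g x"] smooth_mult[of "\<lambda>x. -1" g] by simp

lemma smooth_power: "smooth f \<Longrightarrow> smooth (\<lambda>x. f x ^ n)"
  by (induction n) (auto intro: smooth_mult)

lemma smooth_sum: "(\<And>i. i \<in> I \<Longrightarrow> smooth (f i)) \<Longrightarrow> smooth (\<lambda>x. \<Sum>i\<in>I. f i x)"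
  by (induction I rule: infinite_finite_induct) (auto intro: smooth_add)

lemma smooth_prod: "(\<And>i. i \<in> I \<Longrightarrow> smooth (f i)) \<Longrightarrow> smooth (\<lambda>x. \<Prod>i\<in>I. f i x)"
  by (induction I rule: infinite_finite_induct) (auto intro: smooth_mult)

lemma smooth_partial: "smooth f \<Longrightarrow> b \<in> Basis \<Longrightarrow> smooth (partial_deriv f b)"
  unfolding smooth_def by (metis C_k.simps(2))

lemma smooth_differentiable: "smooth f \<Longrightarrow> f differentiable (at x)"
  unfolding smooth_def by (metis C_k.simps(2))

lemma smooth_continuous: "smooth f \<Longrightarrow> continuous_on UNIV f"
  unfolding smooth_def using C_k_imp_continuous by blast

lemma smooth_inner_const: "smooth (\<lambda>x. x \<bullet> c)"
proof -
  have "C_k k (\<lambda>x. x \<bullet> c)" for k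
  proof (cases k)
    case (Suc n)
    have "partial_deriv (\<lambda>x. x \<bullet> c) b = (\<lambda>x. b \<bullet> c)" for b
      by (rule ext) (rule partial_deriv_eqI, auto intro!: derivative_eq_intros)
    then show ?thesis using Suc
      by (auto simp: C_k_const differentiable_def intro!: exI derivative_eq_intros)
  qed (auto intro: continuous_intros)
  then show ?thesis by (simp add: smooth_def)
qed

lemma smooth_id: "smooth (\<lambda>x::real. x)"
  using smooth_inner_const[of "1::real"] by simp

lemma smooth_inverse:
  assumes "smooth f" "\<And>x. f x \<noteq> 0"
  shows "smooth (\<lambda>x. inverse (f x))"
proof -
  have "C_k k (\<lambda>x. inverse (f x))" for k
  proof (induction k)
    case 0
    then show ?case using assms by (simp add: continuous_on_inverse[OF smooth_continuous])
  next
    case (Suc k)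
    have d: "((\<lambda>x. inverse (f x)) has_derivative (\<lambda>v. - (inverse (f x) * frechet_derivative f (at x) v * inverse (f x)))) (at x)" for x
      by (rule Deriv.has_derivative_inverse[OF assms(2) differentiable_has_derivative[OF smooth_differentiable[OF assms(1)]]])
    have "partial_deriv (\<lambda>x. inverse (f x)) b = (\<lambda>x. (-1) * (inverse (f x) * partial_deriv f b x * inverse (f x)))" for b
      unfolding fun_eq_iff using partial_deriv_eqI[OF d] by (simp add: partial_deriv_def)
    moreover have "C_k k (\<lambda>x. (-1) * (inverse (f x) * partial_deriv f b x * inverse (f x)))" if "b \<in> Basis" for b
      by (intro C_k_mult C_k_const Suc smooth_partial[OF assms(1) that, unfolded smooth_def, rule_format])
    moreover have "(\<lambda>x. inverse (f x)) differentiable at x" for x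
      using d by (auto simp: differentiable_def)
    ultimately show ?case by simp
  qed
  then show ?thesis by (simp add: smooth_def)
qed

lemma smooth_has_derivative_grad:
  assumes "smooth f"
  shows "(f has_derivative (\<lambda>v. grad f x \<bullet> v)) (at x)"
proof -
  have d: "(f has_derivative frechet_derivative f (at x)) (at x)"
    using assms by (intro differentiable_has_derivative smooth_differentiable)
  have "frechet_derivative f (at x) v = grad f x \<bullet> v" for v
  proof -
    have "frechet_derivative f (at x) v = frechet_derivative f (at x) (\<Sum>b\<in>Basis. (v \<bullet> b) *\<^sub>R b)"
      by (simp add: euclidean_representation)
    also have "\<dots> = (\<Sum>b\<in>Basis. (v \<bullet> b) * partial_deriv f b x)"
      using has_derivative_linear[OF d] by (simp add: linear_sum linear_cmul partial_deriv_def)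
    also have "\<dots> = grad f x \<bullet> v"
      by (simp add: grad_def inner_sum_left) (simp add: inner_commute mult.commute)
    finally show ?thesis .
  qed
  then have "frechet_derivative f (at x) = (\<bullet>) (grad f x)" by (rule ext)
  with d show ?thesis by simp
qed

lemma grad_eqI:
  assumes "(f has_derivative (\<lambda>v. a \<bullet> v)) (at x)"
  shows "grad f x = a"
  unfolding grad_def using partial_deriv_eqI[OF assms] by (simp add: euclidean_representation)

lemma grad_const: "grad (\<lambda>x. c) x = 0"
  by (rule grad_eqI) simp

lemma grad_add: "smooth f \<Longrightarrow> smooth g \<Longrightarrow> grad (\<lambda>x. f x + g x) x = grad f x + grad g x"
  by (rule grad_eqI) (auto intro!: derivative_eq_intros smooth_has_derivative_grad simp: inner_add_left)

lemma grad_mult: "smooth f \<Longrightarrow> smooth g \<Longrightarrow> grad (\<lambda>x. f x * g x) x = f x *\<^sub>R grad g x + g x *\<^sub>R grad f x"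
  by (rule grad_eqI) (auto intro!: derivative_eq_intros smooth_has_derivative_grad simp: inner_add_left fun_eq_iff)

lemma grad_cmult: "smooth f \<Longrightarrow> grad (\<lambda>x. c * f x) x = c *\<^sub>R grad f x"
  by (simp add: grad_mult grad_const)

lemma smooth_DERIV: "smooth (h::real \<Rightarrow> real) \<Longrightarrow> (h has_field_derivative deriv h x) (at x)"
  by (simp add: DERIV_deriv_iff_real_differentiable smooth_differentiable)

lemma partial_deriv_real: "smooth (h::real \<Rightarrow> real) \<Longrightarrow> partial_deriv h 1 x = deriv h x"
  using partial_deriv_eqI[OF smooth_DERIV[of h x, unfolded has_field_derivative_def], of 1] by simp

lemma smooth_deriv: "smooth (h::real \<Rightarrow> real) \<Longrightarrow> smooth (deriv h)"
  using smooth_partial[of h 1] partial_deriv_real[of h] by (simp add: ext[of "partial_deriv h 1" "deriv h"])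

lemma grad_compose:
  assumes "smooth (h::real \<Rightarrow> real)" "smooth f"
  shows "grad (\<lambda>x. h (f x)) x = deriv h (f x) *\<^sub>R grad f x"
proof (rule grad_eqI)
  have "((\<lambda>x. h (f x)) has_derivative (\<lambda>v. (grad f x \<bullet> v) * deriv h (f x))) (at x)"
    using has_derivative_compose[OF smooth_has_derivative_grad[OF assms(2)] smooth_DERIV[OF assms(1), unfolded has_field_derivative_def]]
    by (simp add: mult.commute)
  moreover have "(\<lambda>v. (grad f x \<bullet> v) * deriv h (f x)) = (\<bullet>) (deriv h (f x) *\<^sub>R grad f x)"
    by (rule ext) (simp add: mult.commute)
  ultimately show "((\<lambda>x. h (f x)) has_derivative (\<bullet>) (deriv h (f x) *\<^sub>R grad f x)) (at x)"
    by simp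
qed

lemma grad_continuous: "smooth f \<Longrightarrow> continuous_on UNIV (grad f)"
  unfolding grad_def by (intro continuous_intros smooth_continuous smooth_partial)

section \<open>A smooth step\<close>

text \<open>
  The polynomial factor is there because the functions \<open>P(1/t) exp(-1/t)\<close>, continued by 0 to \<open>t \<le> 0\<close>, form
  a class that is closed under differentiation, whereas \<open>exp(-1/t)\<close> alone does not.
\<close>

definition flat_exp :: "real poly \<Rightarrow> real \<Rightarrow> real" where
  "flat_exp P t = (if t \<le> 0 then 0 else poly P (1 / t) * exp (- (1 / t)))"

lemma flat_exp_deriv:
  "(flat_exp P has_field_derivative flat_exp (monom 1 2 * (P - pderiv P)) t) (at t)"
proof -
  consider "t < 0" | "t = 0" | "t > 0" by linarith
  then show ?thesis
  proof cases
    case 1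
    have "((\<lambda>_. 0) has_field_derivative 0) (at t)" by simp
    then have "(flat_exp P has_field_derivative 0) (at t)"
      by (rule has_field_derivative_transform_within_open[where S="{..<0}"]) (use 1 in \<open>auto simp: flat_exp_def\<close>)
    then show ?thesis using 1 by (simp add: flat_exp_def)
  next
    case 3
    have "((\<lambda>t. poly P (1 / t) * exp (- (1 / t))) has_field_derivative
        flat_exp (monom 1 2 * (P - pderiv P)) t) (at t)"
      using 3 by (auto intro!: derivative_eq_intros poly_DERIV[THEN DERIV_chain2]
          simp: flat_exp_def poly_monom field_simps power2_eq_square)
    then show ?thesis
      by (rule has_field_derivative_transform_within_open[where S="{0<..}"]) (use 3 in \<open>auto simp: flat_exp_def\<close>)
  next
    case 2
    \<comment> \<open>The difference quotient at 0 is \<open>s P(s) exp(-s)\<close> with \<open>s = 1/t\<close>; the factor \<open>s\<close> is the \<open>pCons 0\<close>.\<close>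
    have "((\<lambda>s. poly (pCons 0 P) s / exp s) \<longlongrightarrow> 0) at_top"
    proof -
      have "((\<lambda>s. \<Sum>i\<le>degree Q. coeff Q i * (s ^ i / exp s)) \<longlongrightarrow> (\<Sum>i\<le>degree Q. coeff Q i * 0)) at_top" for Q :: "real poly"
        by (intro tendsto_intros tendsto_power_div_exp_0)
      from this[of "pCons 0 P"] show ?thesis unfolding poly_altdef sum_divide_distrib
        by (simp only: times_divide_eq_right mult_zero_right sum.neutral_const)
    qed
    then have lim: "((\<lambda>t. poly (pCons 0 P) (inverse t) / exp (inverse t)) \<longlongrightarrow> 0) (at_right 0)"
      by (rule filterlim_compose[OF _ filterlim_inverse_at_top_right])
    have "((\<lambda>t. (flat_exp P t - flat_exp P 0) / (t - 0)) \<longlongrightarrow> 0) (at_right 0)"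
      by (rule Lim_transform_eventually[OF lim])
        (auto simp: flat_exp_def eventually_at_right_field exp_minus field_simps intro!: exI[of _ 1])
    moreover have "((\<lambda>t. (flat_exp P t - flat_exp P 0) / (t - 0)) \<longlongrightarrow> 0) (at_left 0)"
      by (rule Lim_transform_eventually[OF tendsto_const])
        (auto simp: flat_exp_def eventually_at_left_field intro!: exI[of _ "-1"])
    ultimately have "((\<lambda>t. (flat_exp P t - flat_exp P 0) / (t - 0)) \<longlongrightarrow> 0) (at 0)"
      by (simp add: filterlim_split_at_real)
    then show ?thesis using 2 by (simp add: has_field_derivative_iff flat_exp_def)
  qed
qed

lemma smooth_flat_exp: "smooth (flat_exp P)"
proof -
  have "C_k k (flat_exp P)" for k
  proof (rule C_k_coinduct[where P="\<lambda>f. \<exists>P. f = flat_exp P"])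
    fix f :: "real \<Rightarrow> real" and b assume "\<exists>P. f = flat_exp P" and b: "b \<in> (Basis :: real set)"
    then obtain P where P: "f = flat_exp P" by blast
    show "\<exists>P. partial_deriv f b = flat_exp P"
      using b partial_deriv_eqI[OF flat_exp_deriv[of P, unfolded has_field_derivative_def]] P
      by (auto intro!: exI[of _ "monom 1 2 * (P - pderiv P)"])
  qed (use flat_exp_deriv in \<open>auto simp: real_differentiable_def\<close>)
  then show ?thesis by (simp add: smooth_def)
qed

definition smooth_step :: "real \<Rightarrow> real" where
  "smooth_step t = flat_exp 1 t * inverse (flat_exp 1 t + flat_exp 1 (1 - t))"

lemma flat_exp_1: "flat_exp 1 t \<ge> 0" "flat_exp 1 t = 0 \<longleftrightarrow> t \<le> 0" "flat_exp 1 t + flat_exp 1 (1 - t) > 0"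
  by (auto simp: flat_exp_def add_pos_pos add_nonneg_pos)

lemma smooth_smooth_step: "smooth smooth_step"
proof -
  have "smooth (\<lambda>t. 1 - t)" by (intro smooth_diff smooth_id smooth_const)
  from smooth_compose[OF smooth_flat_exp[of 1] this]
  show ?thesis
    unfolding smooth_step_def[abs_def]
    using flat_exp_1(3) by (intro smooth_mult smooth_inverse smooth_add smooth_flat_exp) (auto simp: less_imp_neq[THEN not_sym])
qed

lemma smooth_step_le_0: "t \<le> 0 \<Longrightarrow> smooth_step t = 0"
  by (simp add: smooth_step_def flat_exp_def)

lemma smooth_step_ge_1: "t \<ge> 1 \<Longrightarrow> smooth_step t = 1"
  by (simp add: smooth_step_def flat_exp_def)

lemma smooth_step_bounds: "0 \<le> smooth_step t" "smooth_step t \<le> 1"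
  using flat_exp_1(1)[of t] flat_exp_1(1)[of "1 - t"] flat_exp_1(3)[of t]
  by (auto simp: smooth_step_def field_simps)

lemma deriv_smooth_step_0: "t < 0 \<or> 1 < t \<Longrightarrow> deriv smooth_step t = 0"
proof -
  assume "t < 0 \<or> 1 < t"
  then obtain c and S :: "real set" where S: "open S" "t \<in> S" "\<And>s. s \<in> S \<Longrightarrow> c = smooth_step s"
    using smooth_step_le_0 smooth_step_ge_1
    by (metis greaterThan_iff lessThan_iff less_imp_le open_greaterThan open_lessThan)
  have "((\<lambda>_. c) has_field_derivative 0) (at t)" by simp
  then have "(smooth_step has_field_derivative 0) (at t)"
    by (rule has_field_derivative_transform_within_open[OF _ S])
  then show ?thesis by (rule DERIV_imp_deriv)
qed

lemma deriv_smooth_step_bounded: obtains C where "C \<ge> 0" "\<And>t. \<bar>deriv smooth_step t\<bar> \<le> C"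
proof -
  have "compact (deriv smooth_step ` {0..1})"
    by (intro compact_continuous_image continuous_on_subset[OF smooth_continuous[OF smooth_deriv[OF smooth_smooth_step]]]) auto
  then obtain C where C: "\<And>y. y \<in> deriv smooth_step ` {0..1} \<Longrightarrow> norm y \<le> C"
    by (meson bounded_iff compact_imp_bounded)
  have "\<bar>deriv smooth_step t\<bar> \<le> max C 0" for t
    using C[of "deriv smooth_step t"] deriv_smooth_step_0[of t] by (cases "0 \<le> t \<and> t \<le> 1") force+
  then show ?thesis by (intro that[of "max C 0"]) auto
qed

section \<open>Test functions\<close>

lemma lebesgue_measurable_continuous:
  fixes f :: "'a::euclidean_space \<Rightarrow> 'b::euclidean_space"
  assumes "continuous_on UNIV f"
  shows "f \<in> borel_measurable lebesgue"
  using borel_measurable_continuous_onI[OF assms] by (intro measurable_completion) simp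

lemma C0_infI:
  assumes "smooth f" "compact K" "K \<subseteq> U" "\<And>x. x \<notin> K \<Longrightarrow> f x = 0"
  shows "f \<in> C0_inf U"
proof -
  have "{x. f x \<noteq> 0} \<subseteq> K" using assms(4) by blast
  then have 1: "closure {x. f x \<noteq> 0} \<subseteq> K" using assms(2) by (intro closure_minimal compact_imp_closed)
  then have "compact (closure {x. f x \<noteq> 0})"
    using assms(2) compact_Int_closed[of K "closure {x. f x \<noteq> 0}"] by (simp add: Int_absorb1)
  with 1 assms show ?thesis by (auto simp: C0_inf_def smooth_def)
qed

lemma C0_inf_smooth: "f \<in> C0_inf U \<Longrightarrow> smooth f"
  by (simp add: C0_inf_def smooth_def)

lemma C0_inf_support:
  assumes "f \<in> C0_inf U"
  obtains K where "compact K" "K \<subseteq> U" "\<And>x. x \<notin> K \<Longrightarrow> f x = 0" "\<And>x. x \<notin> K \<Longrightarrow> grad f x = 0"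
proof -
  define K where "K = closure {x. f x \<noteq> 0}"
  have K: "compact K" "K \<subseteq> U" using assms by (auto simp: C0_inf_def K_def)
  have f0: "f x = 0" if "x \<notin> K" for x
    using that closure_subset[of "{x. f x \<noteq> 0}"] unfolding K_def by blast
  have "grad f x = 0" if "x \<notin> K" for x
  proof (rule grad_eqI)
    have "((\<lambda>_. 0) has_derivative (\<lambda>v. 0 \<bullet> v)) (at x)" by simp
    then show "(f has_derivative (\<lambda>v. 0 \<bullet> v)) (at x)"
      by (rule has_derivative_transform_within_open[where s="- K"])
        (use that f0 K(1) in \<open>auto simp: compact_imp_closed open_Compl\<close>)
  qed
  with K f0 show ?thesis by (rule that)
qed

lemma C0_inf_add: "f \<in> C0_inf U \<Longrightarrow> g \<in> C0_inf U \<Longrightarrow> (\<lambda>x. f x + g x) \<in> C0_inf U"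
proof -
  assume f: "f \<in> C0_inf U" and g: "g \<in> C0_inf U"
  obtain K where K: "compact K" "K \<subseteq> U" "\<And>x. x \<notin> K \<Longrightarrow> f x = 0" using C0_inf_support[OF f] by metis
  obtain L where L: "compact L" "L \<subseteq> U" "\<And>x. x \<notin> L \<Longrightarrow> g x = 0" using C0_inf_support[OF g] by metis
  show ?thesis
    by (rule C0_infI[of _ "K \<union> L"]) (use K L f g in \<open>auto intro: smooth_add C0_inf_smooth\<close>)
qed

lemma C0_inf_mult:
  assumes "smooth r" "f \<in> C0_inf U"
  shows "(\<lambda>x. r x * f x) \<in> C0_inf U"
proof -
  obtain K where K: "compact K" "K \<subseteq> U" "\<And>x. x \<notin> K \<Longrightarrow> f x = 0" using C0_inf_support[OF assms(2)] by metis
  show ?thesis by (rule C0_infI[OF smooth_mult[OF assms(1) C0_inf_smooth[OF assms(2)]] K(1,2)]) (simp add: K(3))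
qed

lemma C0_inf_compose:
  assumes "smooth h" "h 0 = 0" "f \<in> C0_inf U"
  shows "(\<lambda>x. h (f x)) \<in> C0_inf U"
proof -
  obtain K where K: "compact K" "K \<subseteq> U" "\<And>x. x \<notin> K \<Longrightarrow> f x = 0" using C0_inf_support[OF assms(3)] by metis
  show ?thesis by (rule C0_infI[OF smooth_compose[OF assms(1) C0_inf_smooth[OF assms(3)]] K(1,2)]) (simp add: K(3) assms(2))
qed

lemma C0_inf_mono: "f \<in> C0_inf U \<Longrightarrow> U \<subseteq> V \<Longrightarrow> f \<in> C0_inf V"
  by (auto simp: C0_inf_def)

lemma continuous_compact_support_bounded:
  fixes f :: "'a::euclidean_space \<Rightarrow> 'b::euclidean_space"
  assumes "continuous_on UNIV f" "compact K" "\<And>x. x \<notin> K \<Longrightarrow> f x = 0"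
  obtains C where "0 \<le> C" "\<And>x. norm (f x) \<le> C"
proof -
  have "bounded (f ` K)"
    by (intro compact_imp_bounded compact_continuous_image continuous_on_subset[OF assms(1)] assms(2)) simp
  then obtain C where "\<And>y. y \<in> f ` K \<Longrightarrow> norm y \<le> C" by (auto simp: bounded_iff)
  then have "norm (f x) \<le> max C 0" for x using assms(3)[of x] by (cases "x \<in> K") force+
  then show ?thesis by (intro that[of "max C 0"]) auto
qed

lemma integrable_continuous_compact_support:
  fixes f :: "'a::euclidean_space \<Rightarrow> 'b::euclidean_space"
  assumes "continuous_on UNIV f" "compact K" "\<And>x. x \<notin> K \<Longrightarrow> f x = 0"
  shows "integrable lebesgue f"
proof -
  have "integrable lborel (\<lambda>x. indicator K x *\<^sub>R f x)"
    by (rule borel_integrable_compact[OF assms(2) continuous_on_subset[OF assms(1)]]) simp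
  also have "(\<lambda>x. indicator K x *\<^sub>R f x) = f" using assms(3) by (auto simp: indicator_def fun_eq_iff)
  finally have "integrable lborel f" .
  then show ?thesis by (subst integrable_completion) auto
qed

lemma sq_integrable_continuous_compact_support:
  fixes f :: "'a::euclidean_space \<Rightarrow> 'b::euclidean_space"
  assumes "continuous_on UNIV f" "compact K" "\<And>x. x \<notin> K \<Longrightarrow> f x = 0"
  shows "sq_integrable lebesgue f"
  unfolding sq_integrable_def
proof
  show "integrable lebesgue (\<lambda>x. (norm (f x))\<^sup>2)"
    by (rule integrable_continuous_compact_support[OF _ assms(2)])
      (simp_all add: assms(3) continuous_on_power continuous_on_norm[OF assms(1)])
qed (rule lebesgue_measurable_continuous[OF assms(1)])

lemma C0_inf_sq_integrable:
  assumes "f \<in> C0_inf U"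
  shows "sq_integrable lebesgue f" "sq_integrable lebesgue (grad f)"
  using C0_inf_support[OF assms] C0_inf_smooth[OF assms]
  by (metis sq_integrable_continuous_compact_support smooth_continuous grad_continuous)+

lemma C0_inf_bounded:
  assumes "f \<in> C0_inf U"
  obtains C where "0 \<le> C" "\<And>x. \<bar>f x\<bar> \<le> C" "\<And>x. norm (grad f x) \<le> C"
proof -
  obtain K where K: "compact K" "\<And>x. x \<notin> K \<Longrightarrow> f x = 0" "\<And>x. x \<notin> K \<Longrightarrow> grad f x = 0"
    using C0_inf_support[OF assms] by metis
  have s: "smooth f" by (rule C0_inf_smooth[OF assms])
  obtain C where C: "0 \<le> C" "\<And>x. norm (f x) \<le> C"
    using continuous_compact_support_bounded[OF smooth_continuous[OF s] K(1,2)] by metis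
  obtain D where D: "0 \<le> D" "\<And>x. norm (grad f x) \<le> D"
    using continuous_compact_support_bounded[OF grad_continuous[OF s] K(1,3)] by metis
  show ?thesis
  proof (rule that[of "max C D"])
    show "\<bar>f x\<bar> \<le> max C D" "norm (grad f x) \<le> max C D" for x
      using C(2)[of x] D(2)[of x] by auto
  qed (use C in auto)
qed

section \<open>The space \<open>\<D>\<^sub>0\<^sup>1\<^sup>,\<^sup>2\<close>\<close>

text \<open>
  The diagonal argument by which the closure of the test functions is closed.
\<close>

lemma L2_tendsto_perturb:
  assumes "\<And>n. sq_integrable M (f n)" "L2_tendsto M u v"
    and "\<And>n. sqnorm M (\<lambda>x. f n x - u n x) \<le> 1 / Suc n"
  shows "L2_tendsto M f v"
proof -
  have "L2_tendsto M (\<lambda>n x. f n x - u n x) (\<lambda>x. 0)"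
  proof (rule L2_tendstoI_bound[where e="\<lambda>n. 1 / Suc n"])
    show "(\<lambda>n. 1 / real (Suc n)) \<longlonglongrightarrow> 0" by (rule LIMSEQ_Suc[OF lim_const_over_n])
  qed (use assms L2_tendstoD[OF assms(2)] in \<open>auto intro: sq_integrable_diff\<close>)
  from L2_tendsto_add[OF this assms(2)] show ?thesis by simp
qed

lemma L2_tendsto_nn_integral_iff:
  fixes u :: "'a::euclidean_space \<Rightarrow> 'b::euclidean_space"
  assumes f: "\<And>n::nat. sq_integrable M (f n)"
  shows "L2_tendsto M f u \<longleftrightarrow> u \<in> borel_measurable M \<and>
      (\<lambda>n. \<integral>\<^sup>+x. ennreal ((norm (f n x - u x))\<^sup>2) \<partial>M) \<longlonglongrightarrow> 0"
proof safe
  assume L: "L2_tendsto M f u"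
  note D = L2_tendstoD[OF L]
  show "u \<in> borel_measurable M" by (rule D)
  show "(\<lambda>n. \<integral>\<^sup>+x. ennreal ((norm (f n x - u x))\<^sup>2) \<partial>M) \<longlonglongrightarrow> 0"
    unfolding nn_integral_sq[OF sq_integrable_diff[OF D(1,2)]]
    using tendsto_ennrealI[OF D(5)] by simp
next
  assume u: "u \<in> borel_measurable M"
    and lim: "(\<lambda>n. \<integral>\<^sup>+x. ennreal ((norm (f n x - u x))\<^sup>2) \<partial>M) \<longlonglongrightarrow> 0"
  have "eventually (\<lambda>n. (\<integral>\<^sup>+x. ennreal ((norm (f n x - u x))\<^sup>2) \<partial>M) < \<infinity>) sequentially"
    using order_tendstoD(2)[OF lim, of \<infinity>] by simp
  then obtain n where n: "(\<integral>\<^sup>+x. ennreal ((norm (f n x - u x))\<^sup>2) \<partial>M) < \<infinity>"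
    by (auto dest: eventually_happens)
  have "sq_integrable M (\<lambda>x. f n x - u x)"
    by (rule sq_integrable_nn[OF _ n]) (use u sq_integrableD(1)[OF f] in auto)
  from sq_integrable_diff[OF f[of n] this] have us: "sq_integrable M u" by simp
  have "(\<lambda>n. ennreal (sqnorm M (\<lambda>x. f n x - u x))) \<longlonglongrightarrow> ennreal 0"
    using lim unfolding nn_integral_sq[OF sq_integrable_diff[OF f us]] by simp
  then have "(\<lambda>n. sqnorm M (\<lambda>x. f n x - u x)) \<longlonglongrightarrow> 0"
    by (subst (asm) tendsto_ennreal_iff) auto
  with f us show "L2_tendsto M f u" by (simp add: L2_tendsto_def)
qed

text \<open>
  The definition is stated with nonnegative integrals, which may be infinite; here it becomes convergence in
  \<open>L\<^sup>2\<close> of the functions and of their gradients.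
\<close>

lemma D12_0_iff:
  "D12_0 U u g \<longleftrightarrow> (\<exists>f. (\<forall>n. f n \<in> C0_inf U) \<and> L2_tendsto lebesgue f u \<and>
      L2_tendsto lebesgue (\<lambda>n. grad (f n)) g)" (is "_ \<longleftrightarrow> ?R")
proof -
  have 1: "(\<forall>n::nat. f n \<in> C0_inf U) \<Longrightarrow> L2_tendsto lebesgue f u \<longleftrightarrow> u \<in> borel_measurable lebesgue \<and>
      (\<lambda>n. \<integral>\<^sup>+x. ennreal ((f n x - u x)\<^sup>2) \<partial>lebesgue) \<longlonglongrightarrow> 0" for f
    by (subst L2_tendsto_nn_integral_iff) (auto intro: C0_inf_sq_integrable)
  have 2: "(\<forall>n::nat. f n \<in> C0_inf U) \<Longrightarrow> L2_tendsto lebesgue (\<lambda>n. grad (f n)) g \<longleftrightarrow> g \<in> borel_measurable lebesgue \<and>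
      (\<lambda>n. \<integral>\<^sup>+x. ennreal ((norm (grad (f n) x - g x))\<^sup>2) \<partial>lebesgue) \<longlonglongrightarrow> 0" for f
    by (rule L2_tendsto_nn_integral_iff) (auto intro: C0_inf_sq_integrable)
  have "?R \<longleftrightarrow> (\<exists>f. (\<forall>n::nat. f n \<in> C0_inf U) \<and> (u \<in> borel_measurable lebesgue \<and>
      (\<lambda>n. \<integral>\<^sup>+x. ennreal ((f n x - u x)\<^sup>2) \<partial>lebesgue) \<longlonglongrightarrow> 0) \<and> (g \<in> borel_measurable lebesgue \<and>
      (\<lambda>n. \<integral>\<^sup>+x. ennreal ((norm (grad (f n) x - g x))\<^sup>2) \<partial>lebesgue) \<longlonglongrightarrow> 0))"
    by (intro arg_cong[where f=Ex] ext conj_cong refl 1 2)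
  then show ?thesis unfolding D12_0_def by (simp only:) blast
qed

lemma D12_0_sq_integrable:
  assumes "D12_0 U u g"
  shows "sq_integrable lebesgue u" "sq_integrable lebesgue g"
  using assms unfolding D12_0_iff by (auto dest: L2_tendstoD)

lemma D12_0_measurable:
  assumes "D12_0 U u g"
  shows "u \<in> borel_measurable lebesgue" "g \<in> borel_measurable lebesgue"
  using D12_0_sq_integrable[OF assms] by (auto dest: sq_integrableD)

lemma D12_0_test: "f \<in> C0_inf U \<Longrightarrow> D12_0 U f (grad f)"
  unfolding D12_0_iff by (intro exI[of _ "\<lambda>_. f"]) (auto intro: L2_tendsto_const C0_inf_sq_integrable)

lemma D12_0_add:
  assumes "D12_0 U u g" "D12_0 U v h"
  shows "D12_0 U (\<lambda>x. u x + v x) (\<lambda>x. g x + h x)"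
proof -
  obtain F where F: "\<And>n::nat. F n \<in> C0_inf U" "L2_tendsto lebesgue F u" "L2_tendsto lebesgue (\<lambda>n. grad (F n)) g"
    using assms(1) unfolding D12_0_iff by blast
  obtain G where G: "\<And>n::nat. G n \<in> C0_inf U" "L2_tendsto lebesgue G v" "L2_tendsto lebesgue (\<lambda>n. grad (G n)) h"
    using assms(2) unfolding D12_0_iff by blast
  show ?thesis unfolding D12_0_iff
  proof (intro exI[of _ "\<lambda>n x. F n x + G n x"] conjI allI)
    show "(\<lambda>x. F n x + G n x) \<in> C0_inf U" for n using F G by (intro C0_inf_add)
    show "L2_tendsto lebesgue (\<lambda>n x. F n x + G n x) (\<lambda>x. u x + v x)" using F G by (intro L2_tendsto_add)
    have "grad (\<lambda>x. F n x + G n x) = (\<lambda>x. grad (F n) x + grad (G n) x)" for n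
      using F G by (intro ext grad_add C0_inf_smooth)
    then show "L2_tendsto lebesgue (\<lambda>n. grad (\<lambda>x. F n x + G n x)) (\<lambda>x. g x + h x)"
      using L2_tendsto_add[OF F(3) G(3)] by simp
  qed
qed

lemma D12_0_smooth_mult:
  assumes "D12_0 U u g" and r: "smooth r" "\<And>x. \<bar>r x\<bar> \<le> C" "\<And>x. norm (grad r x) \<le> C"
  shows "D12_0 U (\<lambda>x. r x * u x) (\<lambda>x. r x *\<^sub>R g x + u x *\<^sub>R grad r x)"
proof -
  obtain F where F: "\<And>n::nat. F n \<in> C0_inf U" "L2_tendsto lebesgue F u" "L2_tendsto lebesgue (\<lambda>n. grad (F n)) g"
    using assms(1) unfolding D12_0_iff by blast
  have rm: "r \<in> borel_measurable lebesgue" "grad r \<in> borel_measurable lebesgue"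
    using r by (auto intro: lebesgue_measurable_continuous smooth_continuous grad_continuous)
  show ?thesis unfolding D12_0_iff
  proof (intro exI[of _ "\<lambda>n x. r x * F n x"] conjI allI)
    show "(\<lambda>x. r x * F n x) \<in> C0_inf U" for n using F r by (intro C0_inf_mult)
    show "L2_tendsto lebesgue (\<lambda>n x. r x * F n x) (\<lambda>x. r x * u x)"
      using L2_tendsto_bounded_scaleR[OF F(2) rm(1) r(2)] by simp
    have 1: "L2_tendsto lebesgue (\<lambda>n x. F n x *\<^sub>R grad r x) (\<lambda>x. u x *\<^sub>R grad r x)"
    proof (rule L2_tendstoI_bound)
      note D = L2_tendstoD[OF F(2)]
      have C: "0 \<le> C" using r(2)[of 0] by linarith
      have gr: "(norm (grad r x))\<^sup>2 \<le> C\<^sup>2" for x using r(3) by (intro power_mono) auto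
      have sq: "sq_integrable lebesgue (\<lambda>x. v x *\<^sub>R grad r x)" if "sq_integrable lebesgue v" for v :: "'a \<Rightarrow> real"
      proof (rule sq_integrable_bound)
        show "integrable lebesgue (\<lambda>x. C\<^sup>2 * (norm (v x))\<^sup>2)" using that by (auto simp: sq_integrable_def)
        show "AE x in lebesgue. (norm (v x *\<^sub>R grad r x))\<^sup>2 \<le> C\<^sup>2 * (norm (v x))\<^sup>2"
          using gr by (auto simp: power_mult_distrib mult.commute[of "C\<^sup>2"] intro!: mult_left_mono)
      qed (use that rm in \<open>auto simp: sq_integrable_def\<close>)
      fix n
      show "sq_integrable lebesgue (\<lambda>x. F n x *\<^sub>R grad r x)" "sq_integrable lebesgue (\<lambda>x. u x *\<^sub>R grad r x)"
        by (intro sq D)+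
      have d: "sq_integrable lebesgue (\<lambda>x. F n x - u x)" by (intro sq_integrable_diff D)
      have "sqnorm lebesgue (\<lambda>x. F n x *\<^sub>R grad r x - u x *\<^sub>R grad r x)
        \<le> (\<integral>x. C\<^sup>2 * (norm (F n x - u x))\<^sup>2 \<partial>lebesgue)"
      proof (rule integral_mono)
        show "integrable lebesgue (\<lambda>x. (norm (F n x *\<^sub>R grad r x - u x *\<^sub>R grad r x))\<^sup>2)"
          using sq_integrableD(2)[OF sq[OF d]] by (simp add: scaleR_diff_left)
        show "(norm (F n x *\<^sub>R grad r x - u x *\<^sub>R grad r x))\<^sup>2 \<le> C\<^sup>2 * (norm (F n x - u x))\<^sup>2" for x
          using gr[of x] by (auto simp: power_mult_distrib scaleR_diff_left[symmetric] mult.commute intro!: mult_right_mono)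
      qed (use sq_integrableD(2)[OF d] in auto)
      then show "sqnorm lebesgue (\<lambda>x. F n x *\<^sub>R grad r x - u x *\<^sub>R grad r x) \<le> C\<^sup>2 * sqnorm lebesgue (\<lambda>x. F n x - u x)"
        by simp
      show "(\<lambda>n. C\<^sup>2 * sqnorm lebesgue (\<lambda>x. F n x - u x)) \<longlonglongrightarrow> 0"
        using tendsto_mult[OF tendsto_const[of "C\<^sup>2"] D(5)] by simp
    qed
    have "grad (\<lambda>x. r x * F n x) = (\<lambda>x. r x *\<^sub>R grad (F n) x + F n x *\<^sub>R grad r x)" for n
      by (intro ext grad_mult C0_inf_smooth[OF F(1)] r(1))
    then show "L2_tendsto lebesgue (\<lambda>n. grad (\<lambda>x. r x * F n x)) (\<lambda>x. r x *\<^sub>R g x + u x *\<^sub>R grad r x)"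
      using L2_tendsto_add[OF L2_tendsto_bounded_scaleR[OF F(3) rm(1) r(2)] 1] by simp
  qed
qed

lemma D12_0_cmult:
  assumes "D12_0 U u g"
  shows "D12_0 U (\<lambda>x. c * u x) (\<lambda>x. c *\<^sub>R g x)"
  using D12_0_smooth_mult[OF assms, of "\<lambda>_. c" "\<bar>c\<bar>"] by (simp add: grad_const)

lemma D12_0_closed:
  assumes "\<And>n::nat. D12_0 U (u n) (g n)" "L2_tendsto lebesgue u v" "L2_tendsto lebesgue g h"
  shows "D12_0 U v h"
proof -
  have "\<exists>f\<in>C0_inf U. sqnorm lebesgue (\<lambda>x. f x - u n x) \<le> 1 / Suc n \<and>
      sqnorm lebesgue (\<lambda>x. grad f x - g n x) \<le> 1 / Suc n" for n
  proof -
    obtain F where F: "\<And>n::nat. F n \<in> C0_inf U" "L2_tendsto lebesgue F (u n)" "L2_tendsto lebesgue (\<lambda>n. grad (F n)) (g n)"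
      using assms(1)[of n] unfolding D12_0_iff by blast
    have "\<forall>\<^sub>F k in sequentially. sqnorm lebesgue (\<lambda>x. F k x - u n x) < 1 / Suc n \<and>
      sqnorm lebesgue (\<lambda>x. grad (F k) x - g n x) < 1 / Suc n"
      by (intro eventually_conj order_tendstoD(2)[OF L2_tendstoD(5)[OF F(2)]] order_tendstoD(2)[OF L2_tendstoD(5)[OF F(3)]]) auto
    then obtain k where "sqnorm lebesgue (\<lambda>x. F k x - u n x) < 1 / Suc n \<and>
      sqnorm lebesgue (\<lambda>x. grad (F k) x - g n x) < 1 / Suc n" by (auto dest: eventually_happens)
    with F(1)[of k] show ?thesis by (intro bexI[of _ "F k"]) auto
  qed
  then have "\<forall>n. \<exists>f. f \<in> C0_inf U \<and> sqnorm lebesgue (\<lambda>x. f x - u n x) \<le> 1 / Suc n \<and>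
      sqnorm lebesgue (\<lambda>x. grad f x - g n x) \<le> 1 / Suc n"
    unfolding Bex_def by (rule allI)
  from choice[OF this] obtain f where "\<forall>n. f n \<in> C0_inf U \<and> sqnorm lebesgue (\<lambda>x. f n x - u n x) \<le> 1 / Suc n \<and>
      sqnorm lebesgue (\<lambda>x. grad (f n) x - g n x) \<le> 1 / Suc n" by (rule exE)
  then have f: "\<And>n. f n \<in> C0_inf U" "\<And>n. sqnorm lebesgue (\<lambda>x. f n x - u n x) \<le> 1 / Suc n"
      "\<And>n. sqnorm lebesgue (\<lambda>x. grad (f n) x - g n x) \<le> 1 / Suc n" by simp_all
  show ?thesis unfolding D12_0_iff
  proof (intro exI[of _ f] conjI allI)
    show "L2_tendsto lebesgue f v"
      by (rule L2_tendsto_perturb[OF C0_inf_sq_integrable(1)[OF f(1)] assms(2) f(2)])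
    show "L2_tendsto lebesgue (\<lambda>n. grad (f n)) h"
      by (rule L2_tendsto_perturb[OF C0_inf_sq_integrable(2)[OF f(1)] assms(3) f(3)])
  qed (rule f(1))
qed

lemma Lipschitz_of_deriv_bound:
  assumes "smooth (H :: real \<Rightarrow> real)" "\<And>t. \<bar>deriv H t\<bar> \<le> C"
  shows "\<bar>H a - H b\<bar> \<le> C * \<bar>a - b\<bar>"
  using field_differentiable_bound[of UNIV H "deriv H" C a b] assms smooth_DERIV[OF assms(1)] by simp

lemma smooth_compose_measurable:
  "smooth (H :: real \<Rightarrow> real) \<Longrightarrow> u \<in> borel_measurable M \<Longrightarrow> (\<lambda>x. H (u x)) \<in> borel_measurable M"
  by (rule borel_measurable_continuous_on[OF smooth_continuous])

text \<open>
  The gradients of \<open>H(f\<^sub>n)\<close> are \<open>H'(f\<^sub>n)\<nabla>f\<^sub>n\<close>. The second factor converges in \<open>L\<^sup>2\<close>, while the first one is bounded and converges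
  almost everywhere along a subsequence. The condition \<open>H(0) = 0\<close> keeps the support inside \<open>U\<close>.
\<close>

lemma D12_0_compose:
  assumes D: "D12_0 U u g" and H: "smooth (H :: real \<Rightarrow> real)" "H 0 = 0" "\<And>t. \<bar>deriv H t\<bar> \<le> C"
  shows "D12_0 U (\<lambda>x. H (u x)) (\<lambda>x. deriv H (u x) *\<^sub>R g x)"
proof -
  obtain F where F: "\<And>n::nat. F n \<in> C0_inf U" "L2_tendsto lebesgue F u" "L2_tendsto lebesgue (\<lambda>n. grad (F n)) g"
    using D unfolding D12_0_iff by blast
  obtain r where r: "strict_mono r" "AE x in lebesgue. (\<lambda>n. F (r n) x) \<longlonglongrightarrow> u x"
    using L2_tendsto_AE_subseq[OF F(2)] by metis
  define f where "f n = F (r n)" for n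
  have f: "\<And>n. f n \<in> C0_inf U" "L2_tendsto lebesgue f u" "L2_tendsto lebesgue (\<lambda>n. grad (f n)) g"
     "AE x in lebesgue. (\<lambda>n. f n x) \<longlonglongrightarrow> u x"
    using F L2_tendsto_subseq[OF F(2) r(1)] L2_tendsto_subseq[OF F(3) r(1)] r(2)
    by (auto simp: f_def[abs_def])
  have um: "u \<in> borel_measurable lebesgue" by (rule D12_0_measurable[OF D])
  have fm: "f n \<in> borel_measurable lebesgue" for n using L2_tendstoD(3)[OF f(2)] .
  note lip = Lipschitz_of_deriv_bound[OF H(1,3)]
  have sqle: "(norm (H a - H b))\<^sup>2 \<le> C\<^sup>2 * (norm (a - b))\<^sup>2" for a b
    using power_mono[OF lip[of a b], of 2] by (simp add: power_mult_distrib)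
  have Hu: "sq_integrable lebesgue (\<lambda>x. H (u x))"
    by (rule sq_integrable_bound[where h="\<lambda>x. C\<^sup>2 * (norm (u x))\<^sup>2"])
      (use sqle[of _ 0] H(2) smooth_compose_measurable[OF H(1) um] D12_0_sq_integrable(1)[OF D] in \<open>auto simp: sq_integrable_def\<close>)
  have Hf: "(\<lambda>x. H (f n x)) \<in> C0_inf U" for n by (rule C0_inf_compose[OF H(1,2) f(1)])
  show ?thesis unfolding D12_0_iff
  proof (intro exI[of _ "\<lambda>n x. H (f n x)"] conjI allI)
    show "(\<lambda>x. H (f n x)) \<in> C0_inf U" for n by (rule Hf)
    show "L2_tendsto lebesgue (\<lambda>n x. H (f n x)) (\<lambda>x. H (u x))"
    proof (rule L2_tendstoI_bound[OF C0_inf_sq_integrable(1)[OF Hf] Hu])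
      fix n
      have d: "integrable lebesgue (\<lambda>x. (norm (f n x - u x))\<^sup>2)"
        by (intro sq_integrableD(2) sq_integrable_diff L2_tendstoD[OF f(2)])
      have "sqnorm lebesgue (\<lambda>x. H (f n x) - H (u x)) \<le> (\<integral>x. C\<^sup>2 * (norm (f n x - u x))\<^sup>2 \<partial>lebesgue)"
        by (rule integral_mono[OF sq_integrableD(2)[OF sq_integrable_diff[OF C0_inf_sq_integrable(1)[OF Hf] Hu]]])
          (use d sqle in auto)
      then show "sqnorm lebesgue (\<lambda>x. H (f n x) - H (u x)) \<le> C\<^sup>2 * sqnorm lebesgue (\<lambda>x. f n x - u x)"
        by simp
      show "(\<lambda>n. C\<^sup>2 * sqnorm lebesgue (\<lambda>x. f n x - u x)) \<longlonglongrightarrow> 0"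
        using tendsto_mult[OF tendsto_const[of "C\<^sup>2"] L2_tendstoD(5)[OF f(2)]] by simp
    qed
    have "L2_tendsto lebesgue (\<lambda>n x. deriv H (f n x) *\<^sub>R grad (f n) x) (\<lambda>x. deriv H (u x) *\<^sub>R g x)"
    proof (rule L2_tendsto_scaleR_AE[OF f(3) _ _ H(3)])
      show "(\<lambda>x. deriv H (f n x)) \<in> borel_measurable lebesgue" "(\<lambda>x. deriv H (u x)) \<in> borel_measurable lebesgue" for n
        by (rule smooth_compose_measurable[OF smooth_deriv[OF H(1)]], rule fm um)+
      show "AE x in lebesgue. (\<lambda>n. deriv H (f n x)) \<longlonglongrightarrow> deriv H (u x)"
        using f(4) by eventually_elim
          (rule continuous_on_tendsto_compose[OF smooth_continuous[OF smooth_deriv[OF H(1)]]], auto)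
    qed
    moreover have "grad (\<lambda>x. H (f n x)) = (\<lambda>x. deriv H (f n x) *\<^sub>R grad (f n) x)" for n
      by (intro ext grad_compose H C0_inf_smooth[OF f(1)])
    ultimately show "L2_tendsto lebesgue (\<lambda>n. grad (\<lambda>x. H (f n x))) (\<lambda>x. deriv H (u x) *\<^sub>R g x)"
      by simp
  qed
qed

text \<open>
  A smooth approximation of the positive part. It vanishes for \<open>t \<le> 0\<close>, so that in the limit the gradient
  vanishes on the set where the function is 0.
\<close>

definition smooth_pos_part :: "nat \<Rightarrow> real \<Rightarrow> real" where
  "smooth_pos_part k t = t * smooth_step (real (Suc k) * t)"

lemma smooth_smooth_pos_part: "smooth (smooth_pos_part k)"
  unfolding smooth_pos_part_def[abs_def]
  by (intro smooth_mult smooth_id smooth_compose[OF smooth_smooth_step] smooth_const)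

lemma deriv_smooth_pos_part:
  "deriv (smooth_pos_part k) t = smooth_step (real (Suc k) * t) + real (Suc k) * t * deriv smooth_step (real (Suc k) * t)"
proof (rule DERIV_imp_deriv)
  have "((\<lambda>t. smooth_step (real (Suc k) * t)) has_field_derivative deriv smooth_step (real (Suc k) * t) * real (Suc k)) (at t)"
    by (rule DERIV_chain2[OF smooth_DERIV[OF smooth_smooth_step]]) (auto intro!: derivative_eq_intros)
  then have "((\<lambda>t. t * smooth_step (real (Suc k) * t)) has_field_derivative
      t * (deriv smooth_step (real (Suc k) * t) * real (Suc k)) + 1 * smooth_step (real (Suc k) * t)) (at t)"
    by (rule DERIV_mult'[OF DERIV_ident])
  then show "(smooth_pos_part k has_field_derivative
      smooth_step (real (Suc k) * t) + real (Suc k) * t * deriv smooth_step (real (Suc k) * t)) (at t)"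
    by (simp add: smooth_pos_part_def[abs_def] algebra_simps)
qed

lemma smooth_pos_part_eventually:
  "\<forall>\<^sub>F k in sequentially. smooth_pos_part k t = max 0 t \<and> deriv (smooth_pos_part k) t = (if t > 0 then 1 else 0)"
proof (cases "t > 0")
  case True
  obtain k0 :: nat where k0: "1 < k0 * t" using reals_Archimedean3[OF True] by blast
  have "\<forall>\<^sub>F k in sequentially. k0 \<le> k" by (rule eventually_ge_at_top)
  then show ?thesis
  proof eventually_elim
    case (elim k)
    have "k0 * t \<le> real (Suc k) * t" using elim True by (intro mult_right_mono) auto
    with k0 have "1 < real (Suc k) * t" by linarith
    then show ?case using True smooth_step_ge_1[of "real (Suc k) * t"] deriv_smooth_step_0[of "real (Suc k) * t"]
      unfolding deriv_smooth_pos_part smooth_pos_part_def by simp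
  qed
next
  case False
  have "smooth_step (real (Suc k) * t) = 0" for k
    using False by (intro smooth_step_le_0) (auto simp: mult_nonneg_nonpos)
  moreover have "real (Suc k) * t * deriv smooth_step (real (Suc k) * t) = 0" for k
    using False deriv_smooth_step_0[of "real (Suc k) * t"] by (cases "t = 0") (auto simp: mult_pos_neg)
  ultimately show ?thesis using False unfolding deriv_smooth_pos_part smooth_pos_part_def by simp
qed

lemma D12_0_pos_part:
  assumes D: "D12_0 U u g"
  shows "D12_0 U (\<lambda>x. max 0 (u x)) (\<lambda>x. if u x > 0 then g x else 0)"
proof -
  obtain C where C: "C \<ge> 0" "\<And>t. \<bar>deriv smooth_step t\<bar> \<le> C" using deriv_smooth_step_bounded by metis
  have b: "\<bar>deriv (smooth_pos_part k) t\<bar> \<le> 1 + C" for k t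
  proof -
    \<comment> \<open>The factor \<open>s smooth_step'(s)\<close> is bounded, as the derivative of the step lives on \<open>[0, 1]\<close>.\<close>
    let ?s = "real (Suc k) * t"
    have "\<bar>?s * deriv smooth_step ?s\<bar> \<le> C"
    proof (cases "0 \<le> ?s \<and> ?s \<le> 1")
      case True
      then have "\<bar>?s\<bar> * \<bar>deriv smooth_step ?s\<bar> \<le> 1 * C" by (intro mult_mono C) auto
      then show ?thesis by (simp only: abs_mult)
    next
      case False
      then show ?thesis using deriv_smooth_step_0[of ?s] C(1) by force
    qed
    then show ?thesis using smooth_step_bounds[of ?s] unfolding deriv_smooth_pos_part by linarith
  qed
  note m = D12_0_measurable[OF D] and sq = D12_0_sq_integrable[OF D]
  show ?thesis
  proof (rule D12_0_closed)
    show "D12_0 U (\<lambda>x. smooth_pos_part n (u x)) (\<lambda>x. deriv (smooth_pos_part n) (u x) *\<^sub>R g x)" for n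
      by (rule D12_0_compose[OF D smooth_smooth_pos_part _ b]) (simp add: smooth_pos_part_def)
    show "L2_tendsto lebesgue (\<lambda>n x. smooth_pos_part n (u x)) (\<lambda>x. max 0 (u x))"
    proof (rule L2_tendsto_dominated[OF _ _ _ _ sq(1)])
      show "AE x in lebesgue. (\<lambda>n. smooth_pos_part n (u x)) \<longlonglongrightarrow> max 0 (u x)"
        by (intro AE_I2 tendsto_eventually) (auto intro: eventually_mono[OF smooth_pos_part_eventually])
      have "\<bar>smooth_pos_part n t\<bar> \<le> \<bar>t\<bar>" for n t
        using mult_left_le[of "smooth_step (real (Suc n) * t)" "\<bar>t\<bar>"] smooth_step_bounds[of "real (Suc n) * t"]
        unfolding smooth_pos_part_def abs_mult by (simp only: abs_of_nonneg abs_ge_zero)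
      then show "AE x in lebesgue. norm (smooth_pos_part n (u x)) \<le> norm (u x)" for n by auto
    qed (use m smooth_compose_measurable[OF smooth_smooth_pos_part] in auto)
    have "L2_tendsto lebesgue (\<lambda>n x. deriv (smooth_pos_part n) (u x) *\<^sub>R g x) (\<lambda>x. (if u x > 0 then 1 else 0) *\<^sub>R g x)"
    proof (rule L2_tendsto_scaleR_AE[OF L2_tendsto_const[OF sq(2)] _ _ b])
      show "AE x in lebesgue. (\<lambda>n. deriv (smooth_pos_part n) (u x)) \<longlonglongrightarrow> (if 0 < u x then 1 else 0)"
        by (intro AE_I2 tendsto_eventually) (rule eventually_mono[OF smooth_pos_part_eventually], blast)
    qed (use m smooth_compose_measurable[OF smooth_deriv[OF smooth_smooth_pos_part]] in auto)
    then show "L2_tendsto lebesgue (\<lambda>n x. deriv (smooth_pos_part n) (u x) *\<^sub>R g x) (\<lambda>x. if u x > 0 then g x else 0)"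
      by (simp add: if_distrib[of "\<lambda>c. c *\<^sub>R _"] cong: if_cong)
  qed
qed

lemma D12_0_vanishes_outside:
  assumes "D12_0 U u g"
  shows "AE x in lebesgue. x \<notin> U \<longrightarrow> u x = 0 \<and> g x = 0"
proof -
  obtain F where F: "\<And>n::nat. F n \<in> C0_inf U" "L2_tendsto lebesgue F u" "L2_tendsto lebesgue (\<lambda>n. grad (F n)) g"
    using assms unfolding D12_0_iff by blast
  obtain r where r: "AE x in lebesgue. (\<lambda>n. F (r n) x) \<longlonglongrightarrow> u x"
    using L2_tendsto_AE_subseq[OF F(2)] by metis
  obtain s where s: "AE x in lebesgue. (\<lambda>n. grad (F (s n)) x) \<longlonglongrightarrow> g x"
    using L2_tendsto_AE_subseq[OF F(3)] by metis
  have z: "F n x = 0" "grad (F n) x = 0" if "x \<notin> U" for n x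
    using C0_inf_support[OF F(1)[of n]] that by (metis subsetD)+
  from r s show ?thesis
  proof eventually_elim
    case (elim x)
    show ?case using elim by (auto simp: z LIMSEQ_const_iff)
  qed
qed

section \<open>Integration by parts\<close>

lemma integral_lborel_translate:
  fixes f :: "'a::euclidean_space \<Rightarrow> 'b::euclidean_space"
  assumes "f \<in> borel_measurable borel"
  shows "(\<integral>x. f (c + x) \<partial>lborel) = (\<integral>x. f x \<partial>lborel)"
proof -
  have "(\<integral>x. f x \<partial>distr lborel borel ((+) c)) = (\<integral>x. f (c + x) \<partial>lborel)"
    by (rule integral_distr) (use assms in auto)
  then show ?thesis by (simp add: lborel_distr_plus)
qed

lemma C0_inf_Lipschitz:
  assumes "f \<in> C0_inf U" "\<And>x. norm (grad f x) \<le> C" 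
  shows "\<bar>f x - f y\<bar> \<le> C * norm (x - y)"
proof -
  have "norm (f x - f y) \<le> C * norm (x - y)"
  proof (rule differentiable_bound[of UNIV f "\<lambda>x v. grad f x \<bullet> v"])
    show "(f has_derivative (\<lambda>v. grad f x \<bullet> v)) (at x within UNIV)" for x
      using smooth_has_derivative_grad[OF C0_inf_smooth[OF assms(1)]] by simp
    show "onorm (\<lambda>v. grad f x \<bullet> v) \<le> C" for x
    proof (rule onorm_bound)
      show "0 \<le> C" using assms(2)[of x] norm_ge_zero order_trans by blast
      show "norm (grad f x \<bullet> v) \<le> C * norm v" for v
        using Cauchy_Schwarz_ineq2[of "grad f x" v] mult_right_mono[OF assms(2)[of x] norm_ge_zero[of v]]
        by simp
    qed
  qed auto
  then show ?thesis by simp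
qed

text \<open>
  The integral of a derivative vanishes because it is the limit of the integrals of difference
  quotients, and those vanish by translation invariance of the Lebesgue measure.
\<close>

lemma integral_grad_C0_inf:
  assumes f: "f \<in> C0_inf U"
  shows "(\<integral>x. grad f x \<bullet> b \<partial>lebesgue) = 0"
proof -
  have s: "smooth f" by (rule C0_inf_smooth[OF f])
  obtain K where K: "compact K" "\<And>x. x \<notin> K \<Longrightarrow> f x = 0" using C0_inf_support[OF f] by metis
  obtain C where C: "0 \<le> C" "\<And>x. norm (grad f x) \<le> C" using C0_inf_bounded[OF f] by metis
  define L where "L = {x + y |x y. x \<in> K \<and> y \<in> cball 0 (norm b)}"
  have L: "compact L" unfolding L_def using K(1) by (intro compact_sums compact_cball)
  define d where "d n x = real (Suc n) * (f ((1 / real (Suc n)) *\<^sub>R b + x) - f x)" for n x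
  have fb: "f \<in> borel_measurable borel" by (rule borel_measurable_continuous_onI[OF smooth_continuous[OF s]])
  have dc: "continuous_on UNIV (d n)" for n
    unfolding d_def by (intro continuous_intros continuous_on_compose2[OF smooth_continuous[OF s]]) auto
  have d0: "(\<integral>x. d n x \<partial>lborel) = 0" for n
  proof -
    have fi: "integrable lborel f"
      using integrable_continuous_compact_support[OF smooth_continuous[OF s] K(1)] K(2) fb integrable_completion[of f lborel]
      by auto
    have ti: "integrable lborel (\<lambda>x. f (c + x))" for c
    proof -
      have "integrable (distr lborel borel ((+) c)) f" by (simp add: lborel_distr_plus fi)
      then show ?thesis by (subst (asm) integrable_distr_eq) (auto intro: fb)
    qed
    show ?thesis unfolding d_def by (simp add: fi ti integral_lborel_translate[OF fb])
  qed
  have "(\<lambda>n. \<integral>x. d n x \<partial>lborel) \<longlonglongrightarrow> (\<integral>x. grad f x \<bullet> b \<partial>lborel)"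
  proof (rule integral_dominated_convergence[where w="\<lambda>x. indicator L x *\<^sub>R (C * norm b)"])
    show "(\<lambda>x. grad f x \<bullet> b) \<in> borel_measurable lborel"
      using borel_measurable_continuous_onI[OF grad_continuous[OF s]] by simp
    show "d n \<in> borel_measurable lborel" for n using borel_measurable_continuous_onI[OF dc] by simp
    show "integrable lborel (\<lambda>x. indicator L x *\<^sub>R (C * norm b))"
      by (rule borel_integrable_compact[OF L]) simp
    show "AE x in lborel. (\<lambda>n. d n x) \<longlonglongrightarrow> grad f x \<bullet> b"
    proof (rule AE_I2)
      fix x
      have "((\<lambda>t. f (x + t *\<^sub>R b)) has_derivative (\<lambda>t. grad f (x + 0 *\<^sub>R b) \<bullet> (t *\<^sub>R b))) (at 0)"
        by (rule has_derivative_compose[of "\<lambda>t. x + t *\<^sub>R b" "\<lambda>t. t *\<^sub>R b" 0 UNIV f, simplified])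
           (auto intro!: derivative_eq_intros smooth_has_derivative_grad[OF s, of x])
      moreover have "(\<lambda>t. grad f (x + 0 *\<^sub>R b) \<bullet> (t *\<^sub>R b)) = (*) (grad f x \<bullet> b)"
        by (rule ext) simp
      ultimately have "((\<lambda>t. f (x + t *\<^sub>R b)) has_field_derivative (grad f x \<bullet> b)) (at 0)"
        by (simp only: has_field_derivative_def)
      then have "((\<lambda>t. (f (x + t *\<^sub>R b) - f x) / t) \<longlongrightarrow> grad f x \<bullet> b) (at 0)"
        by (simp add: has_field_derivative_iff)
      moreover have "filterlim (\<lambda>n. inverse (real (Suc n))) (at 0) sequentially"
        unfolding filterlim_at using LIMSEQ_inverse_real_of_nat by auto
      ultimately have "(\<lambda>n. (f (x + inverse (real (Suc n)) *\<^sub>R b) - f x) / inverse (real (Suc n))) \<longlonglongrightarrow> grad f x \<bullet> b"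
        by (rule filterlim_compose)
      then show "(\<lambda>n. d n x) \<longlonglongrightarrow> grad f x \<bullet> b"
        by (simp add: d_def divide_inverse mult.commute add.commute)
    qed
    show "AE x in lborel. norm (d n x) \<le> indicator L x *\<^sub>R (C * norm b)" for n
    proof (rule AE_I2)
      fix x
      let ?v = "(1 / real (Suc n)) *\<^sub>R b"
      show "norm (d n x) \<le> indicator L x *\<^sub>R (C * norm b)"
      proof (cases "x \<in> L")
        case True
        have "\<bar>d n x\<bar> = real (Suc n) * \<bar>f (?v + x) - f x\<bar>"
          unfolding d_def abs_mult by (simp only: abs_of_nat)
        also have "\<dots> \<le> real (Suc n) * (C * norm (?v + x - x))"
          by (intro mult_left_mono C0_inf_Lipschitz[OF f C(2)]) simp
        also have "\<dots> = C * norm b" by simp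
        finally show ?thesis using True by simp
      next
        case False
        have n1: "norm ?v \<le> norm b" by (simp add: field_simps mult_le_cancel_left1)
        have "x \<notin> K" using False unfolding L_def by (auto dest: spec[of _ x] spec[of _ 0])
        moreover have "?v + x \<notin> K"
        proof
          assume "?v + x \<in> K"
          moreover have "x = (?v + x) + (- ?v)" "- ?v \<in> cball 0 (norm b)" using n1 by auto
          ultimately have "x \<in> L" unfolding L_def by blast
          with False show False by simp
        qed
        ultimately show ?thesis using False by (simp add: d_def K(2))
      qed
    qed
  qed
  then have "(\<integral>x. grad f x \<bullet> b \<partial>lborel) = 0" unfolding d0 by (simp add: LIMSEQ_const_iff)
  then show ?thesis
    using borel_measurable_continuous_onI[OF grad_continuous[OF s]] by (subst integral_completion) auto
qed

lemma C0_inf_integration_by_parts: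
  assumes f: "f \<in> C0_inf U" and p: "\<psi> \<in> C0_inf V"
  shows "(\<integral>x. f x * (grad \<psi> x \<bullet> b) \<partial>lebesgue) + (\<integral>x. grad f x \<bullet> (\<psi> x *\<^sub>R b) \<partial>lebesgue) = 0"
proof -
  have sf: "smooth f" and sp: "smooth \<psi>" using f p by (auto intro: C0_inf_smooth)
  have pb: "sq_integrable lebesgue (\<lambda>x. grad \<psi> x \<bullet> b)"
  proof -
    obtain K where K: "compact K" "\<And>x. x \<notin> K \<Longrightarrow> grad \<psi> x = 0" using C0_inf_support[OF p] by metis
    show ?thesis
      by (rule sq_integrable_continuous_compact_support[OF _ K(1)])
        (auto intro!: continuous_intros grad_continuous sp simp: K(2))
  qed
  have pb2: "sq_integrable lebesgue (\<lambda>x. \<psi> x *\<^sub>R b)"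
  proof -
    obtain K where K: "compact K" "\<And>x. x \<notin> K \<Longrightarrow> \<psi> x = 0" using C0_inf_support[OF p] by metis
    show ?thesis
      by (rule sq_integrable_continuous_compact_support[OF _ K(1)])
        (auto intro!: continuous_intros smooth_continuous sp simp: K(2))
  qed
  have i: "integrable lebesgue (\<lambda>x. f x * (grad \<psi> x \<bullet> b))"
    using integrable_inner[OF C0_inf_sq_integrable(1)[OF f] pb] by simp
  have j: "integrable lebesgue (\<lambda>x. grad f x \<bullet> (\<psi> x *\<^sub>R b))"
    by (rule integrable_inner[OF C0_inf_sq_integrable(2)[OF f] pb2])
  have "(\<lambda>x. f x * \<psi> x) \<in> C0_inf V" by (rule C0_inf_mult[OF sf p])
  from integral_grad_C0_inf[OF this, of b]
  have "(\<integral>x. f x * (grad \<psi> x \<bullet> b) + grad f x \<bullet> (\<psi> x *\<^sub>R b) \<partial>lebesgue) = 0"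
    by (simp add: grad_mult sf sp inner_add_left)
  then show ?thesis using Bochner_Integration.integral_add[OF i j] by simp
qed

lemma D12_0_integration_by_parts:
  assumes D: "D12_0 U u g" and p: "\<psi> \<in> C0_inf V"
  shows "(\<integral>x. u x * (grad \<psi> x \<bullet> b) \<partial>lebesgue) + (\<integral>x. g x \<bullet> (\<psi> x *\<^sub>R b) \<partial>lebesgue) = 0"
proof -
  obtain F where F: "\<And>n::nat. F n \<in> C0_inf U" "L2_tendsto lebesgue F u" "L2_tendsto lebesgue (\<lambda>n. grad (F n)) g"
    using D unfolding D12_0_iff by blast
  have sp: "smooth \<psi>" using p by (rule C0_inf_smooth)
  obtain K where K: "compact K" "\<And>x. x \<notin> K \<Longrightarrow> \<psi> x = 0" "\<And>x. x \<notin> K \<Longrightarrow> grad \<psi> x = 0" using C0_inf_support[OF p] by metis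
  have "sq_integrable lebesgue (\<lambda>x. grad \<psi> x \<bullet> b)"
    by (rule sq_integrable_continuous_compact_support[OF _ K(1)])
      (auto intro!: continuous_intros grad_continuous sp simp: K(3))
  from L2_tendsto_inner_left[OF F(2) this]
  have 1: "(\<lambda>n. \<integral>x. F n x * (grad \<psi> x \<bullet> b) \<partial>lebesgue) \<longlonglongrightarrow> (\<integral>x. u x * (grad \<psi> x \<bullet> b) \<partial>lebesgue)" by simp
  have "sq_integrable lebesgue (\<lambda>x. \<psi> x *\<^sub>R b)"
    by (rule sq_integrable_continuous_compact_support[OF _ K(1)])
      (auto intro!: continuous_intros smooth_continuous sp simp: K(2))
  from tendsto_add[OF 1 L2_tendsto_inner_left[OF F(3) this]]
  show ?thesis unfolding C0_inf_integration_by_parts[OF F(1) p] by (simp add: LIMSEQ_const_iff)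
qed

section \<open>The fundamental lemma of the calculus of variations\<close>

definition box_bump :: "'a::euclidean_space \<Rightarrow> 'a \<Rightarrow> nat \<Rightarrow> 'a \<Rightarrow> real" where
  "box_bump a b k x = (\<Prod>i\<in>Basis. smooth_step (real k * (x \<bullet> i - a \<bullet> i)) * smooth_step (real k * (b \<bullet> i - x \<bullet> i)))"

lemma smooth_box_bump: "smooth (box_bump a b k)"
  unfolding box_bump_def[abs_def]
  by (intro smooth_prod smooth_mult smooth_compose[OF smooth_smooth_step] smooth_const smooth_diff smooth_inner_const)

lemma box_bump_outside: "x \<notin> box a b \<Longrightarrow> box_bump a b k x = 0"
proof -
  assume "x \<notin> box a b"
  then obtain i where i: "i \<in> Basis" "x \<bullet> i \<le> a \<bullet> i \<or> b \<bullet> i \<le> x \<bullet> i"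
    by (auto simp: mem_box not_less)
  then have "smooth_step (real k * (x \<bullet> i - a \<bullet> i)) * smooth_step (real k * (b \<bullet> i - x \<bullet> i)) = 0"
    by (auto intro!: smooth_step_le_0 mult_nonneg_nonpos)
  then show ?thesis unfolding box_bump_def using i(1) by (intro prod_zero) auto
qed

lemma box_bump_bounds: "0 \<le> box_bump a b k x" "box_bump a b k x \<le> 1"
  unfolding box_bump_def using smooth_step_bounds
  by (auto intro!: prod_nonneg prod_le_1 mult_le_one)

text \<open>
  The factors are 0 up to the faces and 1 at distance \<open>1/k\<close> from them, so the limit is the indicator of
  the open box.
\<close>

lemma box_bump_tendsto: "(\<lambda>k. box_bump a b k x) \<longlonglongrightarrow> indicator (box a b) x"
proof (cases "x \<in> box a b")
  case True
  have 1: "(\<lambda>k. smooth_step (real k * t)) \<longlonglongrightarrow> 1" if t: "0 < t" for t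
  proof (rule tendsto_eventually)
    obtain m :: nat where m: "1 < m * t" using reals_Archimedean3[OF t] by blast
    have "\<forall>\<^sub>F k in sequentially. m \<le> k" by (rule eventually_ge_at_top)
    then show "\<forall>\<^sub>F k in sequentially. smooth_step (real k * t) = 1"
    proof eventually_elim
      case (elim k)
      have "m * t \<le> real k * t" using elim t by (intro mult_right_mono) auto
      with m show ?case by (intro smooth_step_ge_1) linarith
    qed
  qed
  have "(\<lambda>k. box_bump a b k x) \<longlonglongrightarrow> (\<Prod>i\<in>(Basis::'a set). 1 * 1)"
    unfolding box_bump_def using True by (intro tendsto_prod tendsto_mult 1) (auto simp: mem_box)
  then show ?thesis using True by simp
next
  case False
  then show ?thesis by (simp add: box_bump_outside)
qed

lemma integral_box_eq_0_of_test:
  fixes h :: "'a::euclidean_space \<Rightarrow> real"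
  assumes i: "set_integrable lebesgue (cbox a b) h" and sub: "cbox a b \<subseteq> \<Omega>"
    and test: "\<And>\<psi>. \<psi> \<in> C0_inf \<Omega> \<Longrightarrow> (\<integral>x. \<psi> x * h x \<partial>lebesgue) = 0"
  shows "(\<integral>x. indicator (box a b) x * h x \<partial>lebesgue) = 0"
proof -
  define hh where "hh x = indicator (cbox a b) x * h x" for x
  have hi: "integrable lebesgue hh" using i by (simp add: set_integrable_def hh_def[abs_def])
  have bm: "box_bump a b k \<in> borel_measurable lebesgue" for k
    by (rule lebesgue_measurable_continuous[OF smooth_continuous[OF smooth_box_bump]])
  have eq: "box_bump a b k x * h x = box_bump a b k x * hh x" for k x
    using box_bump_outside[of x a b k] box_subset_cbox[of a b] by (auto simp: hh_def indicator_def)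
  have eq2: "indicator (box a b) x * h x = indicator (box a b) x * hh x" for x
    using box_subset_cbox[of a b] by (auto simp: hh_def indicator_def)
  have "(\<lambda>k. \<integral>x. box_bump a b k x * hh x \<partial>lebesgue) \<longlonglongrightarrow> (\<integral>x. indicator (box a b) x * hh x \<partial>lebesgue)"
  proof (rule integral_dominated_convergence[where w="\<lambda>x. \<bar>hh x\<bar>"])
    show "AE x in lebesgue. (\<lambda>k. box_bump a b k x * hh x) \<longlonglongrightarrow> indicator (box a b) x * hh x"
      by (intro AE_I2 tendsto_mult box_bump_tendsto tendsto_const)
    show "AE x in lebesgue. norm (box_bump a b k x * hh x) \<le> \<bar>hh x\<bar>" for k
      using box_bump_bounds[of a b k] by (auto simp: abs_mult intro!: mult_left_le_one_le)
    have [measurable]: "hh \<in> borel_measurable lebesgue" using hi by auto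
    show "(\<lambda>x. box_bump a b k x * hh x) \<in> borel_measurable lebesgue" for k using bm[of k] by measurable
    have [measurable]: "box a b \<in> sets lebesgue" by simp
    show "(\<lambda>x. indicator (box a b) x * hh x) \<in> borel_measurable lebesgue" by measurable
  qed (use hi in auto)
  moreover have "(\<integral>x. box_bump a b k x * hh x \<partial>lebesgue) = 0" for k
  proof -
    have "box_bump a b k \<in> C0_inf \<Omega>"
      by (rule C0_infI[OF smooth_box_bump compact_cbox sub]) (use box_subset_cbox[of a b] in \<open>auto intro: box_bump_outside\<close>)
    from test[OF this] show ?thesis by (simp add: eq)
  qed
  ultimately show ?thesis unfolding eq2 by (simp add: LIMSEQ_const_iff)
qed

text \<open>
  The Borel sets over which the integral vanishes form a Dynkin system that contains the boxes, hence they are all Borel sets;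
  in particular the sets where \<open>f\<close> is positive and where it is negative are among them.
\<close>

lemma AE_eq_0_of_integral_boxes:
  fixes f :: "'a::euclidean_space \<Rightarrow> real"
  assumes f: "integrable lborel f" and all: "(\<integral>x. f x \<partial>lborel) = 0"
    and box: "\<And>a b. (\<integral>x. indicator (box a b) x * f x \<partial>lborel) = 0"
  shows "AE x in lborel. f x = 0"
proof -
  have set: "(LINT x:A|lborel. f x) = 0" if "A \<in> sets borel" for A
  proof -
    have fi: "set_integrable lborel B f" if "B \<in> sets borel" for B
      unfolding set_integrable_def using that by (intro integrable_mult_indicator f) auto
    have "Int_stable (range (\<lambda>(a, b). box a b :: 'a set))"
      by (auto simp: Int_stable_def box_Int_box)
    moreover have "range (\<lambda>(a, b). box a b :: 'a set) \<subseteq> Pow UNIV" by auto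
    moreover have "A \<in> sigma_sets UNIV (range (\<lambda>(a, b). box a b :: 'a set))"
      using that unfolding borel_eq_box by simp
    ultimately show ?thesis
    proof (induction rule: sigma_sets_induct_disjoint)
      case (basic A)
      then show ?case using box by (auto simp: set_lebesgue_integral_def)
    next
      case empty
      then show ?case by (simp add: set_lebesgue_integral_def)
    next
      case (compl A)
      then have [measurable]: "A \<in> sets borel" by (simp add: borel_eq_box)
      have "(LINT x:UNIV - A|lborel. f x) = (\<integral>x. f x - indicator A x *\<^sub>R f x \<partial>lborel)"
        unfolding set_lebesgue_integral_def
        by (intro Bochner_Integration.integral_cong) (auto simp: indicator_def)
      also have "\<dots> = (\<integral>x. f x \<partial>lborel) - (LINT x:A|lborel. f x)"
        unfolding set_lebesgue_integral_def
        using fi[of A] by (intro Bochner_Integration.integral_diff f) (auto simp: set_integrable_def)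
      finally show ?case using compl all by simp
    next
      case (union F)
      then have [measurable]: "F i \<in> sets borel" for i by (auto simp: borel_eq_box)
      have "(LINT x:(\<Union>i. F i)|lborel. f x) = (\<Sum>i. LINT x:F i|lborel. f x)"
        by (rule lebesgue_integral_countable_add)
          (use union fi[of "\<Union>i. F i"] in \<open>auto simp: disjoint_family_on_def\<close>)
      then show ?case using union by simp
    qed
  qed
  have [measurable]: "f \<in> borel_measurable borel" using f by auto
  have zero: "AE x in lborel. \<not> 0 < s * f x" for s :: real
  proof -
    define A where "A = {x. 0 < s * f x}"
    have [measurable]: "A \<in> sets borel" unfolding A_def by measurable
    have "(\<integral>x. indicator A x *\<^sub>R f x \<partial>lborel) = 0" using set[of A] by (simp add: set_lebesgue_integral_def)
    then have "(\<integral>x. s * (indicator A x *\<^sub>R f x) \<partial>lborel) = 0" by simp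
    moreover have "integrable lborel (\<lambda>x. s * (indicator A x *\<^sub>R f x))"
      by (intro integrable_mult_right integrable_mult_indicator f) auto
    ultimately have "AE x in lborel. s * (indicator A x *\<^sub>R f x) = 0"
      by (subst integral_nonneg_eq_0_iff_AE[symmetric]) (auto simp: A_def indicator_def)
    then show ?thesis by eventually_elim (auto simp: A_def indicator_def)
  qed
  from zero[of 1] zero[of "-1"] show ?thesis by eventually_elim auto
qed

text \<open>
  Smooth bumps reduce the statement to integrals over boxes. As boxes generate the Borel sets only, \<open>h\<close> has to
  be replaced by a Borel function on each compact box of a countable covering of \<open>\<Omega>\<close>.
\<close>

lemma fundamental_lemma:
  fixes h :: "'a::euclidean_space \<Rightarrow> real"
  assumes op: "open \<Omega>" and loc: "\<And>K. compact K \<Longrightarrow> K \<subseteq> \<Omega> \<Longrightarrow> set_integrable lebesgue K h"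
    and test: "\<And>\<psi>. \<psi> \<in> C0_inf \<Omega> \<Longrightarrow> (\<integral>x. \<psi> x * h x \<partial>lebesgue) = 0"
  shows "AE x in lebesgue. x \<in> \<Omega> \<longrightarrow> h x = 0"
proof -
  have box: "AE x in lebesgue. x \<in> cbox c d \<longrightarrow> h x = 0" if sub: "cbox c d \<subseteq> \<Omega>" for c d
  proof -
    define f where "f x = indicator (box c d) x * h x" for x
    have "set_integrable lebesgue (box c d) h"
      by (rule set_integrable_subset[OF loc[OF compact_cbox sub]]) (auto intro: box_subset_cbox[THEN subsetD])
    then have fi: "integrable lebesgue f" by (simp add: set_integrable_def f_def[abs_def])
    then obtain f' where f': "f' \<in> borel_measurable lborel" "AE x in lborel. f x = f' x"
      using completion_ex_borel_measurable_real[of f lborel] by auto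
    have f'b [measurable]: "f' \<in> borel_measurable borel" using f'(1) by simp
    have f'i: "integrable lebesgue f'"
      by (rule integrable_cong_AE_imp[OF fi]) (rule measurable_completion[OF f'(1)], rule AE_completion[OF f'(2)])
    have eqi: "(\<integral>x. r x * f' x \<partial>lborel) = (\<integral>x. r x * f x \<partial>lebesgue)" if [measurable]: "r \<in> borel_measurable borel" for r :: "'a \<Rightarrow> real"
    proof -
      have "(\<integral>x. r x * f' x \<partial>lborel) = (\<integral>x. r x * f' x \<partial>lebesgue)"
        by (intro integral_completion[symmetric]) simp
      also have "\<dots> = (\<integral>x. r x * f x \<partial>lebesgue)"
      proof (rule integral_cong_AE)
        have [measurable]: "r \<in> borel_measurable lebesgue" by (intro measurable_completion) simp
        have [measurable]: "f \<in> borel_measurable lebesgue" "f' \<in> borel_measurable lebesgue" using fi f'i by auto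
        show "(\<lambda>x. r x * f' x) \<in> borel_measurable lebesgue" "(\<lambda>x. r x * f x) \<in> borel_measurable lebesgue" by measurable
        show "AE x in lebesgue. r x * f' x = r x * f x" using AE_completion[OF f'(2)] by eventually_elim simp
      qed
      finally show ?thesis .
    qed
    have z: "AE x in lborel. f' x = 0"
    proof (rule AE_eq_0_of_integral_boxes)
      show "integrable lborel f'" using f'i integrable_completion[OF f'(1)] by simp
      show "(\<integral>x. f' x \<partial>lborel) = 0"
        using eqi[of "\<lambda>_. 1"] integral_box_eq_0_of_test[OF loc[OF compact_cbox sub] sub test] by (simp add: f_def)
      fix a b :: 'a
      define p where "p = (\<Sum>i\<in>Basis. max (a \<bullet> i) (c \<bullet> i) *\<^sub>R i)"
      define q where "q = (\<Sum>i\<in>Basis. min (b \<bullet> i) (d \<bullet> i) *\<^sub>R i)"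
      have pq: "box p q = box a b \<inter> box c d" unfolding p_def q_def box_Int_box ..
      have sub': "cbox p q \<subseteq> \<Omega>"
        using sub by (auto simp: p_def q_def mem_box subset_eq)
      have "(\<integral>x. indicator (box a b) x * f' x \<partial>lborel) = (\<integral>x. indicator (box a b) x * f x \<partial>lebesgue)"
        by (rule eqi) simp
      also have "\<dots> = (\<integral>x. indicator (box p q) x * h x \<partial>lebesgue)"
        unfolding f_def pq by (simp add: indicator_inter_arith mult.assoc)
      also have "\<dots> = 0"
        by (rule integral_box_eq_0_of_test[OF loc[OF compact_cbox sub'] sub' test])
      finally show "(\<integral>x. indicator (box a b) x * f' x \<partial>lborel) = 0" .
    qed
    have 1: "AE x in lebesgue. f x = 0"
      using AE_completion[OF f'(2)] AE_completion[OF z] by eventually_elim simp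
    have "cbox c d - box c d \<in> null_sets lebesgue"
      using negligible_frontier_interval[of c d] by (simp add: negligible_iff_null_sets)
    from AE_not_in[OF this] 1 show ?thesis
      by eventually_elim (auto simp: f_def indicator_def split: if_splits)
  qed
  obtain \<D> where D: "countable \<D>" "\<D> \<subseteq> Pow \<Omega>" "\<And>X. X \<in> \<D> \<Longrightarrow> \<exists>a b. X = cbox a b" "\<Union>\<D> = \<Omega>"
    using open_countable_Union_open_cbox[OF op] by metis
  have "AE x in lebesgue. \<forall>X\<in>\<D>. x \<in> X \<longrightarrow> h x = 0"
    unfolding AE_ball_countable[OF D(1)]
  proof
    fix X assume X: "X \<in> \<D>"
    then obtain a b where "X = cbox a b" using D(3) by blast
    with X D(2) show "AE x in lebesgue. x \<in> X \<longrightarrow> h x = 0" using box[of a b] by auto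
  qed
  then show ?thesis by eventually_elim (use D(4) in auto)
qed

section \<open>The Euler-Lagrange equation\<close>

text \<open>
  Convexity of \<open>t \<mapsto> t\<^sup>q\<close> on the closed half-line. At \<open>a = 0\<close> and \<open>q = 1\<close> the term \<open>a powr (q - 1)\<close> is 0, and
  the inequality is weaker than the tangent inequality with slope 1.
\<close>

lemma powr_tangent:
  fixes a b q :: real
  assumes "0 \<le> a" "0 \<le> b" "1 \<le> q"
  shows "a powr q + q * a powr (q - 1) * (b - a) \<le> b powr q"
proof (cases "a = 0")
  case True
  then show ?thesis by simp
next
  case False
  then have a: "0 < a" using assms by simp
  have aq: "a powr q = a powr (q - 1) * a" using a by (simp add: powr_mult_base mult.commute)
  show ?thesis
  proof (cases "b = 0")
    case True
    have "a powr q * (1 - q) \<le> 0" using assms by (intro mult_nonneg_nonpos) auto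
    then show ?thesis using True aq by (simp add: algebra_simps)
  next
    case False
    then have b: "0 < b" using assms by simp
    have "b powr q - a powr q \<ge> (q * a powr (q - 1)) * (b - a)"
    proof (rule convex_on_imp_above_tangent[where A="{0<..}"])
      show "convex_on {0<..} (\<lambda>x. x powr q)" by (rule powr_convex[OF assms(3)])
      show "((\<lambda>x. x powr q) has_real_derivative q * a powr (q - 1)) (at a within {0<..})"
        using a by (auto intro!: derivative_eq_intros)
    qed (use a b in \<open>auto simp: interior_open\<close>)
    then show ?thesis by simp
  qed
qed

lemma powr_le_square: "0 \<le> a \<Longrightarrow> 1 \<le> q \<Longrightarrow> q < 2 \<Longrightarrow> a powr q \<le> 1 + (a::real)\<^sup>2"
proof (cases "a \<le> 1")
  assume *: "0 \<le> a" "1 \<le> q" "q < 2"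
  case True
  then show ?thesis using powr_mono2[of q a 1] * by (auto intro: order_trans)
next
  assume *: "0 \<le> a" "1 \<le> q" "q < 2"
  case False
  then have "a powr q \<le> a powr 2" using * by (intro powr_mono) auto
  then show ?thesis using False by simp
qed

lemma powr_le_linear: "0 \<le> a \<Longrightarrow> 1 \<le> q \<Longrightarrow> q < 2 \<Longrightarrow> a powr (q - 1) \<le> 1 + (a::real)"
proof (cases "a \<le> 1")
  assume *: "0 \<le> a" "1 \<le> q" "q < 2"
  case True
  then show ?thesis using powr_mono2[of "q - 1" a 1] * by (auto intro: order_trans)
next
  assume *: "0 \<le> a" "1 \<le> q" "q < 2"
  case False
  then have "a powr (q - 1) \<le> a powr 1" using * by (intro powr_mono) auto
  then show ?thesis using False by simp
qed

text \<open>
  A minimizer together with its gradient, so that the gradient can be named.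
\<close>

definition lane_emden_pair :: "real \<Rightarrow> 'a::euclidean_space set \<Rightarrow> ('a \<Rightarrow> real) \<Rightarrow> ('a \<Rightarrow> 'a) \<Rightarrow> bool" where
  "lane_emden_pair q U u g \<longleftrightarrow> D12_0 U u g \<and> (AE x\<in>U in lebesgue. 0 \<le> u x) \<and>
     (\<forall>v h. D12_0 U v h \<and> (AE x\<in>U in lebesgue. 0 \<le> v x) \<longrightarrow>
        lane_emden_energy q U u g \<le> lane_emden_energy q U v h)"

lemma lane_emden_energy_eq:
  assumes D: "D12_0 U u g" and U: "open U"
  shows "lane_emden_energy q U u g =
     1 / 2 * sqnorm lebesgue g - 1 / q * (\<integral>x. u x powr q \<partial>lebesgue)"
proof -
  have [measurable]: "U \<in> sets lebesgue" using U by auto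
  note [measurable] = D12_0_measurable[OF D]
  have "(LINT x:U|lebesgue. (norm (g x))\<^sup>2) = sqnorm lebesgue g"
    unfolding set_lebesgue_integral_def
  proof (rule integral_cong_AE)
    show "AE x in lebesgue. indicat_real U x *\<^sub>R (norm (g x))\<^sup>2 = (norm (g x))\<^sup>2"
      using D12_0_vanishes_outside[OF D] by eventually_elim (auto simp: indicator_def)
  qed measurable
  moreover have "(LINT x:U|lebesgue. u x powr q) = (\<integral>x. u x powr q \<partial>lebesgue)"
    unfolding set_lebesgue_integral_def
  proof (rule integral_cong_AE)
    show "AE x in lebesgue. indicat_real U x *\<^sub>R u x powr q = u x powr q"
      using D12_0_vanishes_outside[OF D] by eventually_elim (auto simp: indicator_def)
  qed measurable
  ultimately show ?thesis by (simp add: lane_emden_energy_def)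
qed

lemma D12_0_nonneg_everywhere:
  assumes "D12_0 U u g" "AE x\<in>U in lebesgue. 0 \<le> u x"
  shows "AE x in lebesgue. 0 \<le> u x"
  using D12_0_vanishes_outside[OF assms(1)] assms(2) by eventually_elim auto

lemma lane_emden_pairD:
  assumes "lane_emden_pair q U u g"
  shows "D12_0 U u g" "AE x in lebesgue. 0 \<le> u x"
  using assms D12_0_nonneg_everywhere unfolding lane_emden_pair_def by blast+

lemma lane_emden_pair_minimal:
  assumes L: "lane_emden_pair q U u g" and U: "open U"
    and D: "D12_0 U v h" and nn: "AE x in lebesgue. 0 \<le> v x"
  shows "1 / 2 * sqnorm lebesgue g - 1 / q * (\<integral>x. u x powr q \<partial>lebesgue) \<le>
     1 / 2 * sqnorm lebesgue h - 1 / q * (\<integral>x. v x powr q \<partial>lebesgue)"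
proof -
  have "AE x\<in>U in lebesgue. 0 \<le> v x" using nn by eventually_elim simp
  then have "lane_emden_energy q U u g \<le> lane_emden_energy q U v h"
    using L D unfolding lane_emden_pair_def by blast
  then show ?thesis
    by (simp only: lane_emden_energy_eq[OF D U] lane_emden_energy_eq[OF lane_emden_pairD(1)[OF L] U])
qed

lemma integrable_indicator_bounded_open:
  "open U \<Longrightarrow> bounded (U::'a::euclidean_space set) \<Longrightarrow> integrable lebesgue (indicator U :: 'a \<Rightarrow> real)"
  using bounded_set_imp_lmeasurable[of U] lmeasurable_iff_integrable[of U] by auto

lemma D12_0_powr_integrable:
  assumes D: "D12_0 U u g" "AE x in lebesgue. 0 \<le> u x" and U: "open U" "bounded U" and q: "1 \<le> q" "q < 2"
  shows "integrable lebesgue (\<lambda>x. u x powr q)"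
proof (rule Bochner_Integration.integrable_bound)
  show "integrable lebesgue (\<lambda>x. indicator U x + (norm (u x))\<^sup>2)"
    by (intro Bochner_Integration.integrable_add integrable_indicator_bounded_open U sq_integrableD(2)[OF D12_0_sq_integrable(1)[OF D(1)]])
  show "(\<lambda>x. u x powr q) \<in> borel_measurable lebesgue" using D12_0_measurable(1)[OF D(1)] by measurable
  show "AE x in lebesgue. norm (u x powr q) \<le> norm (indicator U x + (norm (u x))\<^sup>2)"
    using D12_0_vanishes_outside[OF D(1)] D(2)
    by eventually_elim (use q powr_le_square in \<open>auto simp: indicator_def\<close>)
qed

lemma D12_0_powr_mult_integrable:
  assumes D: "D12_0 U u g" "AE x in lebesgue. 0 \<le> u x" and U: "open U" "bounded U" and q: "1 \<le> q" "q < 2"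
    and k: "D12_0 U v k"
  shows "integrable lebesgue (\<lambda>x. u x powr (q - 1) * v x)"
proof (rule Bochner_Integration.integrable_bound)
  note [measurable] = D12_0_measurable(1)[OF D(1)] D12_0_measurable(1)[OF k]
  show "integrable lebesgue (\<lambda>x. 2 * indicator U x + (norm (u x))\<^sup>2 + 2 * (norm (v x))\<^sup>2)"
    by (intro Bochner_Integration.integrable_add integrable_mult_right integrable_indicator_bounded_open U
      sq_integrableD(2)[OF D12_0_sq_integrable(1)[OF D(1)]] sq_integrableD(2)[OF D12_0_sq_integrable(1)[OF k]])
  show "(\<lambda>x. u x powr (q - 1) * v x) \<in> borel_measurable lebesgue" by measurable
  show "AE x in lebesgue. norm (u x powr (q - 1) * v x) \<le> norm (2 * indicator U x + (norm (u x))\<^sup>2 + 2 * (norm (v x))\<^sup>2)"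
    using D12_0_vanishes_outside[OF k] D(2)
  proof eventually_elim
    case (elim x)
    show ?case
    proof (cases "x \<in> U")
      case False
      then show ?thesis using elim by simp
    next
      case True
      have "\<bar>u x powr (q - 1) * v x\<bar> \<le> (1 + u x) * \<bar>v x\<bar>"
        using powr_le_linear[of "u x" q] elim(2) q by (simp add: abs_mult mult_right_mono)
      also have "\<dots> \<le> 2 + (u x)\<^sup>2 + 2 * (v x)\<^sup>2"
      proof -
        have "2 * \<bar>v x\<bar> \<le> 1 + (v x)\<^sup>2" "2 * (u x * \<bar>v x\<bar>) \<le> (u x)\<^sup>2 + (v x)\<^sup>2"
          using sum_squares_bound[of 1 "\<bar>v x\<bar>"] sum_squares_bound[of "u x" "\<bar>v x\<bar>"] by simp_all
        moreover have "(1 + u x) * \<bar>v x\<bar> = \<bar>v x\<bar> + u x * \<bar>v x\<bar>" by (simp add: distrib_right)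
        ultimately show ?thesis using zero_le_power2[of "u x"] zero_le_power2[of "v x"] by linarith
      qed
      finally show ?thesis using True by simp
    qed
  qed
qed

text \<open>
  The first variation: divide by \<open>t\<close> and let \<open>t\<close> tend to 0.
\<close>

lemma nonneg_of_perturbation:
  assumes "\<And>t::real. 0 < t \<Longrightarrow> 0 \<le> t * A + t\<^sup>2 * B"
  shows "0 \<le> (A::real)"
proof (rule ccontr)
  assume "\<not> 0 \<le> A"
  then have A: "A < 0" by simp
  define t where "t = - A / (2 * (\<bar>B\<bar> + 1))"
  have t: "0 < t" unfolding t_def by (rule divide_pos_pos) (use A in auto)
  have "t * B \<le> t * (\<bar>B\<bar> + 1)" using t by (intro mult_left_mono) auto
  also have "\<dots> = - A / 2"
  proof -
    have "- A / (2 * x) * x = - A / 2" if "0 < x" for x using that by simp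
    from this[of "\<bar>B\<bar> + 1"] show ?thesis by (simp add: t_def)
  qed
  finally have "A + t * B < 0" using A by linarith
  then have "t * (A + t * B) < 0" using t by (simp add: mult_pos_neg)
  with assms[OF t] show False by (simp add: power2_eq_square algebra_simps)
qed

lemma integral_norm_add_sq:
  assumes "sq_integrable M g" "sq_integrable M k"
  shows "sqnorm M (\<lambda>x. g x + t *\<^sub>R k x) =
    sqnorm M g + 2 * t * (\<integral>x. g x \<bullet> k x \<partial>M) + t\<^sup>2 * sqnorm M k"
proof -
  have "sqnorm M (\<lambda>x. g x + t *\<^sub>R k x) =
      (\<integral>x. (norm (g x))\<^sup>2 + 2 * t * (g x \<bullet> k x) + t\<^sup>2 * (norm (k x))\<^sup>2 \<partial>M)"
    by (intro Bochner_Integration.integral_cong refl)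
      (simp add: power2_norm_eq_inner inner_add inner_commute, simp add: power2_eq_square)
  also have "\<dots> = sqnorm M g + 2 * t * (\<integral>x. g x \<bullet> k x \<partial>M) + t\<^sup>2 * sqnorm M k"
    using assms integrable_inner[OF assms] by (simp add: sq_integrable_def)
  finally show ?thesis .
qed

text \<open>
  The competitor is the positive part of \<open>u + t v\<close>, which satisfies the constraint for \<open>v\<close> of any sign. Passing to the positive part does
  not increase the Dirichlet integral, and by convexity the other integral is bounded below by its
  linearization. The inequality for \<open>v\<close> and \<open>-v\<close> yields the equation.
\<close>

lemma Euler_Lagrange_le:
  assumes L: "lane_emden_pair q U u g" and U: "open U" "bounded U" and q: "1 \<le> q" "q < 2"
    and k: "D12_0 U v k"
  shows "(\<integral>x. u x powr (q - 1) * v x \<partial>lebesgue) \<le> (\<integral>x. g x \<bullet> k x \<partial>lebesgue)"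
proof -
  note D = lane_emden_pairD[OF L]
  note sg = D12_0_sq_integrable(2)[OF D(1)] and sk = D12_0_sq_integrable(2)[OF k]
  let ?P = "\<integral>x. u x powr (q - 1) * v x \<partial>lebesgue" and ?G = "\<integral>x. g x \<bullet> k x \<partial>lebesgue"
  have "0 \<le> t * (?G - ?P) + t\<^sup>2 * (1 / 2 * sqnorm lebesgue k)" if t: "0 < t" for t
  proof -
    define w where "w x = max 0 (u x + t * v x)" for x
    define h where "h x = (if u x + t * v x > 0 then g x + t *\<^sub>R k x else 0)" for x
    have Dt: "D12_0 U (\<lambda>x. u x + t * v x) (\<lambda>x. g x + t *\<^sub>R k x)" by (intro D12_0_add D12_0_cmult D k)
    have Dw: "D12_0 U w h" unfolding w_def h_def by (rule D12_0_pos_part[OF Dt])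
    have wnn: "AE x in lebesgue. 0 \<le> w x" by (simp add: w_def)
    have "sqnorm lebesgue h \<le> sqnorm lebesgue (\<lambda>x. g x + t *\<^sub>R k x)"
      by (rule integral_mono) (use sq_integrableD(2)[OF D12_0_sq_integrable(2)[OF Dw]]
        sq_integrableD(2)[OF D12_0_sq_integrable(2)[OF Dt]] in \<open>auto simp: h_def\<close>)
    then have 1: "sqnorm lebesgue h \<le>
      sqnorm lebesgue g + 2 * t * ?G + t\<^sup>2 * sqnorm lebesgue k"
      unfolding integral_norm_add_sq[OF sg sk] .
    have iu: "integrable lebesgue (\<lambda>x. u x powr q)" by (rule D12_0_powr_integrable[OF D U q])
    have iuv: "integrable lebesgue (\<lambda>x. u x powr (q - 1) * v x)" by (rule D12_0_powr_mult_integrable[OF D U q k])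
    have "(\<integral>x. u x powr q + q * t * (u x powr (q - 1) * v x) \<partial>lebesgue) \<le> (\<integral>x. w x powr q \<partial>lebesgue)"
    proof (rule integral_mono_AE)
      show "integrable lebesgue (\<lambda>x. w x powr q)" by (rule D12_0_powr_integrable[OF Dw wnn U q])
      show "AE x in lebesgue. u x powr q + q * t * (u x powr (q - 1) * v x) \<le> w x powr q"
        using D(2)
      proof eventually_elim
        case (elim x)
        have "q * u x powr (q - 1) * (t * v x) \<le> q * u x powr (q - 1) * (w x - u x)"
          using q by (intro mult_left_mono) (auto simp: w_def)
        then show ?case
          using powr_tangent[OF elim _ q(1), of "w x"] by (simp add: w_def algebra_simps)
      qed
    qed (use iu iuv in auto)
    then have "(\<integral>x. u x powr q \<partial>lebesgue) + q * t * ?P \<le> (\<integral>x. w x powr q \<partial>lebesgue)"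
      using iu iuv by simp
    then have "1 / q * ((\<integral>x. u x powr q \<partial>lebesgue) + q * t * ?P) \<le> 1 / q * (\<integral>x. w x powr q \<partial>lebesgue)"
      using q by (intro mult_left_mono) auto
    then have 2: "1 / q * (\<integral>x. u x powr q \<partial>lebesgue) + t * ?P \<le> 1 / q * (\<integral>x. w x powr q \<partial>lebesgue)"
      using q by (simp add: distrib_left)
    have "t * (?G - ?P) + t\<^sup>2 * (1 / 2 * sqnorm lebesgue k) =
      t * ?G - t * ?P + 1 / 2 * (t\<^sup>2 * sqnorm lebesgue k)" by (simp add: algebra_simps)
    with 1 2 lane_emden_pair_minimal[OF L U(1) Dw wnn] show ?thesis
      by linarith
  qed
  from nonneg_of_perturbation[OF this] show ?thesis by simp
qed

lemma Euler_Lagrange: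
  assumes L: "lane_emden_pair q U u g" and U: "open U" "bounded U" and q: "1 \<le> q" "q < 2"
    and k: "D12_0 U v k"
  shows "(\<integral>x. g x \<bullet> k x \<partial>lebesgue) = (\<integral>x. u x powr (q - 1) * v x \<partial>lebesgue)"
  using Euler_Lagrange_le[OF assms] Euler_Lagrange_le[OF L U q D12_0_cmult[OF k, of "-1"]] by simp

text \<open>
  The last summand on the left is what the tangent inequality loses at \<open>a = 0\<close>. For \<open>q > 1\<close> the tangent there is horizontal,
  and for \<open>q = 1\<close> it is so by the convention \<open>0 powr 0 = 0\<close>.
\<close>

lemma powr_add_le_split:
  fixes a c q :: real
  assumes "0 \<le> a" "0 \<le> c" "1 \<le> q"
  shows "a powr q + q * a powr (q - 1) * c + (if a = 0 then c powr q else 0) \<le> (a + c) powr q"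
  using powr_tangent[of a "a + c" q] assms by simp

text \<open>
  A strong maximum principle that uses minimality only. By the Euler-Lagrange equation the terms of order \<open>t\<close> in the energy of
  \<open>u + t f\<close> cancel. What is left is a loss of order \<open>t\<^sup>2\<close> and, from the set where \<open>u\<close> vanishes,
  a gain of order \<open>t\<^sup>q\<close>; since \<open>q < 2\<close>, that set cannot meet \<open>{f > 0}\<close> in positive measure.
\<close>

lemma lane_emden_pair_pos:
  assumes L: "lane_emden_pair q U u g" and U: "open U" "bounded U" and q: "1 \<le> q" "q < 2"
    and f: "f \<in> C0_inf U" "\<And>x. 0 \<le> f x"
  shows "AE x in lebesgue. 0 < f x \<longrightarrow> 0 < u x"
proof -
  note D = lane_emden_pairD[OF L]
  note k = D12_0_test[OF f(1)]
  note sg = D12_0_sq_integrable(2)[OF D(1)] and sk = D12_0_sq_integrable(2)[OF k]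
  note [measurable] = D12_0_measurable(1)[OF D(1)] D12_0_measurable(1)[OF k]
  let ?K = "sqnorm lebesgue (grad f)"
  define z where "z x = (if u x = 0 then f x powr q else 0)" for x
  have fq: "integrable lebesgue (\<lambda>x. f x powr q)"
    by (rule D12_0_powr_integrable[OF k _ U q]) (simp add: f(2))
  have zi: "integrable lebesgue z"
    by (rule Bochner_Integration.integrable_bound[OF fq]) (auto simp: z_def[abs_def])
  let ?Z = "\<integral>x. z x \<partial>lebesgue"
  have est: "?Z \<le> q / 2 * ?K * t powr (2 - q)" if t: "0 < t" for t
  proof -
    have Dt: "D12_0 U (\<lambda>x. u x + t * f x) (\<lambda>x. g x + t *\<^sub>R grad f x)" by (intro D12_0_add D12_0_cmult D k)
    have tnn: "AE x in lebesgue. 0 \<le> u x + t * f x" using D(2) by eventually_elim (use f(2) t in auto)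
    have iu: "integrable lebesgue (\<lambda>x. u x powr q)" by (rule D12_0_powr_integrable[OF D U q])
    have iuv: "integrable lebesgue (\<lambda>x. u x powr (q - 1) * f x)" by (rule D12_0_powr_mult_integrable[OF D U q k])
    have "(\<integral>x. u x powr q + q * t * (u x powr (q - 1) * f x) + t powr q * z x \<partial>lebesgue) \<le> (\<integral>x. (u x + t * f x) powr q \<partial>lebesgue)"
    proof (rule integral_mono_AE)
      show "integrable lebesgue (\<lambda>x. (u x + t * f x) powr q)" by (rule D12_0_powr_integrable[OF Dt tnn U q])
      show "AE x in lebesgue. u x powr q + q * t * (u x powr (q - 1) * f x) + t powr q * z x \<le> (u x + t * f x) powr q"
        using D(2)
      proof eventually_elim
        case (elim x)
        show ?case using powr_add_le_split[OF elim _ q(1), of "t * f x"] t f(2)[of x]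
          by (simp add: z_def powr_mult mult_ac split: if_splits)
      qed
    qed (use iu iuv zi in auto)
    then have "(\<integral>x. u x powr q \<partial>lebesgue) + q * t * (\<integral>x. u x powr (q - 1) * f x \<partial>lebesgue) + t powr q * ?Z
      \<le> (\<integral>x. (u x + t * f x) powr q \<partial>lebesgue)"
      using iu iuv zi by simp
    moreover have "(\<integral>x. (u x + t * f x) powr q \<partial>lebesgue) \<le> (\<integral>x. u x powr q \<partial>lebesgue) + q * t * (\<integral>x. g x \<bullet> grad f x \<partial>lebesgue)
        + q / 2 * (t\<^sup>2 * ?K)"
    proof -
      have "1 / q * (\<integral>x. (u x + t * f x) powr q \<partial>lebesgue) \<le> 1 / q * (\<integral>x. u x powr q \<partial>lebesgue) + t * (\<integral>x. g x \<bullet> grad f x \<partial>lebesgue)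
        + 1 / 2 * (t\<^sup>2 * ?K)"
      proof -
        have "1 / 2 * (a + 2 * t * b + t\<^sup>2 * c) = 1 / 2 * a + t * b + 1 / 2 * (t\<^sup>2 * c)" for a b c
          by (simp add: algebra_simps)
        then show ?thesis
          using lane_emden_pair_minimal[OF L U(1) Dt tnn] unfolding integral_norm_add_sq[OF sg sk] by (smt (verit))
      qed
      then have "q * (1 / q * (\<integral>x. (u x + t * f x) powr q \<partial>lebesgue)) \<le> q * (1 / q * (\<integral>x. u x powr q \<partial>lebesgue) + t * (\<integral>x. g x \<bullet> grad f x \<partial>lebesgue)
        + 1 / 2 * (t\<^sup>2 * ?K))"
        using q by (intro mult_left_mono) auto
      then show ?thesis using q by (simp add: distrib_left)
    qed
    ultimately have "t powr q * ?Z \<le> q / 2 * (t\<^sup>2 * ?K)"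
      unfolding Euler_Lagrange[OF L U q k] by linarith
    also have "t\<^sup>2 = t powr q * t powr (2 - q)" using t by (simp add: powr_add[symmetric])
    finally have "t powr q * ?Z \<le> t powr q * (q / 2 * ?K * t powr (2 - q))" by (simp add: mult_ac)
    then show ?thesis using t by (simp add: mult_le_cancel_left_pos)
  qed
  have lim: "((\<lambda>t. q / 2 * ?K * t powr (2 - q)) \<longlongrightarrow> q / 2 * ?K * 0) (at_right 0)"
  proof (intro tendsto_mult tendsto_const)
    have "((\<lambda>t::real. t powr (2 - q)) \<longlongrightarrow> 0 powr (2 - q)) (at_right 0)"
      by (rule tendsto_powr2) (use q in \<open>auto simp: eventually_at_right_field intro!: exI[of _ 1] tendsto_intros\<close>)
    then show "((\<lambda>t::real. t powr (2 - q)) \<longlongrightarrow> 0) (at_right 0)" by simp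
  qed
  have "?Z \<le> q / 2 * ?K * 0"
    by (rule tendsto_lowerbound[OF lim]) (use est in \<open>auto simp: eventually_at_right_field intro!: exI[of _ 1]\<close>)
  moreover have "0 \<le> ?Z" by (rule integral_nonneg_AE) (simp add: z_def)
  ultimately have "?Z = 0" by simp
  moreover have "AE x in lebesgue. 0 \<le> z x" by (simp add: z_def)
  ultimately have "AE x in lebesgue. z x = 0" by (simp only: integral_nonneg_eq_0_iff_AE[OF zi])
  then show ?thesis using D(2) by eventually_elim (auto simp: z_def split: if_splits)
qed

section \<open>Weighted estimates\<close>

text \<open>
  The definition of \<open>\<lambda>\<^sub>1\<close> sees normalized functions only, so \<open>f\<close> is divided by its norm.
\<close>

lemma lambda1_Poincare:
  assumes l: "ereal l \<le> lambda1 \<Omega>" and f: "f \<in> C0_inf \<Omega>"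
  shows "l * sqnorm lebesgue f \<le> sqnorm lebesgue (grad f)"
proof (cases "sqnorm lebesgue f = 0")
  case True
  then show ?thesis by simp
next
  case False
  let ?S = "sqnorm lebesgue f"
  have "0 \<le> ?S" by simp
  with False have S: "0 < ?S" by linarith
  define c where "c = 1 / sqrt ?S"
  have c: "c\<^sup>2 = 1 / ?S" using S by (simp add: c_def power_divide)
  let ?h = "\<lambda>x. c * f x"
  have h: "?h \<in> C0_inf \<Omega>" by (rule C0_inf_mult[OF smooth_const f])
  obtain K where K: "K \<subseteq> \<Omega>" "\<And>x. x \<notin> K \<Longrightarrow> f x = 0" "\<And>x. x \<notin> K \<Longrightarrow> grad f x = 0"
    using C0_inf_support[OF f] by metis
  have z: "x \<notin> \<Omega> \<Longrightarrow> f x = 0" "x \<notin> \<Omega> \<Longrightarrow> grad f x = 0" for x using K by blast+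
  have gh: "grad ?h x = c *\<^sub>R grad f x" for x by (rule grad_cmult[OF C0_inf_smooth[OF f]])
  have "(LINT x:\<Omega>|lebesgue. (?h x)\<^sup>2) = (\<integral>x. c\<^sup>2 * (norm (f x))\<^sup>2 \<partial>lebesgue)"
    unfolding set_lebesgue_integral_def
    by (intro Bochner_Integration.integral_cong refl) (auto simp: indicator_def z power_mult_distrib)
  also have "\<dots> = 1" using S by (simp add: c)
  finally have 1: "sqrt (LINT x:\<Omega>|lebesgue. (?h x)\<^sup>2) = 1" by simp
  have "(LINT x:\<Omega>|lebesgue. (norm (grad ?h x))\<^sup>2) = (\<integral>x. c\<^sup>2 * (norm (grad f x))\<^sup>2 \<partial>lebesgue)"
    unfolding set_lebesgue_integral_def
    by (intro Bochner_Integration.integral_cong refl) (auto simp: indicator_def z gh power_mult_distrib)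
  then have 2: "(LINT x:\<Omega>|lebesgue. (norm (grad ?h x))\<^sup>2) = c\<^sup>2 * sqnorm lebesgue (grad f)" by simp
  have "lambda1 \<Omega> \<le> ereal (LINT x:\<Omega>|lebesgue. (norm (grad ?h x))\<^sup>2)"
    unfolding lambda1_def by (rule INF_lower) (use h 1 in auto)
  from order_trans[OF l this] have "l \<le> c\<^sup>2 * sqnorm lebesgue (grad f)"
    unfolding 2 by (simp only: ereal_less_eq(3))
  then show ?thesis unfolding c using S by (simp add: field_simps)
qed

lemma D12_0_Poincare:
  assumes P: "\<And>f. f \<in> C0_inf \<Omega> \<Longrightarrow> l * sqnorm lebesgue f \<le> sqnorm lebesgue (grad f)"
    and D: "D12_0 U v k" and U: "U \<subseteq> \<Omega>"
  shows "l * sqnorm lebesgue v \<le> sqnorm lebesgue k"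
proof -
  obtain F where F: "\<And>n::nat. F n \<in> C0_inf U" "L2_tendsto lebesgue F v" "L2_tendsto lebesgue (\<lambda>n. grad (F n)) k"
    using D unfolding D12_0_iff by blast
  show ?thesis
  proof (rule LIMSEQ_le[OF tendsto_mult[OF tendsto_const L2_tendsto_norm[OF F(2)]] L2_tendsto_norm[OF F(3)]])
    show "\<exists>N. \<forall>n\<ge>N. l * sqnorm lebesgue (F n) \<le> sqnorm lebesgue (grad (F n))"
      using P[OF C0_inf_mono[OF F(1) U]] by blast
  qed
qed

lemma powr_le_small_square:
  assumes "1 \<le> q" "q < 2" "0 < \<theta>"
  obtains K where "0 \<le> K" "\<And>a. 0 \<le> a \<Longrightarrow> a powr q \<le> \<theta> * a\<^sup>2 + (K::real)"
proof -
  define T where "T = (1 / \<theta>) powr (1 / (2 - q))"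
  have T: "0 < T" "T powr (2 - q) = 1 / \<theta>" using assms by (auto simp: T_def powr_powr)
  have "a powr q \<le> \<theta> * a\<^sup>2 + T powr q" if a: "0 \<le> a" for a
  proof (cases "a \<le> T")
    case True
    have "a powr q \<le> T powr q" using True a assms by (intro powr_mono2) auto
    moreover have "0 \<le> \<theta> * a\<^sup>2" using assms by simp
    ultimately show ?thesis by linarith
  next
    case False
    have "1 / \<theta> \<le> a powr (2 - q)" using False T assms by (subst T(2)[symmetric], intro powr_mono2) auto
    then have "1 \<le> \<theta> * a powr (2 - q)" using assms by (simp add: field_simps)
    then have "a powr q * 1 \<le> a powr q * (\<theta> * a powr (2 - q))" by (intro mult_left_mono) auto
    also have "\<dots> = \<theta> * (a powr q * a powr (2 - q))" by simp
    also have "a powr q * a powr (2 - q) = a\<^sup>2" using False T by (simp add: powr_add[symmetric])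
    finally show ?thesis by (simp add: add_increasing2)
  qed
  then show ?thesis by (intro that[of "T powr q"]) auto
qed

text \<open>
  Let \<open>A\<close>, \<open>Q\<close> and \<open>E\<close> be the integrals of \<open>(\<rho>u)\<^sup>2\<close>, \<open>|\<nabla>(\<rho>u)|\<^sup>2\<close> and \<open>u\<^sup>2|\<nabla>\<rho>|\<^sup>2\<close>. Testing the equation with \<open>\<rho>\<^sup>2u\<close> gives
  \<open>Q = \<integral> \<rho>\<^sup>2u\<^sup>q + E\<close>. Both terms can be absorbed into \<open>l A \<le> Q\<close>: \<open>E\<close> because \<open>\<rho>\<close> varies slowly, and the other
  one because \<open>u\<^sup>q\<close> is at most \<open>l u\<^sup>2/4\<close> plus a constant, which is integrable against \<open>\<rho>\<^sup>2\<close>.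
\<close>

lemma lane_emden_weighted_bound:
  fixes \<rho> :: "'a::euclidean_space \<Rightarrow> real"
  assumes P: "\<And>f. f \<in> C0_inf \<Omega> \<Longrightarrow> l * sqnorm lebesgue f \<le> sqnorm lebesgue (grad f)"
    and l: "0 < l" and q: "1 \<le> q" "q < 2"
    and r: "smooth \<rho>" "\<And>x. \<bar>\<rho> x\<bar> \<le> 1" "\<And>x. norm (grad \<rho> x) \<le> c * \<bar>\<rho> x\<bar>" "c\<^sup>2 \<le> l / 4" "0 \<le> c"
    and rs: "sq_integrable lebesgue \<rho>"
  obtains M where "\<And>U u g. lane_emden_pair q U u g \<Longrightarrow> open U \<Longrightarrow> bounded U \<Longrightarrow> U \<subseteq> \<Omega> \<Longrightarrow>
    sqnorm lebesgue (\<lambda>x. \<rho> x * u x) \<le> M \<and> sqnorm lebesgue (\<lambda>x. \<rho> x *\<^sub>R g x) \<le> M"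
proof -
  obtain K where K: "0 \<le> K" "\<And>a. 0 \<le> a \<Longrightarrow> a powr q \<le> l / 4 * a\<^sup>2 + K"
    using powr_le_small_square[OF q, of "l / 4"] l by auto
  define R where "R = sqnorm lebesgue \<rho>"
  have R: "0 \<le> R" by (simp add: R_def)
  have gb: "norm (grad \<rho> x) \<le> c" for x
    using r(3)[of x] mult_left_mono[OF r(2)[of x] r(5)] by linarith
  have gb2: "(norm (grad \<rho> x))\<^sup>2 \<le> l / 4 * (\<rho> x)\<^sup>2" for x
  proof -
    have "(norm (grad \<rho> x))\<^sup>2 \<le> (c * \<bar>\<rho> x\<bar>)\<^sup>2" by (intro power_mono r) simp
    also have "\<dots> = c\<^sup>2 * (\<rho> x)\<^sup>2" by (simp add: power_mult_distrib)
    also have "\<dots> \<le> l / 4 * (\<rho> x)\<^sup>2" by (intro mult_right_mono r) simp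
    finally show ?thesis .
  qed
  have "sqnorm lebesgue (\<lambda>x. \<rho> x * u x) \<le> 2 * K * R / l \<and> sqnorm lebesgue (\<lambda>x. \<rho> x *\<^sub>R g x) \<le> 5 * K * R"
    if L: "lane_emden_pair q U u g" and U: "open U" "bounded U" "U \<subseteq> \<Omega>" for U u g
  proof -
    note D = lane_emden_pairD[OF L]
    note sq = D12_0_sq_integrable[OF D(1)]
    note m = D12_0_measurable[OF D(1)]
    have rm: "\<rho> \<in> borel_measurable lebesgue" "grad \<rho> \<in> borel_measurable lebesgue"
      using r by (auto intro: lebesgue_measurable_continuous smooth_continuous grad_continuous)
    define k where "k x = \<rho> x *\<^sub>R g x + u x *\<^sub>R grad \<rho> x" for x
    have k: "D12_0 U (\<lambda>x. \<rho> x * u x) k" unfolding k_def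
    proof (rule D12_0_smooth_mult[OF D(1) r(1), where C="max 1 c"])
      show "\<bar>\<rho> x\<bar> \<le> max 1 c" "norm (grad \<rho> x) \<le> max 1 c" for x
        using r(2)[of x] gb[of x] by auto
    qed
    define k2 where "k2 x = \<rho> x *\<^sub>R k x + (\<rho> x * u x) *\<^sub>R grad \<rho> x" for x
    have k2: "D12_0 U (\<lambda>x. \<rho> x * (\<rho> x * u x)) k2" unfolding k2_def
    proof (rule D12_0_smooth_mult[OF k r(1), where C="max 1 c"])
      show "\<bar>\<rho> x\<bar> \<le> max 1 c" "norm (grad \<rho> x) \<le> max 1 c" for x
        using r(2)[of x] gb[of x] by auto
    qed
    define A where "A = sqnorm lebesgue (\<lambda>x. \<rho> x * u x)"
    define Q where "Q = sqnorm lebesgue k"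
    define E where "E = sqnorm lebesgue (\<lambda>x. u x *\<^sub>R grad \<rho> x)"
    have sru: "sq_integrable lebesgue (\<lambda>x. \<rho> x * u x)" by (rule D12_0_sq_integrable[OF k])
    have sk: "sq_integrable lebesgue k" by (rule D12_0_sq_integrable[OF k])
    have Epw: "(norm (u x *\<^sub>R grad \<rho> x))\<^sup>2 \<le> l / 4 * (norm (\<rho> x * u x))\<^sup>2" for x
      using mult_left_mono[OF gb2[of x], of "(u x)\<^sup>2"] by (simp add: power_mult_distrib mult_ac)
    have sE: "sq_integrable lebesgue (\<lambda>x. u x *\<^sub>R grad \<rho> x)"
    proof (rule sq_integrable_bound)
      show "integrable lebesgue (\<lambda>x. l / 4 * (norm (\<rho> x * u x))\<^sup>2)" using sru by (auto simp: sq_integrable_def)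
      show "AE x in lebesgue. (norm (u x *\<^sub>R grad \<rho> x))\<^sup>2 \<le> l / 4 * (norm (\<rho> x * u x))\<^sup>2"
        by (intro AE_I2 Epw)
    qed (use rm m in auto)
    have EA: "E \<le> l / 4 * A"
    proof -
      have "E \<le> (\<integral>x. l / 4 * (norm (\<rho> x * u x))\<^sup>2 \<partial>lebesgue)" unfolding E_def
      proof (rule integral_mono)
        show "(norm (u x *\<^sub>R grad \<rho> x))\<^sup>2 \<le> l / 4 * (norm (\<rho> x * u x))\<^sup>2" for x
          by (rule Epw)
      qed (use sq_integrableD(2)[OF sE] sq_integrableD(2)[OF sru] in auto)
      then show ?thesis by (simp add: A_def)
    qed
    have lA: "l * A \<le> Q" unfolding A_def Q_def by (rule D12_0_Poincare[OF P k U(3)])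
    have "Q = (\<integral>x. g x \<bullet> k2 x + (norm (u x *\<^sub>R grad \<rho> x))\<^sup>2 \<partial>lebesgue)"
      unfolding Q_def
      by (intro Bochner_Integration.integral_cong refl)
        (simp only: k_def k2_def power2_norm_eq_inner, simp add: inner_add inner_commute algebra_simps)
    also have "\<dots> = (\<integral>x. g x \<bullet> k2 x \<partial>lebesgue) + E" unfolding E_def
      by (intro Bochner_Integration.integral_add integrable_inner sq D12_0_sq_integrable(2)[OF k2] sq_integrableD(2)[OF sE])
    also have "(\<integral>x. g x \<bullet> k2 x \<partial>lebesgue) = (\<integral>x. u x powr (q - 1) * (\<rho> x * (\<rho> x * u x)) \<partial>lebesgue)"
      by (rule Euler_Lagrange[OF L U(1,2) q k2])
    also have "\<dots> \<le> (\<integral>x. l / 4 * (norm (\<rho> x * u x))\<^sup>2 + K * (norm (\<rho> x))\<^sup>2 \<partial>lebesgue)"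
    proof (rule integral_mono_AE)
      show "integrable lebesgue (\<lambda>x. u x powr (q - 1) * (\<rho> x * (\<rho> x * u x)))"
        by (rule D12_0_powr_mult_integrable[OF D U(1,2) q k2])
      show "AE x in lebesgue. u x powr (q - 1) * (\<rho> x * (\<rho> x * u x)) \<le> l / 4 * (norm (\<rho> x * u x))\<^sup>2 + K * (norm (\<rho> x))\<^sup>2"
        using D(2)
      proof eventually_elim
        case (elim x)
        have "u x powr (q - 1) * u x = u x powr q"
          using elim by (cases "u x = 0") (auto simp: powr_mult_base mult.commute)
        then have "u x powr (q - 1) * (\<rho> x * (\<rho> x * u x)) = (\<rho> x)\<^sup>2 * u x powr q"
          by (simp add: power2_eq_square mult_ac)
        also have "\<dots> \<le> (\<rho> x)\<^sup>2 * (l / 4 * (u x)\<^sup>2 + K)" by (intro mult_left_mono K elim) simp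
        finally show ?case by (simp add: power_mult_distrib algebra_simps)
      qed
    qed (use sq_integrableD(2)[OF sru] sq_integrableD(2)[OF rs] in auto)
    also have "\<dots> = l / 4 * A + K * R" unfolding A_def R_def
      using sq_integrableD(2)[OF sru] sq_integrableD(2)[OF rs] by simp
    finally have Q: "Q \<le> l / 4 * A + K * R + l / 4 * A" using EA by linarith
    have lA2: "l * A \<le> 2 * K * R" using Q lA by (simp add: algebra_simps)
    then have A: "A \<le> 2 * K * R / l" using l by (simp add: field_simps)
    have "sqnorm lebesgue (\<lambda>x. \<rho> x *\<^sub>R g x) \<le> (\<integral>x. 2 * (norm (k x))\<^sup>2 + 2 * (norm (u x *\<^sub>R grad \<rho> x))\<^sup>2 \<partial>lebesgue)"
    proof (rule integral_mono)
      show "integrable lebesgue (\<lambda>x. (norm (\<rho> x *\<^sub>R g x))\<^sup>2)"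
        by (intro sq_integrableD(2) sq_integrable_bounded_scaleR[OF sq(2) rm(1) r(2)])
      show "(norm (\<rho> x *\<^sub>R g x))\<^sup>2 \<le> 2 * (norm (k x))\<^sup>2 + 2 * (norm (u x *\<^sub>R grad \<rho> x))\<^sup>2" for x
        using norm_diff_sq_le[of "k x" "u x *\<^sub>R grad \<rho> x"] by (simp add: k_def)
    qed (use sq_integrableD(2)[OF sk] sq_integrableD(2)[OF sE] in auto)
    also have "\<dots> = 2 * Q + 2 * E" unfolding Q_def E_def
      using sq_integrableD(2)[OF sk] sq_integrableD(2)[OF sE] by simp
    also have "\<dots> \<le> 5 * K * R" using Q EA lA2 by (simp add: algebra_simps)
    finally show ?thesis using A by (simp add: A_def)
  qed
  then show ?thesis by (intro that[of "max (2 * K * R / l) (5 * K * R)"]) (meson max.coboundedI1 max.coboundedI2)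
qed

section \<open>The quotient \<open>\<phi>\<^sup>2 / (u + \<epsilon>)\<close> as a test function\<close>

text \<open>
  A smooth function on the whole line that is bounded below by \<open>e/2\<close> and equals \<open>e + t\<close> for \<open>t \<ge> 0\<close>. The
  approximating test functions may be negative, so \<open>1/(e + t)\<close> has to be continued to negative \<open>t\<close>. The
  step rises for \<open>t\<close> between \<open>-e/2\<close> and \<open>-e/4\<close>; as it stops before 0, the derivative at \<open>t = 0\<close> is the right one.
\<close>

definition recip_denom :: "real \<Rightarrow> real \<Rightarrow> real" where
  "recip_denom e t = e + t * smooth_step (4 / e * t + 2)"

definition smooth_recip :: "real \<Rightarrow> real \<Rightarrow> real" where
  "smooth_recip e t = inverse (recip_denom e t)"

lemma recip_denom_ge:
  assumes "0 < e"
  shows "e / 2 \<le> recip_denom e t"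
proof -
  let ?s = "smooth_step (4 / e * t + 2)"
  consider "0 \<le> t" | "t < - e / 2" | "- e / 2 \<le> t" "t < 0" by linarith
  then show ?thesis
  proof cases
    case 1
    then have "0 \<le> t * ?s" using smooth_step_bounds by simp
    then show ?thesis using assms unfolding recip_denom_def by linarith
  next
    case 2
    then have "4 / e * t + 2 \<le> 0" using assms by (simp add: field_simps)
    then show ?thesis using assms by (simp add: recip_denom_def smooth_step_le_0)
  next
    case 3
    have "t * 1 \<le> t * ?s" using 3 smooth_step_bounds by (intro mult_left_mono_neg) auto
    then show ?thesis using 3 unfolding recip_denom_def by linarith
  qed
qed

lemma smooth_recip_denom: "smooth (recip_denom e)"
  unfolding recip_denom_def[abs_def]
  by (intro smooth_add smooth_mult smooth_compose[OF smooth_smooth_step] smooth_const smooth_id)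

lemma smooth_smooth_recip:
  assumes "0 < e"
  shows "smooth (smooth_recip e)"
proof -
  have "recip_denom e t \<noteq> 0" for t using recip_denom_ge[OF assms, of t] assms by (smt (verit) half_gt_zero)
  then show ?thesis unfolding smooth_recip_def[abs_def] by (rule smooth_inverse[OF smooth_recip_denom])
qed

lemma deriv_recip_denom:
  "deriv (recip_denom e) t = smooth_step (4 / e * t + 2) + t * (deriv smooth_step (4 / e * t + 2) * (4 / e))"
proof (rule DERIV_imp_deriv)
  have "((\<lambda>t. smooth_step (4 / e * t + 2)) has_field_derivative deriv smooth_step (4 / e * t + 2) * (4 / e)) (at t)"
    by (rule DERIV_chain2[OF smooth_DERIV[OF smooth_smooth_step]],
        rule DERIV_cong[OF DERIV_add[OF DERIV_cmult_Id DERIV_const]], simp)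
  then have "((\<lambda>t. e + t * smooth_step (4 / e * t + 2)) has_field_derivative
      0 + (t * (deriv smooth_step (4 / e * t + 2) * (4 / e)) + 1 * smooth_step (4 / e * t + 2))) (at t)"
    by (intro DERIV_add DERIV_const DERIV_mult'[OF DERIV_ident])
  then show "(recip_denom e has_field_derivative
      smooth_step (4 / e * t + 2) + t * (deriv smooth_step (4 / e * t + 2) * (4 / e))) (at t)"
    by (simp add: recip_denom_def[abs_def] add.commute)
qed

lemma deriv_smooth_recip:
  assumes "0 < e"
  shows "deriv (smooth_recip e) t = - (deriv (recip_denom e) t * (smooth_recip e t)\<^sup>2)"
proof (rule DERIV_imp_deriv)
  have "recip_denom e t \<noteq> 0" using recip_denom_ge[OF assms, of t] assms by linarith
  from DERIV_inverse'[OF smooth_DERIV[OF smooth_recip_denom] this]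
  show "(smooth_recip e has_field_derivative - (deriv (recip_denom e) t * (smooth_recip e t)\<^sup>2)) (at t)"
    by (simp add: smooth_recip_def[abs_def] power2_eq_square mult_ac)
qed

lemma smooth_recip_bound:
  assumes "0 < e"
  shows "0 \<le> smooth_recip e t" "smooth_recip e t \<le> 2 / e"
proof -
  have "inverse (recip_denom e t) \<le> inverse (e / 2)"
    using recip_denom_ge[OF assms, of t] assms by (intro le_imp_inverse_le) auto
  then show "smooth_recip e t \<le> 2 / e" by (simp add: smooth_recip_def)
  show "0 \<le> smooth_recip e t" using recip_denom_ge[OF assms, of t] assms by (simp add: smooth_recip_def)
qed

lemma smooth_recip_nonneg:
  assumes "0 < e" "0 \<le> t"
  shows "smooth_recip e t = 1 / (t + e)" "deriv (smooth_recip e) t = - ((1 / (t + e))\<^sup>2)"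
proof -
  have "0 \<le> 4 / e * t" using assms by simp
  then have "1 < 4 / e * t + 2" by linarith
  then have s: "smooth_step (4 / e * t + 2) = 1" "deriv smooth_step (4 / e * t + 2) = 0"
    by (auto intro: smooth_step_ge_1 deriv_smooth_step_0)
  show 1: "smooth_recip e t = 1 / (t + e)"
    using s by (simp add: smooth_recip_def recip_denom_def inverse_eq_divide add.commute)
  show "deriv (smooth_recip e) t = - ((1 / (t + e))\<^sup>2)"
    unfolding deriv_smooth_recip[OF assms(1)] deriv_recip_denom s 1 by simp
qed

lemma deriv_smooth_recip_bounded:
  assumes "0 < e"
  obtains C where "\<And>t. \<bar>deriv (smooth_recip e) t\<bar> \<le> C"
proof -
  obtain C where C: "C \<ge> 0" "\<And>t. \<bar>deriv smooth_step t\<bar> \<le> C" using deriv_smooth_step_bounded by metis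
  have 1: "\<bar>deriv (recip_denom e) t\<bar> \<le> 1 + 2 * C" for t
  proof -
    \<comment> \<open>Where the derivative of the step does not vanish, \<open>4t/e\<close> lies between -2 and -1.\<close>
    let ?a = "4 / e * t + 2"
    have "\<bar>t * (deriv smooth_step ?a * (4 / e))\<bar> \<le> 2 * C"
    proof (cases "0 \<le> ?a \<and> ?a \<le> 1")
      case True
      then have "\<bar>4 / e * t\<bar> * \<bar>deriv smooth_step ?a\<bar> \<le> 2 * C" by (intro mult_mono C) auto
      moreover have "t * (deriv smooth_step ?a * (4 / e)) = (4 / e * t) * deriv smooth_step ?a" by simp
      ultimately show ?thesis by (simp only: abs_mult)
    next
      case False
      then have "deriv smooth_step ?a = 0" by (intro deriv_smooth_step_0) auto
      then show ?thesis using C by simp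
    qed
    then show ?thesis using smooth_step_bounds[of ?a] unfolding deriv_recip_denom by linarith
  qed
  have "\<bar>deriv (smooth_recip e) t\<bar> \<le> (1 + 2 * C) * (2 / e)\<^sup>2" for t
  proof -
    have "(smooth_recip e t)\<^sup>2 \<le> (2 / e)\<^sup>2" using smooth_recip_bound[OF assms] by (intro power_mono)
    then show ?thesis unfolding deriv_smooth_recip[OF assms] abs_minus_cancel abs_mult
      using 1[of t] C by (intro mult_mono) auto
  qed
  then show ?thesis by (rule that)
qed

text \<open>
  Since \<open>1/(u + e)\<close> does not vanish where \<open>u = 0\<close>, the chain rule is applied to \<open>1/(u + e) - 1/e\<close>, and the
  multiple of \<open>\<phi>\<^sup>2\<close> that is missing is added as a test function.
\<close>

lemma D12_0_test_quotient:
  assumes D: "D12_0 U u g" "AE x in lebesgue. 0 \<le> u x" and p: "\<phi> \<in> C0_inf U" and e: "0 < e"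
  obtains k where "D12_0 U (\<lambda>x. (\<phi> x)\<^sup>2 * smooth_recip e (u x)) k"
    and "AE x in lebesgue. k x = (2 * (\<phi> x / (u x + e))) *\<^sub>R grad \<phi> x - (\<phi> x / (u x + e))\<^sup>2 *\<^sub>R g x"
proof -
  let ?H = "smooth_recip e" and ?p2 = "\<lambda>x. \<phi> x * \<phi> x"
  have H: "smooth ?H" by (rule smooth_smooth_recip[OF e])
  have sp: "smooth \<phi>" by (rule C0_inf_smooth[OF p])
  obtain C where C: "\<And>t. \<bar>deriv ?H t\<bar> \<le> C" using deriv_smooth_recip_bounded[OF e] by metis
  have H0: "smooth (\<lambda>t. ?H t - ?H 0)" by (intro smooth_diff H smooth_const)
  have dH0: "deriv (\<lambda>t. ?H t - ?H 0) t = deriv ?H t" for t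
    by (rule DERIV_imp_deriv) (auto intro!: derivative_eq_intros smooth_DERIV[OF H])
  have p2: "?p2 \<in> C0_inf U" by (rule C0_inf_mult[OF sp p])
  obtain B where B: "\<And>x. \<bar>?p2 x\<bar> \<le> B" "\<And>x. norm (grad ?p2 x) \<le> B" using C0_inf_bounded[OF p2] by metis
  have gp2: "grad ?p2 x = (2 * \<phi> x) *\<^sub>R grad \<phi> x" for x
    by (simp add: grad_mult[OF sp sp] scaleR_2[symmetric])
  have 1: "D12_0 U (\<lambda>x. ?H (u x) - ?H 0) (\<lambda>x. deriv ?H (u x) *\<^sub>R g x)"
    by (rule D12_0_compose[OF D(1) H0, unfolded dH0, OF _ C]) simp
  have 2: "D12_0 U (\<lambda>x. ?p2 x * (?H (u x) - ?H 0)) (\<lambda>x. ?p2 x *\<^sub>R (deriv ?H (u x) *\<^sub>R g x) + (?H (u x) - ?H 0) *\<^sub>R grad ?p2 x)"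
    by (rule D12_0_smooth_mult[OF 1 C0_inf_smooth[OF p2] B])
  have 3: "D12_0 U (\<lambda>x. ?H 0 * ?p2 x) (\<lambda>x. ?H 0 *\<^sub>R grad ?p2 x)"
    by (rule D12_0_cmult[OF D12_0_test[OF p2]])
  let ?k = "\<lambda>x. ?p2 x *\<^sub>R (deriv ?H (u x) *\<^sub>R g x) + ?H (u x) *\<^sub>R grad ?p2 x"
  have "D12_0 U (\<lambda>x. (\<phi> x)\<^sup>2 * ?H (u x)) ?k"
    using D12_0_add[OF 2 3] by (simp add: algebra_simps power2_eq_square)
  moreover have "AE x in lebesgue. ?k x = (2 * (\<phi> x / (u x + e))) *\<^sub>R grad \<phi> x - (\<phi> x / (u x + e))\<^sup>2 *\<^sub>R g x"
    using D(2)
  proof eventually_elim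
    case (elim x)
    show ?case unfolding smooth_recip_nonneg[OF e elim] gp2
      by (simp add: power_divide power2_eq_square)
  qed
  ultimately show ?thesis by (rule that)
qed

lemma norm_scaleR_sq: "(norm (c *\<^sub>R v))\<^sup>2 = c\<^sup>2 * (norm v)\<^sup>2"
  by (simp add: power_mult_distrib)

lemma lane_emden_test_identity:
  assumes L: "lane_emden_pair q U u g" and U: "open U" "bounded U" and q: "1 \<le> q" "q < 2"
    and p: "\<phi> \<in> C0_inf U" and e: "0 < e"
  shows "integrable lebesgue (\<lambda>x. u x powr (q - 1) * (\<phi> x)\<^sup>2 / (u x + e))"
    and "sq_integrable lebesgue (\<lambda>x. (\<phi> x / (u x + e)) *\<^sub>R g x)"
    and "(\<integral>x. u x powr (q - 1) * (\<phi> x)\<^sup>2 / (u x + e) \<partial>lebesgue) + sqnorm lebesgue (\<lambda>x. (\<phi> x / (u x + e)) *\<^sub>R g x)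
      = 2 * (\<integral>x. grad \<phi> x \<bullet> ((\<phi> x / (u x + e)) *\<^sub>R g x) \<partial>lebesgue)"
proof -
  note D = lane_emden_pairD[OF L]
  note sg = D12_0_sq_integrable(2)[OF D(1)]
  note m [measurable] = D12_0_measurable[OF D(1)]
  have pm [measurable]: "\<phi> \<in> borel_measurable lebesgue" "grad \<phi> \<in> borel_measurable lebesgue"
    using C0_inf_sq_integrable[OF p] by (auto dest: sq_integrableD)
  obtain k where k: "D12_0 U (\<lambda>x. (\<phi> x)\<^sup>2 * smooth_recip e (u x)) k"
    "AE x in lebesgue. k x = (2 * (\<phi> x / (u x + e))) *\<^sub>R grad \<phi> x - (\<phi> x / (u x + e))\<^sup>2 *\<^sub>R g x"
    by (rule D12_0_test_quotient[OF D p e])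
  obtain B where B: "0 \<le> B" "\<And>x. \<bar>\<phi> x\<bar> \<le> B" using C0_inf_bounded[OF p] by metis
  show i: "integrable lebesgue (\<lambda>x. u x powr (q - 1) * (\<phi> x)\<^sup>2 / (u x + e))"
  proof (rule integrable_cong_AE_imp[OF D12_0_powr_mult_integrable[OF D U q k(1)]])
    show "AE x in lebesgue. u x powr (q - 1) * ((\<phi> x)\<^sup>2 * smooth_recip e (u x)) = u x powr (q - 1) * (\<phi> x)\<^sup>2 / (u x + e)"
      using D(2) by eventually_elim (simp add: smooth_recip_nonneg e)
  qed measurable
  show s: "sq_integrable lebesgue (\<lambda>x. (\<phi> x / (u x + e)) *\<^sub>R g x)"
  proof (rule sq_integrable_bound)
    show "integrable lebesgue (\<lambda>x. (B / e)\<^sup>2 * (norm (g x))\<^sup>2)" using sq_integrableD(2)[OF sg] by simp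
    show "AE x in lebesgue. (norm ((\<phi> x / (u x + e)) *\<^sub>R g x))\<^sup>2 \<le> (B / e)\<^sup>2 * (norm (g x))\<^sup>2"
      using D(2)
    proof eventually_elim
      case (elim x)
      have "\<bar>\<phi> x / (u x + e)\<bar> \<le> B / e" using elim e B by (simp add: abs_divide frac_le)
      then have "(\<phi> x / (u x + e))\<^sup>2 \<le> (B / e)\<^sup>2" by (metis abs_ge_zero power2_abs power_mono)
      then show ?case unfolding norm_scaleR power_mult_distrib power2_abs by (intro mult_right_mono) auto
    qed
  qed measurable
  have ip: "integrable lebesgue (\<lambda>x. grad \<phi> x \<bullet> ((\<phi> x / (u x + e)) *\<^sub>R g x))"
    by (rule integrable_inner[OF C0_inf_sq_integrable(2)[OF p] s])
  note km [measurable] = D12_0_measurable[OF k(1)]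
  have "(\<integral>x. u x powr (q - 1) * (\<phi> x)\<^sup>2 / (u x + e) \<partial>lebesgue) = (\<integral>x. u x powr (q - 1) * ((\<phi> x)\<^sup>2 * smooth_recip e (u x)) \<partial>lebesgue)"
  proof (rule integral_cong_AE)
    show "AE x in lebesgue. u x powr (q - 1) * (\<phi> x)\<^sup>2 / (u x + e) = u x powr (q - 1) * ((\<phi> x)\<^sup>2 * smooth_recip e (u x))"
      using D(2) by eventually_elim (simp add: smooth_recip_nonneg e)
  qed measurable
  also have "\<dots> = (\<integral>x. g x \<bullet> k x \<partial>lebesgue)"
    by (rule Euler_Lagrange[OF L U q k(1), symmetric])
  also have "\<dots> = (\<integral>x. 2 * (grad \<phi> x \<bullet> ((\<phi> x / (u x + e)) *\<^sub>R g x)) - (norm ((\<phi> x / (u x + e)) *\<^sub>R g x))\<^sup>2 \<partial>lebesgue)"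
  proof (rule integral_cong_AE)
    show "AE x in lebesgue. g x \<bullet> k x = 2 * (grad \<phi> x \<bullet> ((\<phi> x / (u x + e)) *\<^sub>R g x)) - (norm ((\<phi> x / (u x + e)) *\<^sub>R g x))\<^sup>2"
      using k(2) by eventually_elim (simp add: inner_diff_right inner_commute norm_scaleR_sq dot_square_norm mult.assoc del: norm_scaleR)
  qed measurable
  also have "\<dots> = 2 * (\<integral>x. grad \<phi> x \<bullet> ((\<phi> x / (u x + e)) *\<^sub>R g x) \<partial>lebesgue) - sqnorm lebesgue (\<lambda>x. (\<phi> x / (u x + e)) *\<^sub>R g x)"
    by (simp only: Bochner_Integration.integral_diff[OF integrable_mult_right[OF ip] sq_integrableD(2)[OF s]] integral_mult_right_zero)
  finally show "(\<integral>x. u x powr (q - 1) * (\<phi> x)\<^sup>2 / (u x + e) \<partial>lebesgue) + sqnorm lebesgue (\<lambda>x. (\<phi> x / (u x + e)) *\<^sub>R g x)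
      = 2 * (\<integral>x. grad \<phi> x \<bullet> ((\<phi> x / (u x + e)) *\<^sub>R g x) \<partial>lebesgue)" by simp
qed

lemma tendsto_quotient_powr:
  fixes a :: "nat \<Rightarrow> real"
  assumes "a \<longlonglongrightarrow> t" "0 < t" "e \<longlonglongrightarrow> c" "0 \<le> c"
  shows "(\<lambda>n. a n powr r * s / (a n + e n)) \<longlonglongrightarrow> t powr r * s / (t + c)"
  using assms by (intro tendsto_divide tendsto_mult tendsto_powr tendsto_add tendsto_const) auto

text \<open>
  This is the case \<open>\<delta> = 1\<close> of the inequality.
\<close>

lemma lane_emden_test_bound:
  assumes L: "lane_emden_pair q U u g" and U: "open U" "bounded U" and q: "1 \<le> q" "q < 2"
    and p: "\<phi> \<in> C0_inf U" and e: "0 < e"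
  shows "(\<integral>x. u x powr (q - 1) * (\<phi> x)\<^sup>2 / (u x + e) \<partial>lebesgue) \<le> sqnorm lebesgue (grad \<phi>)"
proof -
  let ?X = "\<lambda>x. (\<phi> x / (u x + e)) *\<^sub>R g x"
  note I = lane_emden_test_identity[OF L U q p e]
  have "0 \<le> sqnorm lebesgue (\<lambda>x. grad \<phi> x + (-1) *\<^sub>R ?X x)" by simp
  then show ?thesis
    using I(3) unfolding integral_norm_add_sq[OF C0_inf_sq_integrable(2)[OF p] I(2)] by simp
qed

text \<open>
  The bound does not depend on the open set \<open>U\<close>; it keeps the minimizers away from 0 along the exhaustion.
\<close>

lemma lane_emden_negative_power_bound:
  assumes L: "lane_emden_pair q U u g" and U: "open U" "bounded U" and q: "1 \<le> q" "q < 2"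
    and p: "\<phi> \<in> C0_inf U"
  shows "(\<integral>\<^sup>+x. ennreal ((\<phi> x)\<^sup>2 * u x powr (q - 2)) \<partial>lebesgue) \<le> ennreal (sqnorm lebesgue (grad \<phi>))"
    and "AE x in lebesgue. \<phi> x \<noteq> 0 \<longrightarrow> 0 < u x"
proof -
  note D = lane_emden_pairD[OF L]
  note [measurable] = D12_0_measurable[OF D(1)]
  have [measurable]: "\<phi> \<in> borel_measurable lebesgue"
    using C0_inf_sq_integrable[OF p] by (auto dest: sq_integrableD)
  have "AE x in lebesgue. 0 < \<phi> x * \<phi> x \<longrightarrow> 0 < u x"
    by (rule lane_emden_pair_pos[OF L U q C0_inf_mult[OF C0_inf_smooth[OF p] p]]) simp
  then show pos: "AE x in lebesgue. \<phi> x \<noteq> 0 \<longrightarrow> 0 < u x"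
    by eventually_elim (auto simp: zero_less_mult_iff)
  define e where "e k = 1 / real (Suc k)" for k
  have e: "0 < e k" for k by (simp add: e_def)
  have e0: "e \<longlonglongrightarrow> 0" unfolding e_def by (rule LIMSEQ_Suc[OF lim_const_over_n])
  let ?A = "\<lambda>k x. u x powr (q - 1) * (\<phi> x)\<^sup>2 / (u x + e k)"
  have "(\<integral>\<^sup>+x. ennreal ((\<phi> x)\<^sup>2 * u x powr (q - 2)) \<partial>lebesgue) = (\<integral>\<^sup>+x. liminf (\<lambda>k. ennreal (?A k x)) \<partial>lebesgue)"
  proof (rule nn_integral_cong_AE)
    show "AE x in lebesgue. ennreal ((\<phi> x)\<^sup>2 * u x powr (q - 2)) = liminf (\<lambda>k. ennreal (?A k x))"
      using pos
    proof eventually_elim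
      case (elim x)
      show ?case
      proof (cases "\<phi> x = 0")
        case True
        then show ?thesis by (simp add: Liminf_const)
      next
        case False
        then have u: "0 < u x" using elim by simp
        have "(\<lambda>k. ?A k x) \<longlonglongrightarrow> u x powr (q - 1) * (\<phi> x)\<^sup>2 / (u x + 0)"
          by (rule tendsto_quotient_powr[OF tendsto_const u e0]) simp
        also have "u x powr (q - 1) * (\<phi> x)\<^sup>2 / (u x + 0) = (\<phi> x)\<^sup>2 * (u x powr (q - 1) / u x powr 1)"
          using u by simp
        also have "u x powr (q - 1) / u x powr 1 = u x powr (q - 2)" by (simp only: powr_diff[symmetric]) simp
        finally show ?thesis
          by (intro lim_imp_Liminf[OF trivial_limit_sequentially, symmetric] tendsto_ennrealI)
      qed
    qed
  qed
  also have "\<dots> \<le> liminf (\<lambda>k. \<integral>\<^sup>+x. ennreal (?A k x) \<partial>lebesgue)"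
    by (rule nn_integral_liminf) measurable
  also have "\<dots> \<le> ennreal (sqnorm lebesgue (grad \<phi>))"
  proof (rule Liminf_le)
    have "(\<integral>\<^sup>+x. ennreal (?A k x) \<partial>lebesgue) \<le> ennreal (sqnorm lebesgue (grad \<phi>))" for k
    proof -
      have "AE x in lebesgue. 0 \<le> ?A k x"
        using D(2)
      proof eventually_elim
        case (elim x)
        then have "0 < u x + e k" using e[of k] by simp
        then show ?case by simp
      qed
      then show ?thesis
        by (subst nn_integral_eq_integral[OF lane_emden_test_identity(1)[OF L U q p e]])
          (auto intro: ennreal_leI lane_emden_test_bound[OF L U q p e])
    qed
    then show "\<forall>\<^sub>F k in sequentially. (\<integral>\<^sup>+x. ennreal (?A k x) \<partial>lebesgue) \<le> ennreal (sqnorm lebesgue (grad \<phi>))"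
      by simp
  qed simp
  finally show "(\<integral>\<^sup>+x. ennreal ((\<phi> x)\<^sup>2 * u x powr (q - 2)) \<partial>lebesgue) \<le> ennreal (sqnorm lebesgue (grad \<phi>))" .
qed

section \<open>A slowly varying square integrable weight\<close>

text \<open>
  A polynomially decaying weight: the exponent makes it square integrable, and a small \<open>a\<close> makes the quotient
  \<open>|\<nabla>\<rho>|/\<rho>\<close> as small as required.
\<close>

definition weight :: "real \<Rightarrow> nat \<Rightarrow> 'a::euclidean_space \<Rightarrow> real" where
  "weight a m x = inverse (1 + a * (x \<bullet> x)) ^ m"

lemma weight_denom_pos: "0 \<le> a \<Longrightarrow> 0 < 1 + a * (x \<bullet> x)"
  by (simp add: add_pos_nonneg)

lemma smooth_weight:
  assumes "0 \<le> a"
  shows "smooth (weight a m :: 'a::euclidean_space \<Rightarrow> real)"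
proof -
  have nz: "1 + a * (x \<bullet> x) \<noteq> 0" for x :: 'a using weight_denom_pos[OF assms, of x] by linarith
  have "smooth (\<lambda>x::'a. 1 + a * (\<Sum>b\<in>Basis. (x \<bullet> b) * (x \<bullet> b)))"
    by (intro smooth_add smooth_mult smooth_const smooth_sum smooth_inner_const)
  then have "smooth (\<lambda>x::'a. 1 + a * (x \<bullet> x))" by (simp add: euclidean_inner[of _ _, symmetric])
  then show ?thesis unfolding weight_def[abs_def]
    by (intro smooth_power smooth_inverse nz)
qed

lemma weight_bounds: "0 \<le> a \<Longrightarrow> 0 < weight a m x" "0 \<le> a \<Longrightarrow> weight a m x \<le> 1"
  using weight_denom_pos[of a x] by (auto simp: weight_def inverse_le_1_iff intro!: power_le_one)

text \<open>
  The quotient is \<open>2am|x|/(1 + a|x|\<^sup>2)\<close>, and \<open>2\<surd>a|x| \<le> 1 + a|x|\<^sup>2\<close>.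
\<close>

lemma norm_grad_weight_le:
  assumes a: "0 < a"
  shows "norm (grad (weight a m) x) \<le> (m * sqrt a) * weight a m x"
proof (cases m)
  case 0
  then have "weight a m = (\<lambda>x::'a. 1)" by (simp add: weight_def fun_eq_iff)
  then show ?thesis using 0 by (simp add: grad_const)
next
  case (Suc k)
  define s where "s = 1 + a * (x \<bullet> x)"
  have s: "0 < s" using weight_denom_pos[of a x] a by (simp add: s_def)
  have "((\<lambda>x. inverse (1 + a * (x \<bullet> x)) ^ m) has_derivative
     (\<lambda>v. of_nat m * (- (inverse s * (a * (x \<bullet> v + v \<bullet> x)) * inverse s)) * inverse s ^ (m - 1))) (at x)"
    using s unfolding s_def by (auto intro!: derivative_eq_intros)
  also have "(\<lambda>v. of_nat m * (- (inverse s * (a * (x \<bullet> v + v \<bullet> x)) * inverse s)) * inverse s ^ (m - 1))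
     = (\<lambda>v. (- (2 * a * m * inverse s ^ (m + 1)) *\<^sub>R x) \<bullet> v)"
    by (rule ext) (simp add: Suc inner_commute mult_ac)
  finally have "grad (weight a m) x = - (2 * a * m * inverse s ^ (m + 1)) *\<^sub>R x"
    unfolding weight_def[abs_def] by (rule grad_eqI)
  then have "norm (grad (weight a m) x) = (m * weight a m x * inverse s) * (2 * a * norm x)"
    using a s by (simp add: weight_def s_def[symmetric] abs_mult mult_ac)
  also have "\<dots> \<le> (m * weight a m x * inverse s) * (sqrt a * s)"
  proof (rule mult_left_mono)
    have "2 * (sqrt a * norm x) \<le> 1 + (sqrt a * norm x)\<^sup>2"
      using sum_squares_bound[of 1 "sqrt a * norm x"] by simp
    also have "\<dots> = s" using a by (simp add: s_def power_mult_distrib dot_square_norm)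
    finally have "sqrt a * (2 * (sqrt a * norm x)) \<le> sqrt a * s" using a by (intro mult_left_mono) auto
    also have "sqrt a * (2 * (sqrt a * norm x)) = 2 * (sqrt a * sqrt a) * norm x" by (simp only: mult_ac)
    also have "sqrt a * sqrt a = a" using a by simp
    finally show "2 * a * norm x \<le> sqrt a * s" .
  qed (use s a weight_bounds(1)[of a m x] in auto)
  also have "\<dots> = (m * sqrt a) * weight a m x" using s by simp
  finally show ?thesis .
qed

lemma term_le_suminf: "f n \<le> (\<Sum>n. f n :: ennreal)"
  using sum_le_suminf[OF summableI, of "{n}" f] by simp

text \<open>
  On the shell \<open>n \<le> |x| < n + 1\<close> the square of the weight is at most a multiple of \<open>(n + 1)\<^sup>-\<^sup>4\<^sup>N\<close>, while the volume of the shell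
  is at most a multiple of \<open>(n + 1)\<^sup>N\<close>.
\<close>

lemma sq_integrable_weight:
  assumes a: "0 < a"
  shows "sq_integrable lebesgue (weight a DIM('a) :: 'a::euclidean_space \<Rightarrow> real)"
proof -
  let ?N = "DIM('a)" and ?w = "weight a DIM('a) :: 'a \<Rightarrow> real"
  have N: "1 \<le> ?N" by (simp add: DIM_positive Suc_leI)
  define \<kappa> where "\<kappa> = min 1 a / 2"
  have \<kappa>: "0 < \<kappa>" using a by (simp add: \<kappa>_def)
  define c where "c n = inverse (\<kappa> * (real (Suc n))\<^sup>2) ^ (2 * ?N)" for n
  have c0: "0 \<le> c n" for n using \<kappa> by (simp add: c_def)
  have wc: "(?w x)\<^sup>2 \<le> c n" if n: "real n \<le> norm x" for n x
  proof -
    have "(real (Suc n))\<^sup>2 \<le> 2 * (1 + (real n)\<^sup>2)" using sum_squares_bound[of "real n" 1] by (simp add: power2_sum)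
    then have "\<kappa> * (real (Suc n))\<^sup>2 \<le> \<kappa> * (2 * (1 + (real n)\<^sup>2))" using \<kappa> by (intro mult_left_mono) auto
    also have "\<dots> = min 1 a + min 1 a * (real n)\<^sup>2" by (simp add: \<kappa>_def distrib_left)
    also have "\<dots> \<le> 1 + a * (norm x)\<^sup>2"
      using n a by (intro add_mono mult_mono power_mono) auto
    finally have "\<kappa> * (real (Suc n))\<^sup>2 \<le> 1 + a * (x \<bullet> x)" by (simp add: dot_square_norm)
    then have "inverse (1 + a * (x \<bullet> x)) \<le> inverse (\<kappa> * (real (Suc n))\<^sup>2)"
      using \<kappa> by (intro le_imp_inverse_le) auto
    then have "inverse (1 + a * (x \<bullet> x)) ^ (2 * ?N) \<le> c n"
      unfolding c_def using weight_denom_pos[of a x] a by (intro power_mono) auto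
    then show ?thesis by (simp add: weight_def power_mult[symmetric] mult.commute)
  qed
  have wb: "?w \<in> borel_measurable borel"
    by (rule borel_measurable_continuous_onI[OF smooth_continuous[OF smooth_weight]]) (use a in simp)
  have "(\<integral>\<^sup>+x. ennreal ((?w x)\<^sup>2) \<partial>lborel) \<le> (\<integral>\<^sup>+x. (\<Sum>n. ennreal (c n) * indicator (ball (0::'a) (real (Suc n))) x) \<partial>lborel)"
  proof (rule nn_integral_mono)
    fix x :: 'a
    define n where "n = nat \<lfloor>norm x\<rfloor>"
    have n: "real n \<le> norm x" "norm x < real (Suc n)" unfolding n_def
      by (simp_all add: of_nat_floor) linarith
    have "ennreal ((?w x)\<^sup>2) \<le> ennreal (c n) * indicator (ball (0::'a) (real (Suc n))) x"
      using n wc[OF n(1)] by (simp add: ennreal_leI)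
    also have "\<dots> \<le> (\<Sum>n. ennreal (c n) * indicator (ball (0::'a) (real (Suc n))) x)"
      by (rule term_le_suminf)
    finally show "ennreal ((?w x)\<^sup>2) \<le> (\<Sum>n. ennreal (c n) * indicator (ball (0::'a) (real (Suc n))) x)" .
  qed
  also have "\<dots> = (\<Sum>n. \<integral>\<^sup>+x. ennreal (c n) * indicator (ball (0::'a) (real (Suc n))) x \<partial>lborel)"
    by (rule nn_integral_suminf)
      (intro borel_measurable_times_ennreal borel_measurable_const borel_measurable_indicator, simp)
  also have "\<dots> = (\<Sum>n. ennreal (c n * (unit_ball_vol (real ?N) * real (Suc n) ^ ?N)))"
  proof (intro arg_cong[where f=suminf] ext)
    fix n
    have "(\<integral>\<^sup>+x. ennreal (c n) * indicator (ball (0::'a) (real (Suc n))) x \<partial>lborel) = ennreal (c n) * emeasure lborel (ball (0::'a) (real (Suc n)))"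
      by (rule nn_integral_cmult_indicator) simp
    also have "\<dots> = ennreal (c n * (unit_ball_vol (real ?N) * real (Suc n) ^ ?N))"
      by (subst emeasure_ball) (simp_all add: ennreal_mult[symmetric] c0)
    finally show "(\<integral>\<^sup>+x. ennreal (c n) * indicator (ball (0::'a) (real (Suc n))) x \<partial>lborel) = ennreal (c n * (unit_ball_vol (real ?N) * real (Suc n) ^ ?N))" .
  qed
  also have "\<dots> \<le> (\<Sum>n. ennreal (inverse \<kappa> ^ (2 * ?N) * unit_ball_vol (real ?N) * inverse ((real (Suc n))\<^sup>2)))"
  proof (intro suminf_le ennreal_leI)
    fix n
    let ?r = "real (Suc n)"
    have "c n * ?r ^ ?N = inverse \<kappa> ^ (2 * ?N) * (inverse ?r ^ (4 * ?N) * ?r ^ ?N)"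
      unfolding c_def by (simp add: power_mult_distrib power_inverse inverse_mult_distrib flip: power_mult)
    also have "inverse ?r ^ (4 * ?N) * ?r ^ ?N = inverse ?r ^ (3 * ?N)"
    proof -
      have "4 * ?N = 3 * ?N + ?N" by simp
      then have "inverse ?r ^ (4 * ?N) = inverse ?r ^ (3 * ?N) * inverse ?r ^ ?N" by (simp only: power_add)
      then show ?thesis by (simp add: power_mult_distrib[symmetric] mult.assoc del: power_inverse of_nat_Suc)
    qed
    also have "inverse \<kappa> ^ (2 * ?N) * inverse ?r ^ (3 * ?N) \<le> inverse \<kappa> ^ (2 * ?N) * inverse ?r ^ 2"
    proof (intro mult_left_mono power_decreasing)
      show "2 \<le> 3 * ?N" using N by linarith
      show "inverse ?r \<le> 1" by (simp add: field_simps)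
    qed (use \<kappa> in simp_all)
    finally have "c n * ?r ^ ?N \<le> inverse \<kappa> ^ (2 * ?N) * inverse (?r\<^sup>2)" by (simp add: power_inverse)
    then have "unit_ball_vol (real ?N) * (c n * ?r ^ ?N) \<le> unit_ball_vol (real ?N) * (inverse \<kappa> ^ (2 * ?N) * inverse (?r\<^sup>2))"
      by (intro mult_left_mono) (auto intro: unit_ball_vol_nonneg)
    then show "c n * (unit_ball_vol (real ?N) * ?r ^ ?N) \<le> inverse \<kappa> ^ (2 * ?N) * unit_ball_vol (real ?N) * inverse (?r\<^sup>2)"
      by (simp add: mult_ac del: of_nat_Suc)
  qed auto
  also have "\<dots> < \<infinity>"
  proof -
    have s: "summable (\<lambda>n. inverse ((real (Suc n))\<^sup>2))"
      using inverse_power_summable[of 2, where 'a=real] by (subst summable_Suc_iff) simp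
    have "summable (\<lambda>n. inverse \<kappa> ^ (2 * ?N) * unit_ball_vol (real ?N) * inverse ((real (Suc n))\<^sup>2))"
      by (rule summable_mult[OF s])
    then show ?thesis using \<kappa> by (subst suminf_ennreal2) auto
  qed
  finally have fin: "(\<integral>\<^sup>+x. ennreal ((?w x)\<^sup>2) \<partial>lborel) < \<infinity>" .
  have "integrable lborel (\<lambda>x. (?w x)\<^sup>2)"
    by (rule integrableI_bounded) (use fin wb in auto)
  moreover have "(\<lambda>x. (?w x)\<^sup>2) \<in> borel_measurable lborel" using wb by measurable
  ultimately have "integrable lebesgue (\<lambda>x. (?w x)\<^sup>2)" by (simp add: integrable_completion)
  then show ?thesis
    using wb by (auto simp: sq_integrable_def intro!: measurable_completion)
qed

section \<open>Passing to the limit along the exhaustion\<close>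

text \<open>
  The situation after the weighted estimates: minimizers on bounded open sets that exhaust \<open>\<Omega>\<close>, bounded in weighted \<open>L\<^sup>2\<close>, and
  converging almost everywhere to \<open>w\<close>, which may be infinite at this stage.
\<close>

locale lane_emden_exhaustion =
  fixes q :: real and \<Omega> :: "'a::euclidean_space set" and U :: "nat \<Rightarrow> 'a set"
    and u :: "nat \<Rightarrow> 'a \<Rightarrow> real" and g :: "nat \<Rightarrow> 'a \<Rightarrow> 'a" and \<rho> :: "'a \<Rightarrow> real" and M :: real
    and w :: "'a \<Rightarrow> ennreal"
  assumes q: "1 \<le> q" "q < 2" and open_Omega: "open \<Omega>"
    and pair: "\<And>n. lane_emden_pair q (U n) (u n) (g n)"
    and U: "\<And>n. open (U n)" "\<And>n. bounded (U n)" "\<And>n. U n \<subseteq> \<Omega>"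
    and exhaust: "\<And>K. compact K \<Longrightarrow> K \<subseteq> \<Omega> \<Longrightarrow> \<forall>\<^sub>F n in sequentially. K \<subseteq> U n"
    and rho: "smooth \<rho>" "\<And>x. 0 < \<rho> x" "\<And>x. \<rho> x \<le> 1"
    and bound: "\<And>n. sqnorm lebesgue (\<lambda>x. \<rho> x * u n x) \<le> M"
      "\<And>n. sqnorm lebesgue (\<lambda>x. \<rho> x *\<^sub>R g n x) \<le> M"
    and conv: "AE x in lebesgue. x \<in> \<Omega> \<longrightarrow> (\<lambda>n. ennreal (u n x)) \<longlonglongrightarrow> w x"
begin

text \<open>
  The last clause is weak convergence of \<open>\<rho>\<nabla>u\<^sub>n\<close> to \<open>\<rho>G\<close> reduced to what convex combinations give: lower
  bounds that hold eventually along the sequence pass to the limit.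
\<close>

definition weak_limit :: "('a \<Rightarrow> real) \<Rightarrow> ('a \<Rightarrow> 'a) \<Rightarrow> bool" where
  "weak_limit v G \<longleftrightarrow> sq_integrable lebesgue (\<lambda>x. \<rho> x * v x) \<and> sq_integrable lebesgue (\<lambda>x. \<rho> x *\<^sub>R G x) \<and>
     (AE x in lebesgue. x \<in> \<Omega> \<longrightarrow> 0 \<le> v x \<and> w x = ennreal (v x) \<and> (\<lambda>n. u n x) \<longlonglongrightarrow> v x) \<and>
     (\<forall>\<psi>\<in>C0_inf \<Omega>. \<forall>b. (\<integral>x. v x * (grad \<psi> x \<bullet> b) \<partial>lebesgue) + (\<integral>x. G x \<bullet> (\<psi> x *\<^sub>R b) \<partial>lebesgue) = 0) \<and>
     (\<forall>Y \<alpha>. sq_integrable lebesgue Y \<and> (\<forall>\<^sub>F n in sequentially. \<alpha> \<le> (\<integral>x. (\<rho> x *\<^sub>R g n x) \<bullet> Y x \<partial>lebesgue)) \<longrightarrow>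
        \<alpha> \<le> (\<integral>x. (\<rho> x *\<^sub>R G x) \<bullet> Y x \<partial>lebesgue))"

lemma u_D12_0: "D12_0 (U n) (u n) (g n)" and nonneg: "AE x in lebesgue. 0 \<le> u n x"
  using lane_emden_pairD[OF pair] by auto

lemma rho_measurable: "\<rho> \<in> borel_measurable lebesgue"
  by (rule lebesgue_measurable_continuous[OF smooth_continuous[OF rho(1)]])

lemma sq_rho_u: "sq_integrable lebesgue (\<lambda>x. \<rho> x * u n x)"
  and sq_rho_g: "sq_integrable lebesgue (\<lambda>x. \<rho> x *\<^sub>R g n x)"
proof -
  have b: "\<bar>\<rho> x\<bar> \<le> 1" for x using rho(2,3)[of x] by simp
  show "sq_integrable lebesgue (\<lambda>x. \<rho> x * u n x)"
    using sq_integrable_bounded_scaleR[OF D12_0_sq_integrable(1)[OF u_D12_0] rho_measurable b] by simp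
  show "sq_integrable lebesgue (\<lambda>x. \<rho> x *\<^sub>R g n x)"
    by (rule sq_integrable_bounded_scaleR[OF D12_0_sq_integrable(2)[OF u_D12_0] rho_measurable b])
qed

lemma all_nonneg: "AE x in lebesgue. \<forall>n. 0 \<le> u n x"
  using nonneg by (simp add: AE_all_countable)

lemma continuous_div_rho: "continuous_on UNIV f \<Longrightarrow> continuous_on UNIV (\<lambda>x. f x / \<rho> x)" for f :: "'a \<Rightarrow> real"
  using rho(2) by (intro continuous_on_divide[OF _ smooth_continuous[OF rho(1)]]) (auto simp: less_imp_neq[THEN not_sym])

text \<open>
  The convex combinations are taken of functions and gradients simultaneously, with values in \<open>\<real> \<times> \<real>\<^sup>N\<close>. Point values,
  the integration by parts formula and weak convergence all speak of linear functionals that have a common bound, or a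
  common value, on the tail of the sequence, and such bounds are inherited by the convex combinations.
\<close>

lemma exists_limit: "\<exists>v G. weak_limit v G"
proof -
  define F where "F n x = (\<rho> x * u n x, \<rho> x *\<^sub>R g n x)" for n x
  have Fs: "sq_integrable lebesgue (F n)" for n
    unfolding F_def by (rule sq_integrable_Pair(1)[OF sq_rho_u sq_rho_g])
  have Fb: "sqnorm lebesgue (F n) \<le> 2 * M" for n
    unfolding F_def sq_integrable_Pair(2)[OF sq_rho_u sq_rho_g] using bound[of n] by linarith
  obtain H L where H: "\<And>n. H n \<in> tail_hull F n" and L: "L2_tendsto lebesgue H L"
    using bounded_L2_convex_combinations[where f=F, OF Fs Fb] by blast
  define v where "v x = fst (L x) / \<rho> x" for x
  define G where "G x = (1 / \<rho> x) *\<^sub>R snd (L x)" for x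
  have rv: "\<rho> x * v x = fst (L x)" and rG: "\<rho> x *\<^sub>R G x = snd (L x)" for x
    using rho(2)[of x] by (simp_all add: v_def G_def)
  note Ls = L2_tendstoD(2)[OF L]
  have "weak_limit v G" unfolding weak_limit_def
  proof (intro conjI ballI allI impI)
    show "sq_integrable lebesgue (\<lambda>x. \<rho> x * v x)" "sq_integrable lebesgue (\<lambda>x. \<rho> x *\<^sub>R G x)"
      unfolding rv rG by (rule sq_integrable_fst_snd[OF Ls])+
    obtain r where r: "strict_mono r" "AE x in lebesgue. (\<lambda>n. H (r n) x) \<longlonglongrightarrow> L x"
      using L2_tendsto_AE_subseq[OF L] by metis
    show "AE x in lebesgue. x \<in> \<Omega> \<longrightarrow> 0 \<le> v x \<and> w x = ennreal (v x) \<and> (\<lambda>n. u n x) \<longlonglongrightarrow> v x"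
      using r(2) conv all_nonneg
    proof eventually_elim
      case (elim x)
      show ?case
      proof
        assume x: "x \<in> \<Omega>"
        have Hr: "(\<lambda>n. fst (H (r n) x)) \<longlonglongrightarrow> fst (L x)" by (intro tendsto_fst elim)
        have wx: "(\<lambda>n. ennreal (u n x)) \<longlonglongrightarrow> w x" using elim x by simp
        have lin: "s * fst (\<Sum>i\<le>N. c i *\<^sub>R F i x) = (\<Sum>i\<le>N. c i * (s * fst (F i x)))" for c N s
          by (simp add: fst_sum sum_distrib_left mult_ac)
        have ge: "a \<le> s * fst (L x)" if "\<forall>\<^sub>F i in sequentially. a \<le> s * (\<rho> x * u i x)" for a s
        proof -
          have "\<forall>\<^sub>F n in sequentially. a \<le> s * fst (H n x)"
            by (rule tail_hull_functional_eventually_ge[OF H, where \<Phi>="\<lambda>f. s * fst (f x)", OF lin])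
              (use that in \<open>simp add: F_def\<close>)
          then have "\<forall>\<^sub>F n in sequentially. a \<le> s * fst (H (r n) x)"
            by (rule eventually_subseq[OF r(1)])
          then show ?thesis
            by (intro tendsto_lowerbound[OF tendsto_mult[OF tendsto_const Hr]]) auto
        qed
        \<comment> \<open>If \<open>u\<^sub>n(x)\<close> tended to infinity, then so would its convex combinations, but these converge.\<close>
        have "w x \<noteq> \<infinity>"
        proof
          assume "w x = \<infinity>"
          define B where "B = (\<bar>fst (L x)\<bar> + 1) / \<rho> x"
          have B: "0 \<le> B" "\<rho> x * B = \<bar>fst (L x)\<bar> + 1" using rho(2)[of x] by (auto simp: B_def)
          have "\<forall>\<^sub>F i in sequentially. ennreal B < ennreal (u i x)"
            by (rule order_tendstoD(1)[OF wx]) (simp add: \<open>w x = \<infinity>\<close>)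
          then have "\<forall>\<^sub>F i in sequentially. \<rho> x * B \<le> 1 * (\<rho> x * u i x)"
          proof eventually_elim
            case (elim i)
            then have "B \<le> u i x" using B(1) by (metis ennreal_less_iff less_imp_le)
            then show ?case using rho(2)[of x] by (simp add: mult_left_mono)
          qed
          from ge[OF this] show False using B(2) by simp
        qed
        then obtain t where t: "w x = ennreal t" "0 \<le> t" by (cases "w x") auto
        have ut: "(\<lambda>n. u n x) \<longlonglongrightarrow> t"
          using wx t elim(3) by (simp add: tendsto_ennreal_iff)
        then have lim: "(\<lambda>n. s * (\<rho> x * u n x)) \<longlonglongrightarrow> s * (\<rho> x * t)" for s by (intro tendsto_intros)
        have le: "s * (\<rho> x * t) \<le> s * fst (L x)" for s
        proof (rule field_le_epsilon)
          fix e :: real assume "0 < e"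
          then have "\<forall>\<^sub>F i in sequentially. s * (\<rho> x * t) - e < s * (\<rho> x * u i x)"
            by (intro order_tendstoD(1)[OF lim]) simp
          then have "\<forall>\<^sub>F i in sequentially. s * (\<rho> x * t) - e \<le> s * (\<rho> x * u i x)"
            by (rule eventually_mono) simp
          from ge[OF this] show "s * (\<rho> x * t) \<le> s * fst (L x) + e" by simp
        qed
        have "\<rho> x * t = fst (L x)" using le[of 1] le[of "-1"] by simp
        then have "v x = t" using rho(2)[of x] by (simp add: v_def field_simps)
        with t ut show "0 \<le> v x \<and> w x = ennreal (v x) \<and> (\<lambda>n. u n x) \<longlonglongrightarrow> v x" by simp
      qed
    qed
  next
    fix \<psi> b assume p: "\<psi> \<in> C0_inf \<Omega>"
    obtain K where K: "compact K" "\<And>x. x \<notin> K \<Longrightarrow> \<psi> x = 0" "\<And>x. x \<notin> K \<Longrightarrow> grad \<psi> x = 0"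
      using C0_inf_support[OF p] by metis
    have sp: "smooth \<psi>" by (rule C0_inf_smooth[OF p])
    define Y where "Y x = ((grad \<psi> x \<bullet> b) / \<rho> x, (\<psi> x / \<rho> x) *\<^sub>R b)" for x
    have "sq_integrable lebesgue (\<lambda>x. (grad \<psi> x \<bullet> b) / \<rho> x)"
      by (rule sq_integrable_continuous_compact_support[OF continuous_div_rho K(1)])
        (auto intro!: continuous_intros grad_continuous sp simp: K(3))
    moreover have "sq_integrable lebesgue (\<lambda>x. (\<psi> x / \<rho> x) *\<^sub>R b)"
      by (rule sq_integrable_continuous_compact_support[OF continuous_on_scaleR[OF continuous_div_rho continuous_on_const] K(1)])
        (auto intro!: smooth_continuous sp simp: K(2))
    ultimately have Ys: "sq_integrable lebesgue Y" unfolding Y_def by (rule sq_integrable_Pair(1))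
    have pb1: "sq_integrable lebesgue (\<lambda>x. grad \<psi> x \<bullet> b)"
      by (rule sq_integrable_continuous_compact_support[OF _ K(1)])
        (auto intro!: continuous_intros grad_continuous sp simp: K(3))
    have pb2: "sq_integrable lebesgue (\<lambda>x. \<psi> x *\<^sub>R b)"
      by (rule sq_integrable_continuous_compact_support[OF _ K(1)])
        (auto intro!: continuous_intros smooth_continuous sp simp: K(2))
    have F0: "(\<integral>x. F i x \<bullet> Y x \<partial>lebesgue) = 0" for i
    proof -
      have "F i x \<bullet> Y x = u i x * (grad \<psi> x \<bullet> b) + g i x \<bullet> (\<psi> x *\<^sub>R b)" for x
        using rho(2)[of x] by (simp add: F_def Y_def)
      then have "(\<integral>x. F i x \<bullet> Y x \<partial>lebesgue) = (\<integral>x. u i x * (grad \<psi> x \<bullet> b) + g i x \<bullet> (\<psi> x *\<^sub>R b) \<partial>lebesgue)"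
        by simp
      also have "\<dots> = (\<integral>x. u i x * (grad \<psi> x \<bullet> b) \<partial>lebesgue) + (\<integral>x. g i x \<bullet> (\<psi> x *\<^sub>R b) \<partial>lebesgue)"
        using integrable_inner[OF D12_0_sq_integrable(1)[OF u_D12_0] pb1] integrable_inner[OF D12_0_sq_integrable(2)[OF u_D12_0] pb2]
        by (intro Bochner_Integration.integral_add) simp_all
      also have "\<dots> = 0" by (rule D12_0_integration_by_parts[OF u_D12_0 p])
      finally show ?thesis .
    qed
    have "(\<integral>x. H n x \<bullet> Y x \<partial>lebesgue) = 0" for n
    proof -
      have lin: "s * (\<integral>x. (\<Sum>i\<le>N. c i *\<^sub>R F i x) \<bullet> Y x \<partial>lebesgue) = (\<Sum>i\<le>N. c i * (s * (\<integral>x. F i x \<bullet> Y x \<partial>lebesgue)))" for c N s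
        unfolding inner_functional_linear[OF Fs Ys] by (simp add: F0)
      have "0 \<le> s * (\<integral>x. H n x \<bullet> Y x \<partial>lebesgue)" for s
        by (rule tail_hull_functional_ge[OF H, where \<Phi>="\<lambda>f. s * (\<integral>x. f x \<bullet> Y x \<partial>lebesgue)", OF lin]) (simp add: F0)
      from this[of 1] this[of "-1"] show ?thesis by simp
    qed
    with L2_tendsto_inner_left[OF L Ys] have 0: "(\<integral>x. L x \<bullet> Y x \<partial>lebesgue) = 0" by (simp add: LIMSEQ_const_iff)
    have eq: "L x \<bullet> Y x = v x * (grad \<psi> x \<bullet> b) + G x \<bullet> (\<psi> x *\<^sub>R b)" for x
      by (simp add: Y_def inner_prod_def v_def G_def)
    have i1: "integrable lebesgue (\<lambda>x. v x * (grad \<psi> x \<bullet> b))"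
      using integrable_inner[OF sq_integrable_fst_snd(1)[OF Ls] sq_integrable_fst_snd(1)[OF Ys]] by (simp add: Y_def v_def)
    have i2: "integrable lebesgue (\<lambda>x. G x \<bullet> (\<psi> x *\<^sub>R b))"
      using integrable_inner[OF sq_integrable_fst_snd(2)[OF Ls] sq_integrable_fst_snd(2)[OF Ys]] by (simp add: Y_def G_def)
    show "(\<integral>x. v x * (grad \<psi> x \<bullet> b) \<partial>lebesgue) + (\<integral>x. G x \<bullet> (\<psi> x *\<^sub>R b) \<partial>lebesgue) = 0"
      using 0 unfolding eq Bochner_Integration.integral_add[OF i1 i2] .
  next
    fix Y :: "'a \<Rightarrow> 'a" and \<alpha> :: real
    assume "sq_integrable lebesgue Y \<and> (\<forall>\<^sub>F n in sequentially. \<alpha> \<le> (\<integral>x. (\<rho> x *\<^sub>R g n x) \<bullet> Y x \<partial>lebesgue))"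
    then have Y: "sq_integrable lebesgue Y" and ev: "\<forall>\<^sub>F n in sequentially. \<alpha> \<le> (\<integral>x. (\<rho> x *\<^sub>R g n x) \<bullet> Y x \<partial>lebesgue)" by auto
    define Z :: "'a \<Rightarrow> real \<times> 'a" where "Z x = (0, Y x)" for x
    have Z: "sq_integrable lebesgue Z" unfolding Z_def by (rule sq_integrable_Pair(1)[OF sq_integrable_zero Y])
    have "\<forall>\<^sub>F n in sequentially. \<alpha> \<le> (\<integral>x. H n x \<bullet> Z x \<partial>lebesgue)"
      by (rule tail_hull_functional_eventually_ge[OF H, where \<Phi>="\<lambda>f. \<integral>x. f x \<bullet> Z x \<partial>lebesgue", OF inner_functional_linear[OF Fs Z]])
        (use ev in \<open>simp add: F_def Z_def\<close>)
    then have "\<alpha> \<le> (\<integral>x. L x \<bullet> Z x \<partial>lebesgue)"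
      by (intro tendsto_lowerbound[OF L2_tendsto_inner_left[OF L Z]]) auto
    then show "\<alpha> \<le> (\<integral>x. (\<rho> x *\<^sub>R G x) \<bullet> Y x \<partial>lebesgue)"
      unfolding rG by (simp add: Z_def inner_prod_def)
  qed
  then show ?thesis by blast
qed

lemma limit_measurable:
  assumes "weak_limit v G"
  shows "v \<in> borel_measurable lebesgue" "G \<in> borel_measurable lebesgue"
proof -
  have m: "(\<lambda>x. \<rho> x * v x) \<in> borel_measurable lebesgue" "(\<lambda>x. \<rho> x *\<^sub>R G x) \<in> borel_measurable lebesgue"
    using assms by (auto simp: weak_limit_def sq_integrable_def)
  have "v = (\<lambda>x. (\<rho> x * v x) / \<rho> x)" "G = (\<lambda>x. (1 / \<rho> x) *\<^sub>R (\<rho> x *\<^sub>R G x))"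
    using rho(2) by (auto simp: fun_eq_iff less_imp_neq[THEN not_sym])
  moreover have "(\<lambda>x. (\<rho> x * v x) / \<rho> x) \<in> borel_measurable lebesgue"
    "(\<lambda>x. (1 / \<rho> x) *\<^sub>R (\<rho> x *\<^sub>R G x)) \<in> borel_measurable lebesgue"
    using m rho_measurable by measurable
  ultimately show "v \<in> borel_measurable lebesgue" "G \<in> borel_measurable lebesgue" by simp_all
qed

text \<open>
  Both \<open>G\<close> and \<open>gw\<close> satisfy the integration by parts formula for \<open>w\<close>, so their difference is orthogonal to
  all test functions.
\<close>

lemma limit_gradient_unique:
  assumes L: "weak_limit v G" and dg: "has_distributional_gradient \<Omega> (\<lambda>x. enn2real (w x)) gw"
  shows "AE x in lebesgue. x \<in> \<Omega> \<longrightarrow> gw x = G x"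
proof -
  note m = limit_measurable[OF L]
  have Ls: "sq_integrable lebesgue (\<lambda>x. \<rho> x *\<^sub>R G x)"
    and La: "AE x in lebesgue. x \<in> \<Omega> \<longrightarrow> 0 \<le> v x \<and> w x = ennreal (v x) \<and> (\<lambda>n. u n x) \<longlonglongrightarrow> v x"
    and Lp: "\<And>\<psi> b. \<psi> \<in> C0_inf \<Omega> \<Longrightarrow> (\<integral>x. v x * (grad \<psi> x \<bullet> b) \<partial>lebesgue) + (\<integral>x. G x \<bullet> (\<psi> x *\<^sub>R b) \<partial>lebesgue) = 0"
    using L unfolding weak_limit_def by blast+
  have dgK: "set_integrable lebesgue K (\<lambda>x. enn2real (w x))" "set_integrable lebesgue K gw" if "compact K" "K \<subseteq> \<Omega>" for K
    using dg that unfolding has_distributional_gradient_def by blast+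
  have comp: "AE x in lebesgue. x \<in> \<Omega> \<longrightarrow> (G x - gw x) \<bullet> b = 0" for b
  proof (rule fundamental_lemma[OF open_Omega])
    fix K :: "'a set" assume K: "compact K" "K \<subseteq> \<Omega>"
    have Km: "K \<in> sets lebesgue" by (rule fmeasurableD[OF lmeasurable_compact[OF K(1)]])
    have "K \<noteq> {} \<Longrightarrow> \<exists>x\<in>K. \<forall>y\<in>K. \<rho> x \<le> \<rho> y"
      using continuous_attains_inf[OF K(1), of \<rho>] continuous_on_subset[OF smooth_continuous[OF rho(1)]] by blast
    then obtain c where c: "0 < c" "\<And>x. x \<in> K \<Longrightarrow> c \<le> \<rho> x"
      by (cases "K = {}") (auto intro: rho(2) zero_less_one)
    have "sq_integrable lebesgue (\<lambda>x. indicat_real K x *\<^sub>R b)"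
      unfolding sq_integrable_def
    proof
      have "integrable lebesgue (indicat_real K)"
        using K bounded_set_imp_lmeasurable[OF compact_imp_bounded Km] lmeasurable_iff_integrable by blast
      then have "integrable lebesgue (\<lambda>x. indicat_real K x * (norm b)\<^sup>2)" by simp
      moreover have "(\<lambda>x. (norm (indicat_real K x *\<^sub>R b))\<^sup>2) = (\<lambda>x. indicat_real K x * (norm b)\<^sup>2)"
        by (auto simp: fun_eq_iff indicator_def)
      ultimately show "integrable lebesgue (\<lambda>x. (norm (indicat_real K x *\<^sub>R b))\<^sup>2)" by (simp only:)
    qed (use Km in measurable)
    then have i: "integrable lebesgue (\<lambda>x. (\<rho> x *\<^sub>R G x) \<bullet> (indicat_real K x *\<^sub>R b))"
      by (rule integrable_inner[OF Ls])
    have "integrable lebesgue (\<lambda>x. indicat_real K x *\<^sub>R (G x \<bullet> b))"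
    proof (rule Bochner_Integration.integrable_bound)
      show "integrable lebesgue (\<lambda>x. (1 / c) * ((\<rho> x *\<^sub>R G x) \<bullet> (indicat_real K x *\<^sub>R b)))"
        using i by (rule integrable_mult_right)
      show "(\<lambda>x. indicat_real K x *\<^sub>R (G x \<bullet> b)) \<in> borel_measurable lebesgue" using m Km by measurable
      show "AE x in lebesgue. norm (indicat_real K x *\<^sub>R (G x \<bullet> b)) \<le> norm ((1 / c) * ((\<rho> x *\<^sub>R G x) \<bullet> (indicat_real K x *\<^sub>R b)))"
      proof (rule AE_I2)
        fix x
        have "\<bar>G x \<bullet> b\<bar> \<le> \<bar>(1 / c) * (\<rho> x * (G x \<bullet> b))\<bar>" if "x \<in> K"
        proof -
          have "1 * \<bar>G x \<bullet> b\<bar> \<le> (\<rho> x / c) * \<bar>G x \<bullet> b\<bar>"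
            using c(1) c(2)[OF that] by (intro mult_right_mono) auto
          then show ?thesis using c(1) rho(2)[of x] by (simp add: abs_mult)
        qed
        then show "norm (indicat_real K x *\<^sub>R (G x \<bullet> b)) \<le> norm ((1 / c) * ((\<rho> x *\<^sub>R G x) \<bullet> (indicat_real K x *\<^sub>R b)))"
          by (simp add: indicator_def)
      qed
    qed
    moreover have "integrable lebesgue (\<lambda>x. (indicat_real K x *\<^sub>R gw x) \<bullet> b)"
      using dgK(2)[OF K] unfolding set_integrable_def by (rule integrable_inner_left)
    ultimately have "integrable lebesgue (\<lambda>x. indicat_real K x *\<^sub>R (G x \<bullet> b) - (indicat_real K x *\<^sub>R gw x) \<bullet> b)"
      by (rule Bochner_Integration.integrable_diff)
    then show "set_integrable lebesgue K (\<lambda>x. (G x - gw x) \<bullet> b)"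
      unfolding set_integrable_def by (simp add: inner_diff_left right_diff_distrib)
  next
    fix \<psi> assume p: "\<psi> \<in> C0_inf \<Omega>"
    obtain K where K: "compact K" "K \<subseteq> \<Omega>" "\<And>x. x \<notin> K \<Longrightarrow> \<psi> x = 0" "\<And>x. x \<notin> K \<Longrightarrow> grad \<psi> x = 0"
      using C0_inf_support[OF p] by metis
    have pm: "\<psi> \<in> borel_measurable lebesgue" "grad \<psi> \<in> borel_measurable lebesgue"
      using C0_inf_sq_integrable[OF p] by (auto dest: sq_integrableD)
    obtain C where C: "\<And>x. \<bar>\<psi> x\<bar> \<le> C" "\<And>x. norm (grad \<psi> x) \<le> C" using C0_inf_bounded[OF p] by metis
    note iw = dgK(1)[OF K(1,2), unfolded set_integrable_def] and ig = dgK(2)[OF K(1,2), unfolded set_integrable_def]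
    have e1: "indicat_real \<Omega> x *\<^sub>R (enn2real (w x) *\<^sub>R grad \<psi> x) = (indicat_real K x *\<^sub>R enn2real (w x)) *\<^sub>R grad \<psi> x" for x
      using K(2) K(4)[of x] by (auto simp: indicator_def)
    have e2: "indicat_real \<Omega> x *\<^sub>R (\<psi> x *\<^sub>R gw x) = \<psi> x *\<^sub>R (indicat_real K x *\<^sub>R gw x)" for x
      using K(2) K(3)[of x] by (auto simp: indicator_def)
    have i1: "integrable lebesgue (\<lambda>x. (indicat_real K x *\<^sub>R enn2real (w x)) *\<^sub>R grad \<psi> x)"
    proof (rule Bochner_Integration.integrable_bound)
      show "integrable lebesgue (\<lambda>x. C * (indicat_real K x *\<^sub>R enn2real (w x)))" by (rule integrable_mult_right[OF iw])
      show "(\<lambda>x. (indicat_real K x *\<^sub>R enn2real (w x)) *\<^sub>R grad \<psi> x) \<in> borel_measurable lebesgue"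
        using borel_measurable_integrable[OF iw] pm(2) by (rule borel_measurable_scaleR)
      have "\<bar>t\<bar> * norm (grad \<psi> x) \<le> \<bar>C\<bar> * \<bar>t\<bar>" for t x
        using mult_left_mono[OF C(2)[of x], of "\<bar>t\<bar>"] mult_right_mono[OF abs_ge_self[of C], of "\<bar>t\<bar>"] by (simp add: mult.commute)
      then show "AE x in lebesgue. norm ((indicat_real K x *\<^sub>R enn2real (w x)) *\<^sub>R grad \<psi> x) \<le> norm (C * (indicat_real K x *\<^sub>R enn2real (w x)))"
        unfolding norm_scaleR real_norm_def abs_mult by (intro AE_I2) blast
    qed
    have i2: "integrable lebesgue (\<lambda>x. \<psi> x *\<^sub>R (indicat_real K x *\<^sub>R gw x))"
    proof (rule Bochner_Integration.integrable_bound)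
      show "integrable lebesgue (\<lambda>x. C *\<^sub>R (indicat_real K x *\<^sub>R gw x))" by (rule integrable_scaleR_right[OF ig])
      show "(\<lambda>x. \<psi> x *\<^sub>R (indicat_real K x *\<^sub>R gw x)) \<in> borel_measurable lebesgue"
        using pm(1) borel_measurable_integrable[OF ig] by (rule borel_measurable_scaleR)
      have "\<bar>\<psi> x\<bar> \<le> \<bar>C\<bar>" for x using C(1)[of x] by linarith
      then show "AE x in lebesgue. norm (\<psi> x *\<^sub>R (indicat_real K x *\<^sub>R gw x)) \<le> norm (C *\<^sub>R (indicat_real K x *\<^sub>R gw x))"
        unfolding norm_scaleR[of "\<psi> _"] norm_scaleR[of C] by (intro AE_I2 mult_right_mono) auto
    qed
    have "(LINT x:\<Omega>|lebesgue. enn2real (w x) *\<^sub>R grad \<psi> x) = - (LINT x:\<Omega>|lebesgue. \<psi> x *\<^sub>R gw x)"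
      using dg p unfolding has_distributional_gradient_def by blast
    then have "(\<integral>x. (indicat_real K x *\<^sub>R enn2real (w x)) *\<^sub>R grad \<psi> x \<partial>lebesgue) \<bullet> b = - ((\<integral>x. \<psi> x *\<^sub>R (indicat_real K x *\<^sub>R gw x) \<partial>lebesgue) \<bullet> b)"
      unfolding set_lebesgue_integral_def e1 e2 by simp
    then have eq: "(\<integral>x. ((indicat_real K x *\<^sub>R enn2real (w x)) *\<^sub>R grad \<psi> x) \<bullet> b \<partial>lebesgue) = - (\<integral>x. (\<psi> x *\<^sub>R (indicat_real K x *\<^sub>R gw x)) \<bullet> b \<partial>lebesgue)"
      using i1 i2 by (simp only: integral_inner_left)
    have "(\<integral>x. ((indicat_real K x *\<^sub>R enn2real (w x)) *\<^sub>R grad \<psi> x) \<bullet> b \<partial>lebesgue) = (\<integral>x. v x * (grad \<psi> x \<bullet> b) \<partial>lebesgue)"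
    proof (rule integral_cong_AE)
      show "(\<lambda>x. ((indicat_real K x *\<^sub>R enn2real (w x)) *\<^sub>R grad \<psi> x) \<bullet> b) \<in> borel_measurable lebesgue"
        using borel_measurable_integrable[OF i1] by (intro borel_measurable_inner borel_measurable_const)
      show "(\<lambda>x. v x * (grad \<psi> x \<bullet> b)) \<in> borel_measurable lebesgue" using m pm by measurable
      show "AE x in lebesgue. ((indicat_real K x *\<^sub>R enn2real (w x)) *\<^sub>R grad \<psi> x) \<bullet> b = v x * (grad \<psi> x \<bullet> b)"
        using La
      proof eventually_elim
        case (elim x)
        show ?case using elim K(2) K(4)[of x] by (cases "x \<in> K") auto
      qed
    qed
    with eq Lp[OF p, of b] have "(\<integral>x. G x \<bullet> (\<psi> x *\<^sub>R b) \<partial>lebesgue) = (\<integral>x. (\<psi> x *\<^sub>R (indicat_real K x *\<^sub>R gw x)) \<bullet> b \<partial>lebesgue)"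
      by simp
    moreover have iG: "integrable lebesgue (\<lambda>x. G x \<bullet> (\<psi> x *\<^sub>R b))"
    proof -
      have "sq_integrable lebesgue (\<lambda>x. (\<psi> x / \<rho> x) *\<^sub>R b)"
        by (rule sq_integrable_continuous_compact_support[OF continuous_on_scaleR[OF continuous_div_rho continuous_on_const] K(1)])
          (auto intro!: smooth_continuous C0_inf_smooth[OF p] simp: K(3))
      from integrable_inner[OF Ls this] show ?thesis
        using rho(2) by (simp add: less_imp_neq[THEN not_sym])
    qed
    moreover have "integrable lebesgue (\<lambda>x. (\<psi> x *\<^sub>R (indicat_real K x *\<^sub>R gw x)) \<bullet> b)"
      by (rule integrable_inner_left[OF i2])
    ultimately have "(\<integral>x. G x \<bullet> (\<psi> x *\<^sub>R b) - (\<psi> x *\<^sub>R (indicat_real K x *\<^sub>R gw x)) \<bullet> b \<partial>lebesgue) = 0"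
      by (subst Bochner_Integration.integral_diff) auto
    moreover have "G x \<bullet> (\<psi> x *\<^sub>R b) - (\<psi> x *\<^sub>R (indicat_real K x *\<^sub>R gw x)) \<bullet> b = \<psi> x * ((G x - gw x) \<bullet> b)" for x
      using K(3)[of x] by (cases "x \<in> K") (auto simp: inner_diff_left right_diff_distrib)
    ultimately show "(\<integral>x. \<psi> x * ((G x - gw x) \<bullet> b) \<partial>lebesgue) = 0" by simp
  qed
  have "AE x in lebesgue. \<forall>b\<in>Basis. x \<in> \<Omega> \<longrightarrow> (G x - gw x) \<bullet> b = 0"
    by (subst AE_ball_countable) (auto intro: comp countable_finite)
  then show ?thesis
  proof eventually_elim
    case (elim x)
    show ?case
    proof
      assume "x \<in> \<Omega>"
      then have "G x - gw x = 0" using elim by (intro euclidean_eqI[of "G x - gw x" 0]) auto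
      then show "gw x = G x" by simp
    qed
  qed
qed

lemma eventually_test:
  assumes p: "\<phi> \<in> C0_inf \<Omega>"
  shows "\<forall>\<^sub>F n in sequentially. \<phi> \<in> C0_inf (U n)"
proof -
  obtain K where K: "compact K" "K \<subseteq> \<Omega>" "\<And>x. x \<notin> K \<Longrightarrow> \<phi> x = 0" using C0_inf_support[OF p] by metis
  show ?thesis using exhaust[OF K(1,2)]
    by eventually_elim (rule C0_infI[OF C0_inf_smooth[OF p] K(1) _ K(3)])
qed

lemma limit_on_support:
  assumes L: "weak_limit v G" and p: "\<phi> \<in> C0_inf \<Omega>"
  shows "AE x in lebesgue. \<phi> x \<noteq> 0 \<longrightarrow> 0 \<le> v x \<and> (\<lambda>n. u n x) \<longlonglongrightarrow> v x"
proof -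
  have z: "\<phi> x \<noteq> 0 \<Longrightarrow> x \<in> \<Omega>" for x using C0_inf_support[OF p] by (metis subsetD)
  have "AE x in lebesgue. x \<in> \<Omega> \<longrightarrow> 0 \<le> v x \<and> w x = ennreal (v x) \<and> (\<lambda>n. u n x) \<longlonglongrightarrow> v x"
    using L unfolding weak_limit_def by blast
  then show ?thesis by eventually_elim (use z in blast)
qed

text \<open>
  If \<open>w(x) = 0\<close>, then \<open>\<phi>(x)\<^sup>2/u\<^sub>n(x)\<^sup>2\<^sup>-\<^sup>q\<close> tends to infinity. By Fatou's lemma and the uniform bound
  on the integrals this happens on a null set only.
\<close>

lemma limit_pos:
  assumes L: "weak_limit v G" and p: "\<phi> \<in> C0_inf \<Omega>"
  shows "AE x in lebesgue. \<phi> x \<noteq> 0 \<longrightarrow> 0 < v x"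
proof -
  obtain N where N: "\<And>n. N \<le> n \<Longrightarrow> \<phi> \<in> C0_inf (U n)"
    using eventually_test[OF p] unfolding eventually_sequentially by blast
  define f where "f n x = ennreal ((\<phi> x)\<^sup>2 * u (N + n) x powr (q - 2))" for n x
  have [measurable]: "\<phi> \<in> borel_measurable lebesgue"
    using C0_inf_sq_integrable[OF p] by (auto dest: sq_integrableD)
  have [measurable]: "u n \<in> borel_measurable lebesgue" for n by (rule D12_0_measurable[OF u_D12_0])
  have fm [measurable]: "f n \<in> borel_measurable lebesgue" for n unfolding f_def by measurable
  have "(\<integral>\<^sup>+x. liminf (\<lambda>n. f n x) \<partial>lebesgue) \<le> liminf (\<lambda>n. \<integral>\<^sup>+x. f n x \<partial>lebesgue)"
    by (rule nn_integral_liminf[OF fm])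
  also have "\<dots> \<le> ennreal (sqnorm lebesgue (grad \<phi>))"
    by (rule Liminf_le)
      (auto simp: f_def intro!: always_eventually lane_emden_negative_power_bound(1)[OF pair U(1,2) q N])
  also have "\<dots> < \<infinity>" by simp
  finally have "AE x in lebesgue. liminf (\<lambda>n. f n x) \<noteq> \<infinity>"
    by (intro nn_integral_noteq_infinite) auto
  moreover have "AE x in lebesgue. \<forall>n. \<phi> x \<noteq> 0 \<longrightarrow> 0 < u (N + n) x"
    unfolding AE_all_countable
    by (intro allI lane_emden_negative_power_bound(2)[OF pair U(1,2) q N]) simp
  ultimately show ?thesis using limit_on_support[OF L p]
  proof eventually_elim
    case (elim x)
    show ?case
    proof (intro impI, rule ccontr)
      assume nz: "\<phi> x \<noteq> 0" and "\<not> 0 < v x"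
      with elim(3) have v0: "v x = 0" by auto
      obtain K where K: "liminf (\<lambda>n. f n x) = ennreal K" "0 \<le> K"
        using elim(1) by (cases "liminf (\<lambda>n. f n x)") auto
      have "(\<lambda>n. u n x) \<longlonglongrightarrow> 0" using elim(3) nz v0 by simp
      then have "(\<lambda>n. u (n + N) x) \<longlonglongrightarrow> 0" by (rule LIMSEQ_ignore_initial_segment)
      then have "(\<lambda>n. u (N + n) x) \<longlonglongrightarrow> 0" by (simp add: add.commute)
      then have "(\<lambda>n. u (N + n) x powr (2 - q)) \<longlonglongrightarrow> 0 powr (2 - q)"
        using elim(2) nz q by (intro tendsto_powr2 tendsto_const) (auto intro: less_imp_le always_eventually)
      then have "\<forall>\<^sub>F n in sequentially. u (N + n) x powr (2 - q) < (\<phi> x)\<^sup>2 / (K + 1)"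
        using nz K(2) by (intro order_tendstoD(2)) auto
      then have "\<forall>\<^sub>F n in sequentially. ennreal (K + 1) \<le> f n x"
      proof eventually_elim
        case (elim n)
        have u: "0 < u (N + n) x" using \<open>\<forall>n. \<phi> x \<noteq> 0 \<longrightarrow> 0 < u (N + n) x\<close> nz by simp
        have "u (N + n) x powr (2 - q) * (K + 1) < (\<phi> x)\<^sup>2" using elim K(2) by (simp add: field_simps)
        then have "u (N + n) x powr (q - 2) * (u (N + n) x powr (2 - q) * (K + 1)) \<le> u (N + n) x powr (q - 2) * (\<phi> x)\<^sup>2"
          by (intro mult_left_mono) auto
        also have "u (N + n) x powr (q - 2) * (u (N + n) x powr (2 - q) * (K + 1)) = K + 1"
          using u by (simp add: mult.assoc[symmetric] powr_add[symmetric])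
        finally show ?case unfolding f_def by (intro ennreal_leI) (simp add: mult.commute)
      qed
      then have "ennreal (K + 1) \<le> liminf (\<lambda>n. f n x)" by (rule Liminf_bounded)
      with K show False by simp
    qed
  qed
qed

lemma test_div_rho_bounded:
  assumes p: "\<phi> \<in> C0_inf \<Omega>"
  obtains B where "0 \<le> B" "\<And>x. \<bar>\<phi> x / \<rho> x\<bar> \<le> B"
proof -
  obtain K where K: "compact K" "\<And>x. x \<notin> K \<Longrightarrow> \<phi> x = 0" using C0_inf_support[OF p] by metis
  obtain B where "0 \<le> B" "\<And>x. norm (\<phi> x / \<rho> x) \<le> B"
    using continuous_compact_support_bounded[OF continuous_div_rho[OF smooth_continuous[OF C0_inf_smooth[OF p]]] K(1)] K(2)
    by auto
  then show ?thesis by (intro that[of B]) auto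
qed

lemma quotient_bound:
  assumes "\<bar>r\<bar> \<le> B" "0 < e" "0 \<le> t"
  shows "\<bar>r / (t + e)\<bar> \<le> B / (e::real)"
  using assms by (auto simp: abs_divide intro!: frac_le)

lemma limit_log_gradient_sq_integrable:
  assumes L: "weak_limit v G" and p: "\<phi> \<in> C0_inf \<Omega>" and e: "0 < e"
  shows "sq_integrable lebesgue (\<lambda>x. (\<phi> x / (v x + e)) *\<^sub>R G x)"
proof -
  note [measurable] = limit_measurable[OF L]
  have [measurable]: "\<phi> \<in> borel_measurable lebesgue"
    using C0_inf_sq_integrable[OF p] by (auto dest: sq_integrableD)
  obtain B where B: "0 \<le> B" "\<And>x. \<bar>\<phi> x / \<rho> x\<bar> \<le> B" using test_div_rho_bounded[OF p] by blast
  have Ls: "sq_integrable lebesgue (\<lambda>x. \<rho> x *\<^sub>R G x)" using L by (simp add: weak_limit_def)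
  show ?thesis
  proof (rule sq_integrable_bound)
    show "integrable lebesgue (\<lambda>x. (B / e)\<^sup>2 * (norm (\<rho> x *\<^sub>R G x))\<^sup>2)" using sq_integrableD(2)[OF Ls] by simp
    show "AE x in lebesgue. (norm ((\<phi> x / (v x + e)) *\<^sub>R G x))\<^sup>2 \<le> (B / e)\<^sup>2 * (norm (\<rho> x *\<^sub>R G x))\<^sup>2"
      using limit_on_support[OF L p]
    proof eventually_elim
      case (elim x)
      show ?case
      proof (cases "\<phi> x = 0")
        case False
        have "\<bar>\<phi> x / \<rho> x / (v x + e)\<bar> \<le> B / e" using elim False by (intro quotient_bound B e) auto
        then have "(\<phi> x / \<rho> x / (v x + e))\<^sup>2 \<le> (B / e)\<^sup>2" by (metis abs_ge_zero power2_abs power_mono)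
        then have "(\<phi> x / \<rho> x / (v x + e))\<^sup>2 * (norm (\<rho> x *\<^sub>R G x))\<^sup>2 \<le> (B / e)\<^sup>2 * (norm (\<rho> x *\<^sub>R G x))\<^sup>2"
          by (rule mult_right_mono) simp
        moreover have "(\<phi> x / (v x + e)) *\<^sub>R G x = (\<phi> x / \<rho> x / (v x + e)) *\<^sub>R (\<rho> x *\<^sub>R G x)"
          using rho(2)[of x] by simp
        ultimately show ?thesis by (simp only: norm_scaleR_sq)
      qed simp
    qed
  qed measurable
qed

text \<open>
  Put \<open>X\<^sub>n = \<phi>\<nabla>u\<^sub>n/(u\<^sub>n + \<epsilon>)\<close>. Then \<open>|X\<^sub>n|\<^sup>2 \<ge> 2 X\<^sub>n \<bullet> V - |V|\<^sup>2\<close> and the test identity bound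
  \<open>\<integral> u\<^sub>n\<^sup>q\<^sup>-\<^sup>1\<phi>\<^sup>2/(u\<^sub>n + \<epsilon>)\<close> by \<open>2 \<integral> (\<nabla>\<phi> - V) \<bullet> X\<^sub>n + \<integral> |V|\<^sup>2\<close>. Here \<open>\<integral> (\<nabla>\<phi> - V) \<bullet> X\<^sub>n = \<integral> \<rho>\<nabla>u\<^sub>n \<bullet> Y\<^sub>n\<close>, where
  \<open>Y\<^sub>n\<close> converges strongly, so that up to an error \<open>Y\<^sub>n\<close> may be replaced by its limit \<open>Y\<close>. In this form the
  right-hand side is linear in \<open>\<nabla>u\<^sub>n\<close>, and the left-hand side is treated with Fatou's lemma.
\<close>

lemma limit_inequality:
  assumes L: "weak_limit v G" and p: "\<phi> \<in> C0_inf \<Omega>" and e: "0 < e"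
  defines "V \<equiv> \<lambda>x. (\<phi> x / (v x + e)) *\<^sub>R G x"
  defines "R \<equiv> 2 * (\<integral>x. grad \<phi> x \<bullet> V x \<partial>lebesgue) - sqnorm lebesgue V"
  shows "0 \<le> R"
    and "(\<integral>\<^sup>+x. ennreal (v x powr (q - 1) * (\<phi> x)\<^sup>2 / (v x + e)) \<partial>lebesgue) \<le> ennreal R"
proof -
  note m [measurable] = limit_measurable[OF L]
  have pm [measurable]: "\<phi> \<in> borel_measurable lebesgue"
    using C0_inf_sq_integrable[OF p] by (auto dest: sq_integrableD)
  have um [measurable]: "u n \<in> borel_measurable lebesgue" for n by (rule D12_0_measurable[OF u_D12_0])
  note rho_measurable [measurable]
  obtain B where B: "0 \<le> B" "\<And>x. \<bar>\<phi> x / \<rho> x\<bar> \<le> B" using test_div_rho_bounded[OF p] by blast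
  have Vs: "sq_integrable lebesgue V" unfolding V_def by (rule limit_log_gradient_sq_integrable[OF L p e])
  note gs = C0_inf_sq_integrable(2)[OF p]
  define Z where "Z x = grad \<phi> x - V x" for x
  have Zs: "sq_integrable lebesgue Z" unfolding Z_def by (rule sq_integrable_diff[OF gs Vs])
  have [measurable]: "Z \<in> borel_measurable lebesgue" by (rule sq_integrableD(1)[OF Zs])
  define Y where "Y x = (\<phi> x / \<rho> x / (v x + e)) *\<^sub>R Z x" for x
  define Yn where "Yn n x = (\<phi> x / \<rho> x / (u n x + e)) *\<^sub>R Z x" for n x
  define X where "X n x = (\<phi> x / (u n x + e)) *\<^sub>R g n x" for n x
  define a where "a n = (\<integral>x. u n x powr (q - 1) * (\<phi> x)\<^sup>2 / (u n x + e) \<partial>lebesgue)" for n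
  let ?VV = "sqnorm lebesgue V"
  have LY: "L2_tendsto lebesgue Yn Y"
  proof (rule L2_tendsto_dominated[where h="\<lambda>x. (B / e) *\<^sub>R Z x"])
    show "Yn n \<in> borel_measurable lebesgue" "Y \<in> borel_measurable lebesgue" for n
      unfolding Yn_def Y_def by measurable
    show "AE x in lebesgue. (\<lambda>n. Yn n x) \<longlonglongrightarrow> Y x"
      using limit_on_support[OF L p]
    proof eventually_elim
      case (elim x)
      show ?case
      proof (cases "\<phi> x = 0")
        case True
        then show ?thesis by (simp add: Yn_def Y_def)
      next
        case False
        then show ?thesis unfolding Yn_def Y_def using elim e by (intro tendsto_intros) auto
      qed
    qed
    show "AE x in lebesgue. norm (Yn n x) \<le> norm ((B / e) *\<^sub>R Z x)" for n
      using nonneg[of n]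
    proof eventually_elim
      case (elim x)
      have "\<bar>\<phi> x / \<rho> x / (u n x + e)\<bar> \<le> \<bar>B / e\<bar>"
        using quotient_bound[OF B(2) e elim] by (rule order_trans) (rule abs_ge_self)
      then show ?case unfolding Yn_def norm_scaleR by (rule mult_right_mono) simp
    qed
  qed (rule sq_integrable_scaleR[OF Zs])
  define er where "er n = (\<integral>x. (\<rho> x *\<^sub>R g n x) \<bullet> (Yn n x - Y x) \<partial>lebesgue)" for n
  have er0: "er \<longlonglongrightarrow> 0"
  proof -
    have "(\<lambda>n. (er n)\<^sup>2) \<longlonglongrightarrow> 0"
    proof (rule tendsto_sandwich[OF _ _ tendsto_const])
      show "\<forall>\<^sub>F n in sequentially. (er n)\<^sup>2 \<le> M * sqnorm lebesgue (\<lambda>x. Yn n x - Y x)"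
      proof (intro always_eventually allI)
        fix n
        have "(er n)\<^sup>2 \<le> sqnorm lebesgue (\<lambda>x. \<rho> x *\<^sub>R g n x) * sqnorm lebesgue (\<lambda>x. Yn n x - Y x)"
          unfolding er_def by (intro Cauchy_Schwarz_integral sq_rho_g sq_integrable_diff L2_tendstoD[OF LY])
        also have "\<dots> \<le> M * sqnorm lebesgue (\<lambda>x. Yn n x - Y x)"
          by (intro mult_right_mono bound) simp
        finally show "(er n)\<^sup>2 \<le> M * sqnorm lebesgue (\<lambda>x. Yn n x - Y x)" .
      qed
      show "(\<lambda>n. M * sqnorm lebesgue (\<lambda>x. Yn n x - Y x)) \<longlonglongrightarrow> 0"
        using tendsto_mult[OF tendsto_const[of M] L2_tendstoD(5)[OF LY]] by simp
    qed simp
    then show ?thesis by simp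
  qed
  have split: "(\<integral>x. (\<rho> x *\<^sub>R g n x) \<bullet> Yn n x \<partial>lebesgue) = (\<integral>x. (\<rho> x *\<^sub>R g n x) \<bullet> Y x \<partial>lebesgue) + er n" for n
    unfolding er_def inner_diff_right
    by (simp only: Bochner_Integration.integral_diff[OF
        integrable_inner[OF sq_rho_g L2_tendstoD(1)[OF LY]] integrable_inner[OF sq_rho_g L2_tendstoD(2)[OF LY]]])
  have an: "\<forall>\<^sub>F n in sequentially. a n \<le> 2 * ((\<integral>x. (\<rho> x *\<^sub>R g n x) \<bullet> Y x \<partial>lebesgue) + er n) + ?VV"
    using eventually_test[OF p]
  proof eventually_elim
    case (elim n)
    note I = lane_emden_test_identity[OF pair U(1,2) q elim e]
    have Xs: "sq_integrable lebesgue (X n)" unfolding X_def by (rule I(2))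
    have "0 \<le> sqnorm lebesgue (\<lambda>x. X n x + (-1) *\<^sub>R V x)" by simp
    then have 1: "2 * (\<integral>x. X n x \<bullet> V x \<partial>lebesgue) \<le> sqnorm lebesgue (X n) + ?VV"
      unfolding integral_norm_add_sq[OF Xs Vs] by simp
    have 2: "a n + sqnorm lebesgue (X n) = 2 * (\<integral>x. grad \<phi> x \<bullet> X n x \<partial>lebesgue)"
      unfolding a_def X_def by (rule I(3))
    have "(\<rho> x *\<^sub>R g n x) \<bullet> Yn n x = grad \<phi> x \<bullet> X n x - X n x \<bullet> V x" for x
      using rho(2)[of x] by (simp add: Yn_def X_def Z_def inner_diff_right inner_commute right_diff_distrib diff_divide_distrib)
    then have 3: "(\<integral>x. (\<rho> x *\<^sub>R g n x) \<bullet> Yn n x \<partial>lebesgue) = (\<integral>x. grad \<phi> x \<bullet> X n x \<partial>lebesgue) - (\<integral>x. X n x \<bullet> V x \<partial>lebesgue)"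
      by (simp add: integrable_inner gs Xs Vs)
    have arith: "A \<le> 2 * y + C" if "2 * s \<le> B + C" "A + B = 2 * t" "y = t - s" for A B C s t y :: real
      using that by linarith
    show ?case by (rule arith[OF 1 2 3[unfolded split]])
  qed
  have pass: "\<alpha> \<le> R" if ev: "\<forall>\<^sub>F n in sequentially. \<alpha> \<le> a n" for \<alpha>
  proof (rule field_le_epsilon)
    fix d :: real assume d: "0 < d"
    have "\<forall>\<^sub>F n in sequentially. er n < d / 2" using d by (intro order_tendstoD(2)[OF er0]) simp
    with an ev have "\<forall>\<^sub>F n in sequentially. (\<alpha> - ?VV - d) / 2 \<le> (\<integral>x. (\<rho> x *\<^sub>R g n x) \<bullet> Y x \<partial>lebesgue)"
      by eventually_elim argo
    then have "(\<alpha> - ?VV - d) / 2 \<le> (\<integral>x. (\<rho> x *\<^sub>R G x) \<bullet> Y x \<partial>lebesgue)"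
      using L L2_tendstoD(2)[OF LY] unfolding weak_limit_def by blast
    also have "(\<lambda>x. (\<rho> x *\<^sub>R G x) \<bullet> Y x) = (\<lambda>x. grad \<phi> x \<bullet> V x - (norm (V x))\<^sup>2)"
    proof
      fix x
      have "(\<rho> x *\<^sub>R G x) \<bullet> Y x = V x \<bullet> Z x" using rho(2)[of x] by (simp add: Y_def V_def)
      then show "(\<rho> x *\<^sub>R G x) \<bullet> Y x = grad \<phi> x \<bullet> V x - (norm (V x))\<^sup>2"
        by (simp add: Z_def inner_diff_right inner_commute power2_norm_eq_inner)
    qed
    also have "(\<integral>x. grad \<phi> x \<bullet> V x - (norm (V x))\<^sup>2 \<partial>lebesgue) = (\<integral>x. grad \<phi> x \<bullet> V x \<partial>lebesgue) - ?VV"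
      using integrable_inner[OF gs Vs] sq_integrableD(2)[OF Vs] by simp
    finally show "\<alpha> \<le> R + d" unfolding R_def by argo
  qed
  have nn: "AE x in lebesgue. 0 \<le> u n x powr (q - 1) * (\<phi> x)\<^sup>2 / (u n x + e)" for n
    using nonneg[of n] by eventually_elim (use e in auto)
  have "0 \<le> a n" for n unfolding a_def by (rule integral_nonneg_AE[OF nn])
  then show R0: "0 \<le> R" by (intro pass) simp
  show "(\<integral>\<^sup>+x. ennreal (v x powr (q - 1) * (\<phi> x)\<^sup>2 / (v x + e)) \<partial>lebesgue) \<le> ennreal R"
  proof (rule ccontr)
    let ?A = "\<lambda>x. ennreal (v x powr (q - 1) * (\<phi> x)\<^sup>2 / (v x + e))"
    let ?An = "\<lambda>n x. ennreal (u n x powr (q - 1) * (\<phi> x)\<^sup>2 / (u n x + e))"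
    assume "\<not> ?thesis"
    then have "ennreal R < (\<integral>\<^sup>+x. ?A x \<partial>lebesgue)" by simp
    then obtain \<beta> where \<beta>: "ennreal R < \<beta>" "\<beta> < (\<integral>\<^sup>+x. ?A x \<partial>lebesgue)" using dense by blast
    then have "\<beta> \<noteq> \<infinity>" by auto
    then obtain \<alpha> where \<alpha>: "\<beta> = ennreal \<alpha>" "0 \<le> \<alpha>" by (cases \<beta>) auto
    have "(\<integral>\<^sup>+x. ?A x \<partial>lebesgue) \<le> (\<integral>\<^sup>+x. liminf (\<lambda>n. ?An n x) \<partial>lebesgue)"
    proof (rule nn_integral_mono_AE)
      show "AE x in lebesgue. ?A x \<le> liminf (\<lambda>n. ?An n x)"
        using limit_on_support[OF L p]
      proof eventually_elim
        case (elim x)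
        show ?case
        \<comment> \<open>At \<open>v x = 0\<close> convergence may fail if \<open>q = 1\<close>, but there the left-hand side is 0.\<close>
        proof (cases "\<phi> x = 0 \<or> v x = 0")
          case False
          then have "(\<lambda>n. u n x powr (q - 1) * (\<phi> x)\<^sup>2 / (u n x + e)) \<longlonglongrightarrow> v x powr (q - 1) * (\<phi> x)\<^sup>2 / (v x + e)"
            using elim e by (intro tendsto_quotient_powr tendsto_const) auto
          then show ?thesis
            by (subst lim_imp_Liminf[OF trivial_limit_sequentially tendsto_ennrealI]) auto
        qed auto
      qed
    qed
    also have "\<dots> \<le> liminf (\<lambda>n. \<integral>\<^sup>+x. ?An n x \<partial>lebesgue)"
      by (rule nn_integral_liminf) measurable
    finally have "\<beta> < liminf (\<lambda>n. \<integral>\<^sup>+x. ?An n x \<partial>lebesgue)" using \<beta>(2) by (rule less_le_trans[rotated])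
    then have "\<forall>\<^sub>F n in sequentially. \<beta> < (\<integral>\<^sup>+x. ?An n x \<partial>lebesgue)" by (rule less_LiminfD)
    then have "\<forall>\<^sub>F n in sequentially. \<alpha> \<le> a n"
      using eventually_test[OF p]
    proof eventually_elim
      case (elim n)
      have "(\<integral>\<^sup>+x. ?An n x \<partial>lebesgue) = ennreal (a n)" unfolding a_def
        by (rule nn_integral_eq_integral[OF lane_emden_test_identity(1)[OF pair U(1,2) q elim(2) e] nn])
      with elim(1) \<alpha> show ?case by (simp add: ennreal_less_iff)
    qed
    from pass[OF this] \<beta>(1) \<alpha> R0 show False by (simp add: ennreal_less_iff)
  qed
qed

text \<open>
  For \<open>\<delta> = 2\<close> the inequality with \<open>\<epsilon> > 0\<close> bounds the gradient terms by \<open>4 \<integral> |\<nabla>\<phi>|\<^sup>2\<close>. Hence their limit is square integrable and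
  dominates them, and they converge as \<open>\<epsilon>\<close> tends to 0, which is needed because their coefficient \<open>1/\<delta> - 1\<close>
  may have either sign.
\<close>

lemma hardy_inequality_limit:
  assumes L: "weak_limit v G" and p: "\<phi> \<in> C0_inf \<Omega>"
  obtains A B where "0 \<le> A" "0 \<le> B"
    and "(\<integral>\<^sup>+x. ennreal ((\<phi> x)\<^sup>2 / v x powr (2 - q)) \<partial>lebesgue) = ennreal A"
    and "(\<integral>\<^sup>+x. ennreal ((norm ((\<phi> x / v x) *\<^sub>R G x))\<^sup>2) \<partial>lebesgue) = ennreal B"
    and "\<And>d. 0 < d \<Longrightarrow> A \<le> d * sqnorm lebesgue (grad \<phi>) + (1 / d - 1) * B"
proof -
  note m [measurable] = limit_measurable[OF L]
  have pm [measurable]: "\<phi> \<in> borel_measurable lebesgue"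
    using C0_inf_sq_integrable[OF p] by (auto dest: sq_integrableD)
  note gs = C0_inf_sq_integrable(2)[OF p]
  define e where "e k = 1 / real (Suc k)" for k
  have e: "0 < e k" for k by (simp add: e_def)
  have e0: "e \<longlonglongrightarrow> 0" unfolding e_def by (rule LIMSEQ_Suc[OF lim_const_over_n])
  define V where "V k x = (\<phi> x / (v x + e k)) *\<^sub>R G x" for k x
  define V0 where "V0 x = (\<phi> x / v x) *\<^sub>R G x" for x
  define b where "b k = sqnorm lebesgue (V k)" for k
  define P where "P = sqnorm lebesgue (grad \<phi>)"
  define R where "R k = 2 * (\<integral>x. grad \<phi> x \<bullet> V k x \<partial>lebesgue) - b k" for k
  have Vs: "sq_integrable lebesgue (V k)" for k unfolding V_def by (rule limit_log_gradient_sq_integrable[OF L p e])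
  have V0m [measurable]: "V0 \<in> borel_measurable lebesgue" unfolding V0_def by measurable
  have R0: "0 \<le> R k" for k unfolding R_def b_def V_def by (rule limit_inequality(1)[OF L p e])
  have young: "R k \<le> d * P + (1 / d - 1) * b k" if d: "0 < d" for d k
  proof -
    have "0 \<le> sqnorm lebesgue (\<lambda>x. V k x + (-d) *\<^sub>R grad \<phi> x)" by simp
    then have "2 * d * (\<integral>x. grad \<phi> x \<bullet> V k x \<partial>lebesgue) \<le> b k + d\<^sup>2 * P"
      unfolding integral_norm_add_sq[OF Vs gs] b_def P_def by (simp add: inner_commute)
    then have "2 * (\<integral>x. grad \<phi> x \<bullet> V k x \<partial>lebesgue) \<le> (b k + d\<^sup>2 * P) / d"
      using d by (simp add: field_simps)
    also have "\<dots> = b k / d + d * P" using d by (simp add: add_divide_distrib power2_eq_square)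
    finally show ?thesis unfolding R_def by (simp add: left_diff_distrib)
  qed
  \<comment> \<open>The case \<open>d = 2\<close>: \<open>0 \<le> R\<close> is at most \<open>2 P - b/2\<close>.\<close>
  have b4: "b k \<le> 4 * P" for k using young[of 2 k] R0[of k] by simp
  have pos: "AE x in lebesgue. \<phi> x \<noteq> 0 \<longrightarrow> 0 < v x" by (rule limit_pos[OF L p])
  have Vlim: "AE x in lebesgue. (\<lambda>k. V k x) \<longlonglongrightarrow> V0 x"
    using pos
  proof eventually_elim
    case (elim x)
    show ?case
    proof (cases "\<phi> x = 0")
      case False
      then have "(\<lambda>k. (\<phi> x / (v x + e k)) *\<^sub>R G x) \<longlonglongrightarrow> (\<phi> x / (v x + 0)) *\<^sub>R G x"
        using elim by (intro tendsto_intros e0) auto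
      then show ?thesis by (simp add: V_def V0_def)
    qed (simp add: V_def V0_def)
  qed
  have V0s: "sq_integrable lebesgue V0"
    by (rule sq_integrable_Fatou(1)[OF Vs V0m Vlim, where e="4 * P"]) (use b4 in \<open>simp add: b_def\<close>)
  define B where "B = sqnorm lebesgue V0"
  have LV: "L2_tendsto lebesgue V V0"
  proof (rule L2_tendsto_dominated[OF _ V0m Vlim _ V0s])
    show "V k \<in> borel_measurable lebesgue" for k by (rule sq_integrableD(1)[OF Vs])
    show "AE x in lebesgue. norm (V k x) \<le> norm (V0 x)" for k
      using pos
    proof eventually_elim
      case (elim x)
      show ?case
      proof (cases "\<phi> x = 0")
        case False
        then have "\<bar>\<phi> x / (v x + e k)\<bar> \<le> \<bar>\<phi> x / v x\<bar>"
          using elim e[of k] by (auto simp: abs_divide intro!: divide_left_mono)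
        then show ?thesis unfolding V_def V0_def norm_scaleR by (rule mult_right_mono) simp
      qed (simp add: V_def)
    qed
  qed
  have bB: "b \<longlonglongrightarrow> B" unfolding b_def B_def by (rule L2_tendsto_norm[OF LV])
  let ?A = "\<integral>\<^sup>+x. ennreal ((\<phi> x)\<^sup>2 / v x powr (2 - q)) \<partial>lebesgue"
  have bd: "?A \<le> ennreal (d * P + (1 / d - 1) * B) \<and> 0 \<le> d * P + (1 / d - 1) * B" if d: "0 < d" for d
  proof
    let ?Ak = "\<lambda>k x. ennreal (v x powr (q - 1) * (\<phi> x)\<^sup>2 / (v x + e k))"
    have lim: "(\<lambda>k. d * P + (1 / d - 1) * b k) \<longlonglongrightarrow> d * P + (1 / d - 1) * B" by (intro tendsto_intros bB)
    show "0 \<le> d * P + (1 / d - 1) * B"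
      by (rule LIMSEQ_le_const[OF lim]) (use order_trans[OF R0 young[OF d]] in blast)
    have "?A = (\<integral>\<^sup>+x. liminf (\<lambda>k. ?Ak k x) \<partial>lebesgue)"
    proof (rule nn_integral_cong_AE)
      show "AE x in lebesgue. ennreal ((\<phi> x)\<^sup>2 / v x powr (2 - q)) = liminf (\<lambda>k. ?Ak k x)"
        using pos
      proof eventually_elim
        case (elim x)
        show ?case
        proof (cases "\<phi> x = 0")
          case True
          then show ?thesis by (simp add: Liminf_const)
        next
          case False
          then have u: "0 < v x" using elim by simp
          have "(\<lambda>k. v x powr (q - 1) * (\<phi> x)\<^sup>2 / (v x + e k)) \<longlonglongrightarrow> v x powr (q - 1) * (\<phi> x)\<^sup>2 / (v x + 0)"
            by (rule tendsto_quotient_powr[OF tendsto_const u e0]) simp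
          also have "v x powr (q - 1) * (\<phi> x)\<^sup>2 / (v x + 0) = (\<phi> x)\<^sup>2 / (v x powr 1 / v x powr (q - 1))"
            using u by simp
          also have "v x powr 1 / v x powr (q - 1) = v x powr (2 - q)" by (simp only: powr_diff[symmetric]) simp
          finally show ?thesis
            by (intro lim_imp_Liminf[OF trivial_limit_sequentially, symmetric] tendsto_ennrealI)
        qed
      qed
    qed
    also have "\<dots> \<le> liminf (\<lambda>k. \<integral>\<^sup>+x. ?Ak k x \<partial>lebesgue)" by (rule nn_integral_liminf) measurable
    also have "\<dots> \<le> liminf (\<lambda>k. ennreal (d * P + (1 / d - 1) * b k))"
    proof (rule Liminf_mono, rule always_eventually, rule allI)
      fix k
      have "(\<integral>\<^sup>+x. ?Ak k x \<partial>lebesgue) \<le> ennreal (R k)"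
        unfolding R_def b_def V_def by (rule limit_inequality(2)[OF L p e])
      also have "\<dots> \<le> ennreal (d * P + (1 / d - 1) * b k)" by (rule ennreal_leI[OF young[OF d]])
      finally show "(\<integral>\<^sup>+x. ?Ak k x \<partial>lebesgue) \<le> ennreal (d * P + (1 / d - 1) * b k)" .
    qed
    also have "\<dots> = ennreal (d * P + (1 / d - 1) * B)"
      by (rule lim_imp_Liminf[OF trivial_limit_sequentially tendsto_ennrealI[OF lim]])
    finally show "?A \<le> ennreal (d * P + (1 / d - 1) * B)" .
  qed
  have "?A < \<infinity>" using bd[of 1] by (auto intro: le_less_trans)
  then obtain A where A: "?A = ennreal A" "0 \<le> A" by (cases ?A) auto
  show ?thesis
  proof (rule that[of A B])
    show "0 \<le> A" "?A = ennreal A" using A by auto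
    show "0 \<le> B" by (simp add: B_def)
    show "(\<integral>\<^sup>+x. ennreal ((norm ((\<phi> x / v x) *\<^sub>R G x))\<^sup>2) \<partial>lebesgue) = ennreal B"
      using nn_integral_sq[OF V0s] unfolding B_def V0_def .
    show "A \<le> d * sqnorm lebesgue (grad \<phi>) + (1 / d - 1) * B" if "0 < d" for d
      using conjunct1[OF bd[OF that]] conjunct2[OF bd[OF that]] unfolding P_def A(1) by (simp add: ennreal_le_iff)
  qed
qed

end

section \<open>The Hardy-type inequality\<close>

text \<open>
  The sets are \<open>\<Omega> \<inter> B\<^sub>n\<^sub>+\<^sub>1\<close>. With the exponent \<open>N\<close> in the weight, \<open>a\<close> is chosen such that \<open>(N \<surd>a)\<^sup>2 = l/4\<close>.
\<close>

lemma lane_emden_exhaustion_exists: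
  assumes q: "1 \<le> q" "q < 2" and op: "open \<Omega>" and l1: "lambda1 \<Omega> > 0" and d: "lane_emden_density q \<Omega> w"
  shows "\<exists>U u g \<rho> M. lane_emden_exhaustion q \<Omega> U u g \<rho> M w"
proof -
  obtain l where l: "0 < ereal l" "ereal l < lambda1 \<Omega>" using ereal_dense2[OF l1] by blast
  then have l0: "0 < l" by simp
  have Poin: "l * sqnorm lebesgue f \<le> sqnorm lebesgue (grad f)" if "f \<in> C0_inf \<Omega>" for f
    by (rule lambda1_Poincare[OF less_imp_le[OF l(2)] that])
  let ?N = "DIM('a)"
  define a where "a = l / (4 * (real ?N)\<^sup>2)"
  have a: "0 < a" using l0 by (simp add: a_def)
  define \<rho> :: "'a \<Rightarrow> real" where "\<rho> = weight a ?N"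
  have r0: "0 < \<rho> x" "\<rho> x \<le> 1" for x unfolding \<rho>_def using weight_bounds[of a ?N x] a by simp_all
  have rs: "smooth \<rho>" unfolding \<rho>_def by (rule smooth_weight) (use a in simp)
  have rg: "norm (grad \<rho> x) \<le> (?N * sqrt a) * \<bar>\<rho> x\<bar>" for x
    using norm_grad_weight_le[OF a, of ?N x] r0(1)[of x] by (simp add: \<rho>_def)
  have c2: "(real ?N * sqrt a)\<^sup>2 \<le> l / 4" using l0 by (simp add: power_mult_distrib a_def)
  have c0: "0 \<le> real ?N * sqrt a" using a by simp
  have rsq: "sq_integrable lebesgue \<rho>" unfolding \<rho>_def by (rule sq_integrable_weight[OF a])
  have rb: "\<bar>\<rho> x\<bar> \<le> 1" for x using r0[of x] by simp
  obtain M where M: "\<And>U u g. lane_emden_pair q U u g \<Longrightarrow> open U \<Longrightarrow> bounded U \<Longrightarrow> U \<subseteq> \<Omega> \<Longrightarrow>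
      sqnorm lebesgue (\<lambda>x. \<rho> x * u x) \<le> M \<and> sqnorm lebesgue (\<lambda>x. \<rho> x *\<^sub>R g x) \<le> M"
    using lane_emden_weighted_bound[OF Poin l0 q rs rb rg c2 c0 rsq] by blast
  obtain W where W: "\<And>R. R > 0 \<Longrightarrow> lane_emden_minimizer q (\<Omega> \<inter> ball 0 R) (W R)"
    and Wlim: "AE x\<in>\<Omega> in lebesgue. ((\<lambda>R::real. ennreal (W R x)) \<longlongrightarrow> w x) at_top"
    using d unfolding lane_emden_density_def by blast
  define U :: "nat \<Rightarrow> 'a set" where "U n = \<Omega> \<inter> ball 0 (real (Suc n))" for n
  define u where "u n = W (real (Suc n))" for n
  have "\<forall>n. \<exists>g. lane_emden_pair q (U n) (u n) g"
    using W unfolding lane_emden_minimizer_def lane_emden_pair_def U_def u_def by simp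
  then obtain g where g: "\<And>n. lane_emden_pair q (U n) (u n) (g n)" by metis
  have Uo: "open (U n)" "bounded (U n)" "U n \<subseteq> \<Omega>" for n
    using op by (auto simp: U_def bounded_Int)
  have "lane_emden_exhaustion q \<Omega> U u g \<rho> M w"
  proof
    fix K :: "'a set" assume K: "compact K" "K \<subseteq> \<Omega>"
    obtain r where r: "\<And>x. x \<in> K \<Longrightarrow> norm x \<le> r" using compact_imp_bounded[OF K(1)] by (auto simp: bounded_iff)
    obtain N :: nat where N: "r < real N" using reals_Archimedean2 by blast
    show "\<forall>\<^sub>F n in sequentially. K \<subseteq> U n"
      using eventually_ge_at_top[of N]
    proof eventually_elim
      case (elim n)
      then have "r < real (Suc n)" using N by simp
      then show ?case using r K(2) by (force simp: U_def)
    qed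
  next
    have fl: "filterlim (\<lambda>n. real (Suc n)) at_top sequentially"
      by (rule filterlim_compose[OF filterlim_real_sequentially filterlim_Suc])
    show "AE x in lebesgue. x \<in> \<Omega> \<longrightarrow> (\<lambda>n. ennreal (u n x)) \<longlonglongrightarrow> w x"
      using Wlim
    proof eventually_elim
      case (elim x)
      show ?case
      proof
        assume "x \<in> \<Omega>"
        with elim have "((\<lambda>R::real. ennreal (W R x)) \<longlongrightarrow> w x) at_top" by simp
        from filterlim_compose[OF this fl] show "(\<lambda>n. ennreal (u n x)) \<longlonglongrightarrow> w x" by (simp add: u_def)
      qed
    qed
  qed (use q op g Uo rs r0 M[OF g Uo] in auto)
  then show ?thesis by blast
qed

theorem theorem1p3:
  fixes q \<delta> :: real
    and \<Omega> :: "'a::euclidean_space set"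
    and w :: "'a \<Rightarrow> ennreal"
    and grad_w :: "'a \<Rightarrow> 'a"
    and \<phi> :: "'a \<Rightarrow> real"
  assumes "1 \<le> q" and "q < 2"
    and "open \<Omega>"
    and "lambda1 \<Omega> > 0"
    and "lane_emden_density q \<Omega> w"
    and "has_distributional_gradient \<Omega> (\<lambda>x. enn2real (w x)) grad_w"
    and "\<phi> \<in> C0_inf \<Omega>"
    and "\<delta> > 0"
  shows "ereal (1 / \<delta> * (1 - 1 / \<delta>)) *
           enn2ereal (\<integral>\<^sup>+x\<in>\<Omega>. (ennreal (norm (grad_w x)) / w x)\<^sup>2 * ennreal ((\<phi> x)\<^sup>2) \<partial>lebesgue)
         + ereal (1 / \<delta>) *
           enn2ereal (\<integral>\<^sup>+x\<in>\<Omega>. ennreal ((\<phi> x)\<^sup>2) / ennreal_powr (w x) (2 - q) \<partial>lebesgue)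
         \<le> ereal (LINT x:\<Omega>|lebesgue. (norm (grad \<phi> x))\<^sup>2)"
proof -
  note p = assms(7)
  obtain U u g \<rho> M where "lane_emden_exhaustion q \<Omega> U u g \<rho> M w"
    using lane_emden_exhaustion_exists[OF assms(1-5)] by blast
  then interpret lane_emden_exhaustion q \<Omega> U u g \<rho> M w .
  obtain v G where L: "weak_limit v G" using exists_limit by blast
  obtain A B where AB: "0 \<le> A" "0 \<le> B"
    "(\<integral>\<^sup>+x. ennreal ((\<phi> x)\<^sup>2 / v x powr (2 - q)) \<partial>lebesgue) = ennreal A"
    "(\<integral>\<^sup>+x. ennreal ((norm ((\<phi> x / v x) *\<^sub>R G x))\<^sup>2) \<partial>lebesgue) = ennreal B"
    "\<And>d. 0 < d \<Longrightarrow> A \<le> d * sqnorm lebesgue (grad \<phi>) + (1 / d - 1) * B"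
    by (rule hardy_inequality_limit[OF L p]) blast
  have z: "\<phi> x \<noteq> 0 \<Longrightarrow> x \<in> \<Omega>" "grad \<phi> x \<noteq> 0 \<Longrightarrow> x \<in> \<Omega>" for x
    using C0_inf_support[OF p] by (metis subsetD)+
  have lim: "AE x in lebesgue. x \<in> \<Omega> \<longrightarrow> w x = ennreal (v x)"
  proof -
    have "AE x in lebesgue. x \<in> \<Omega> \<longrightarrow> 0 \<le> v x \<and> w x = ennreal (v x) \<and> (\<lambda>n. u n x) \<longlonglongrightarrow> v x"
      using L unfolding weak_limit_def by blast
    then show ?thesis by eventually_elim blast
  qed
  have 1: "(\<integral>\<^sup>+x\<in>\<Omega>. (ennreal (norm (grad_w x)) / w x)\<^sup>2 * ennreal ((\<phi> x)\<^sup>2) \<partial>lebesgue) = ennreal B"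
    unfolding AB(4)[symmetric]
  proof (rule nn_integral_cong_AE)
    show "AE x in lebesgue. (ennreal (norm (grad_w x)) / w x)\<^sup>2 * ennreal ((\<phi> x)\<^sup>2) * indicator \<Omega> x
        = ennreal ((norm ((\<phi> x / v x) *\<^sub>R G x))\<^sup>2)"
      using lim limit_pos[OF L p] limit_gradient_unique[OF L assms(6)]
    proof eventually_elim
      case (elim x)
      show ?case
      proof (cases "\<phi> x = 0")
        case False
        then have x: "x \<in> \<Omega>" "0 < v x" using z elim by auto
        then have "ennreal (norm (grad_w x)) / w x = ennreal (norm (G x) / v x)"
          using elim by (simp add: divide_ennreal)
        then have "(ennreal (norm (grad_w x)) / w x)\<^sup>2 * ennreal ((\<phi> x)\<^sup>2) = ennreal ((norm (G x) / v x)\<^sup>2 * (\<phi> x)\<^sup>2)"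
          using x by (simp add: ennreal_power ennreal_mult)
        also have "(norm (G x) / v x)\<^sup>2 * (\<phi> x)\<^sup>2 = (norm ((\<phi> x / v x) *\<^sub>R G x))\<^sup>2"
          by (simp add: norm_scaleR_sq power_divide del: norm_scaleR)
        finally show ?thesis using x by simp
      qed simp
    qed
  qed
  have 2: "(\<integral>\<^sup>+x\<in>\<Omega>. ennreal ((\<phi> x)\<^sup>2) / ennreal_powr (w x) (2 - q) \<partial>lebesgue) = ennreal A"
    unfolding AB(3)[symmetric]
  proof (rule nn_integral_cong_AE)
    show "AE x in lebesgue. ennreal ((\<phi> x)\<^sup>2) / ennreal_powr (w x) (2 - q) * indicator \<Omega> x
        = ennreal ((\<phi> x)\<^sup>2 / v x powr (2 - q))"
      using lim limit_pos[OF L p]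
    proof eventually_elim
      case (elim x)
      show ?case
      proof (cases "\<phi> x = 0")
        case False
        then have x: "x \<in> \<Omega>" "0 < v x" using z elim by auto
        then show ?thesis using elim by (simp add: ennreal_powr_def divide_ennreal)
      qed simp
    qed
  qed
  have 3: "(LINT x:\<Omega>|lebesgue. (norm (grad \<phi> x))\<^sup>2) = sqnorm lebesgue (grad \<phi>)"
    unfolding set_lebesgue_integral_def
    by (intro Bochner_Integration.integral_cong refl) (use z(2) in \<open>auto simp: indicator_def\<close>)
  define P where "P = sqnorm lebesgue (grad \<phi>)"
  have "1 / \<delta> * A \<le> 1 / \<delta> * (\<delta> * P + (1 / \<delta> - 1) * B)"
    using AB(5)[OF assms(8)] assms(8) by (intro mult_left_mono) (auto simp: P_def)
  also have "\<dots> = P - 1 / \<delta> * (1 - 1 / \<delta>) * B" using assms(8) by (simp add: field_simps)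
  finally have "1 / \<delta> * (1 - 1 / \<delta>) * B + 1 / \<delta> * A \<le> P" by simp
  then show ?thesis unfolding 1 2 3 P_def[symmetric] using AB(1,2) by (simp add: enn2ereal_ennreal)
qed

end
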